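(* Let $N\ge 2$, $s\in(0,1)$, and let $\Omega\subset\mathbb{R}^N$ be a bounded domain with $C^2$ boundary. Let $\rho_0\in L^\infty(\Omega)$ be such that $|\{\rho_0>0\}|>0$, and let $\mathcal{G}(\rho_0)$ be the class of rearrangements of $\rho_0$. Then: (i) there exists $\check{\rho}_1\in\mathcal{G}(\rho_0)$ such that $$\lambda_1(\check{\rho}_1)=\min_{\rho\in\mathcal{G}(\rho_0)}\lambda_1(\rho);$$ (ii) for every such minimizer $\check{\rho}_1$ there exists an increasing function $\psi$ such that $$\check{\rho}_1=\psi(u_{\check{\rho}_1})\quad\text{a.e. in }\Omega,$$ where $u_{\check{\rho}_1}$ is the positive first eigenfunction relative to $\lambda_1(\check{\rho}_1)$ normalized by $\|u_{\check{\rho}_1}\|_{H_0^s(\Omega)}=1$.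
   Context: $H_0^s(\Omega)=\{u\in H^s(\mathbb{R}^N): u=0 \text{ a.e. in } \mathbb{R}^N\setminus\Omega\}$ is a Hilbert space with inner product $\langle u,v\rangle_{H_0^s(\Omega)}=\int_{\mathbb{R}^{2N}}\frac{(u(x)-u(y))(v(x)-v(y))}{|x-y|^{N+2s}}\,dx\,dy$ and associated norm. For $\rho\in L^\infty(\Omega)$, an eigenvalue of the problem $(-\Delta)^su=\lambda\rho u$ in $\Omega$, $u=0$ in $\mathbb{R}^N\setminus\Omega$, is a $\lambda\in\mathbb{R}$ for which there is $u\in H_0^s(\Omega)\setminus\{0\}$ (an eigenfunction) with $\langle u,\varphi\rangle_{H_0^s(\Omega)}=\lambda\int_\Omega\rho u\varphi\,dx$ for all $\varphi\in H_0^s(\Omega)$. If $|\{\rho>0\}|>0$ (where $\{\rho>0\}=\{x\in\Omega:\rho(x)>0\}$ and $|\cdot|$ is Lebesgue measure), $\lambda_1(\rho)>0$ denotes the smallest positive eigenvalue; $1/\lambda_1(\rho)=\max_{f\in H_0^s(\Omega),\,f\neq0}\frac{\int_\Omega\rho f^2\,dx}{\|f\|^2_{H_0^s(\Omega)}}$. It is known to be simple with eigenfunctions of one sign in $\Omega$. Two measurable functions $f,g:\Omega\to\mathbb{R}$ are rearrangements of one another ($f\sim g$) if $|\{x\in\Omega:f(x)>t\}|=|\{x\in\Omega:g(x)>t\}|$ for all $t\in\mathbb{R}$; $\mathcal{G}(\rho_0)=\{g:\Omega\to\mathbb{R}\text{ measurable}: g\sim\rho_0\}$. "Increasing" is meant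 in the weak sense (nondecreasing). *)

theory Defs
  imports "HOL-Analysis.Analysis"
begin

text \<open>
  Elements of \<open>L\<^sup>\<infinity>(\<Omega>)\<close>, of the rearrangement classes and of the fractional Sobolev spaces are
  represented by functions on the whole space, with almost-everywhere equality stated explicitly.
  Functions that live on \<open>\<Omega>\<close> are only constrained through \<^term>\<open>lebesgue_on \<Omega>\<close>, so their values
  outside \<open>\<Omega>\<close> are irrelevant. The dimension \<open>N\<close> is \<open>DIM('a)\<close>.
\<close>

subsection \<open>Domains with C2 boundary\<close>

definition C2_function :: "('a::euclidean_space \<Rightarrow> real) \<Rightarrow> bool" where
  "C2_function f \<longleftrightarrow>
    (\<exists>(f' :: 'a \<Rightarrow> 'a \<Rightarrow>\<^sub>L real) (f'' :: 'a \<Rightarrow> 'a \<Rightarrow>\<^sub>L ('a \<Rightarrow>\<^sub>L real)).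
      (\<forall>x. (f has_derivative blinfun_apply (f' x)) (at x)) \<and>
      (\<forall>x. (f' has_derivative blinfun_apply (f'' x)) (at x)) \<and>
      continuous_on UNIV f'')"

text \<open>
  Near each boundary point, in suitable orthonormal coordinates, \<open>\<Omega>\<close> is the region above the graph
  of a C2 function of the first \<open>N - 1\<close> coordinates. The unit vector \<open>e\<close> is the last coordinate
  direction and \<open>x - (x \<bullet> e) *\<^sub>R e\<close> is the projection of \<open>x\<close> to the hyperplane of the remaining
  coordinates; only the values of \<open>\<gamma>\<close> on this hyperplane matter, and a C2 function on the
  hyperplane extends to a C2 function on the whole space that is constant along \<open>e\<close>.
\<close>

definition C2_boundary :: "'a::euclidean_space set \<Rightarrow> bool" where
  "C2_boundary \<Omega> \<longleftrightarrow>
    (\<forall>p\<in>frontier \<Omega>. \<exists>r>0. \<exists>e \<gamma>. norm e = 1 \<and> C2_function \<gamma> \<and>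
      \<Omega> \<inter> ball p r = {x \<in> ball p r. x \<bullet> e > \<gamma> (x - (x \<bullet> e) *\<^sub>R e)})"


subsection \<open>Fractional Sobolev spaces\<close>

definition Hs :: "real \<Rightarrow> ('a::euclidean_space \<Rightarrow> real) set" where
  "Hs s = {u. u \<in> borel_measurable lebesgue \<and>
      integrable lebesgue (\<lambda>x. (u x)\<^sup>2) \<and>
      integrable (lebesgue \<Otimes>\<^sub>M lebesgue)
        (\<lambda>(x, y). (u x - u y)\<^sup>2 / norm (x - y) powr (real DIM('a) + 2 * s))}"

definition H0s :: "real \<Rightarrow> 'a::euclidean_space set \<Rightarrow> ('a \<Rightarrow> real) set" where
  "H0s s \<Omega> = {u \<in> Hs s. AE x in lebesgue. x \<notin> \<Omega> \<longrightarrow> u x = 0}"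

definition H0s_inner :: "real \<Rightarrow> ('a::euclidean_space \<Rightarrow> real) \<Rightarrow> ('a \<Rightarrow> real) \<Rightarrow> real" where
  "H0s_inner s u v =
    (\<integral>(x, y). (u x - u y) * (v x - v y) / norm (x - y) powr (real DIM('a) + 2 * s)
      \<partial>(lebesgue \<Otimes>\<^sub>M lebesgue))"

definition H0s_norm :: "real \<Rightarrow> ('a::euclidean_space \<Rightarrow> real) \<Rightarrow> real" where
  "H0s_norm s u = sqrt (H0s_inner s u u)"


subsection \<open>The weighted eigenvalue problem\<close>

definition Linfty :: "'a::euclidean_space set \<Rightarrow> ('a \<Rightarrow> real) set" where
  "Linfty \<Omega> = {\<rho>. \<rho> \<in> borel_measurable (lebesgue_on \<Omega>) \<and>
      (\<exists>C. AE x in lebesgue_on \<Omega>. \<bar>\<rho> x\<bar> \<le> C)}"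

definition eigenfunction ::
    "real \<Rightarrow> 'a::euclidean_space set \<Rightarrow> ('a \<Rightarrow> real) \<Rightarrow> real \<Rightarrow> ('a \<Rightarrow> real) \<Rightarrow> bool" where
  "eigenfunction s \<Omega> \<rho> \<mu> u \<longleftrightarrow>
    u \<in> H0s s \<Omega> \<and> \<not> (AE x in lebesgue. u x = 0) \<and>
    (\<forall>\<phi>\<in>H0s s \<Omega>. H0s_inner s u \<phi> = \<mu> * (\<integral>x. \<rho> x * u x * \<phi> x \<partial>lebesgue_on \<Omega>))"

definition eigenvalue :: "real \<Rightarrow> 'a::euclidean_space set \<Rightarrow> ('a \<Rightarrow> real) \<Rightarrow> real \<Rightarrow> bool" where
  "eigenvalue s \<Omega> \<rho> \<mu> \<longleftrightarrow> (\<exists>u. eigenfunction s \<Omega> \<rho> \<mu> u)"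

text \<open>Meaningful for \<open>\<rho> \<in> Linfty \<Omega>\<close> that is positive on a set of positive measure: then the least
  positive eigenvalue exists.\<close>

definition lambda1 :: "real \<Rightarrow> 'a::euclidean_space set \<Rightarrow> ('a \<Rightarrow> real) \<Rightarrow> real" where
  "lambda1 s \<Omega> \<rho> = (LEAST \<mu>. \<mu> > 0 \<and> eigenvalue s \<Omega> \<rho> \<mu>)"

text \<open>The positive normalized first eigenfunction is unique only up to a null set; the choice
  operator selects a representative.\<close>

definition first_eigenfunction ::
    "real \<Rightarrow> 'a::euclidean_space set \<Rightarrow> ('a \<Rightarrow> real) \<Rightarrow> 'a \<Rightarrow> real" where
  "first_eigenfunction s \<Omega> \<rho> =
    (SOME u. eigenfunction s \<Omega> \<rho> (lambda1 s \<Omega> \<rho>) u \<and>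
      (AE x in lebesgue_on \<Omega>. u x > 0) \<and> H0s_norm s u = 1)"


subsection \<open>Rearrangements\<close>

definition rearrangements :: "'a::euclidean_space set \<Rightarrow> ('a \<Rightarrow> real) \<Rightarrow> ('a \<Rightarrow> real) set" where
  "rearrangements \<Omega> f = {g \<in> borel_measurable (lebesgue_on \<Omega>).
      \<forall>t. emeasure lebesgue {x \<in> \<Omega>. g x > t} = emeasure lebesgue {x \<in> \<Omega>. f x > t}}"

definition lambda1_minimizer ::
    "real \<Rightarrow> 'a::euclidean_space set \<Rightarrow> ('a \<Rightarrow> real) \<Rightarrow> ('a \<Rightarrow> real) \<Rightarrow> bool" where
  "lambda1_minimizer s \<Omega> \<rho>0 \<rho> \<longleftrightarrow>
    \<rho> \<in> rearrangements \<Omega> \<rho>0 \<and> (\<forall>\<sigma>\<in>rearrangements \<Omega> \<rho>0. lambda1 s \<Omega> \<rho> \<le> lambda1 s \<Omega> \<sigma>)"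

end

theory Submission imports Defs "HOL-Library.Diagonal_Subsequence" begin

text \<open>
  The number \<open>1 / \<lambda>\<^sub>1(\<rho>)\<close> is the maximum of the quadratic form \<open>\<integral> \<rho> u\<^sup>2\<close> over the unit sphere of
  \<open>H\<^sub>0\<^sup>s(\<Omega>)\<close>, so minimizing \<open>\<lambda>\<^sub>1\<close> over the rearrangements of \<open>\<rho>\<^sub>0\<close> means maximizing \<open>\<integral> \<rho> u\<^sup>2\<close>
  jointly in \<open>\<rho>\<close> and \<open>u\<close>.

  Existence. In a maximizing sequence \<open>(\<rho>\<^sub>n, u\<^sub>n)\<close> only the functions \<open>u\<^sub>n\<close> need a limit. The unit
  ball of \<open>H\<^sub>0\<^sup>s(\<Omega>)\<close> is compact in \<open>L\<^sup>2(\<Omega>)\<close> (\<open>H0s_compact_embedding\<close>), and the weights have a common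
  bound, so \<open>\<integral> \<rho>\<^sub>n u\<^sub>n\<^sup>2\<close> and \<open>\<integral> \<rho>\<^sub>n u\<^sup>2\<close> have the same limit for a suitable \<open>u\<close>. For this fixed \<open>u\<close>, a
  rearrangement of \<open>\<rho>\<^sub>0\<close> that is sorted like \<open>u\<^sup>2\<close> does at least as well as every \<open>\<rho>\<^sub>n\<close>
  (\<open>hardy_littlewood_maximizer\<close>); with it the supremum is attained (\<open>joint_maximizer_exists\<close>).

  Monotonicity. Let \<open>\<rho>\<close> be a minimizer with positive normalized first eigenfunction \<open>u\<close>. Every
  rearrangement \<open>\<sigma>\<close> satisfies \<open>\<integral> \<sigma> u\<^sup>2 \<le> 1 / \<lambda>\<^sub>1(\<sigma>) \<le> 1 / \<lambda>\<^sub>1(\<rho>) = \<integral> \<rho> u\<^sup>2\<close>. If equality holds, \<open>u\<close> is an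
  eigenfunction for \<open>\<sigma>\<close> with the same eigenvalue; subtracting the two weak equations gives
  \<open>(\<sigma> - \<rho>) u = 0\<close>, and \<open>\<sigma> = \<rho>\<close> because \<open>u > 0\<close> (\<open>common_maximizer_unique_weight\<close>). So \<open>\<rho>\<close> is the only
  maximizer of \<open>\<sigma> \<mapsto> \<integral> \<sigma> u\<^sup>2\<close>. If \<open>\<rho>\<close> were not a nondecreasing function of \<open>u\<^sup>2\<close>, then for some levels
  both \<open>{\<rho> > q, u\<^sup>2 \<le> c}\<close> and \<open>{\<rho> \<le> q, u\<^sup>2 \<ge> c}\<close> would have positive measure
  (\<open>monotone_representation\<close>), and exchanging the values of \<open>\<rho>\<close> between a piece of the first set and a
  translate of it inside the second would produce another rearrangement that does at least as well
  (\<open>swap_improves\<close>). Since ties are allowed here, this also rules out that \<open>\<rho>\<close> varies on a set where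
  \<open>u\<close> is constant, which the inequality alone could not exclude.

  Positivity of first eigenfunctions comes from \<open>strong_maximum_principle\<close>, which is easy for a
  nonlocal operator: at a zero of a nonnegative function \<open>u\<close> the fractional Laplacian is minus an
  integral of \<open>u\<close> against a positive kernel.
\<close>

section \<open>The Gagliardo form as an inner product of difference quotients\<close>

declare emeasure_completion [simp del]

lemma sigma_finite_lebesgue: "sigma_finite_measure (lebesgue :: 'a::euclidean_space measure)"
proof
  obtain A :: "'a set set" where A: "countable A" "A \<subseteq> sets lborel" "\<Union>A = space lborel"
      "\<forall>a\<in>A. emeasure lborel a \<noteq> \<infinity>"
    using lborel.sigma_finite_countable by blast
  show "\<exists>A::'a set set. countable A \<and> A \<subseteq> sets lebesgue \<and> \<Union>A = space lebesgue \<and>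
      (\<forall>a\<in>A. emeasure lebesgue a \<noteq> \<infinity>)"
    using A by (intro exI[of _ A]) (auto simp: emeasure_completion)
qed

interpretation leb: sigma_finite_measure "lebesgue :: 'a::euclidean_space measure"
  by (rule sigma_finite_lebesgue)

interpretation lebp: pair_sigma_finite "lebesgue :: 'a::euclidean_space measure"
    "lebesgue :: 'b::euclidean_space measure"
  by unfold_locales

abbreviation lebesgue_pair :: "('a::euclidean_space \<times> 'a) measure" where
  "lebesgue_pair \<equiv> lebesgue \<Otimes>\<^sub>M lebesgue"

definition square_integrable :: "'b measure \<Rightarrow> ('b \<Rightarrow> real) \<Rightarrow> bool" where
  "square_integrable M f \<longleftrightarrow> f \<in> borel_measurable M \<and> integrable M (\<lambda>x. (f x)\<^sup>2)"

lemma square_integrable_mult: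
  assumes "square_integrable M f" "square_integrable M g"
  shows "integrable M (\<lambda>x. f x * g x)"
proof (rule Bochner_Integration.integrable_bound)
  show "integrable M (\<lambda>x. (f x)\<^sup>2 + (g x)\<^sup>2)"
    using assms by (auto simp: square_integrable_def)
  show "(\<lambda>x. f x * g x) \<in> borel_measurable M"
    using assms by (auto simp: square_integrable_def)
  have "\<bar>a * b\<bar> \<le> a\<^sup>2 + b\<^sup>2" for a b :: real
  proof -
    have "2 * \<bar>a * b\<bar> \<le> a\<^sup>2 + b\<^sup>2"
      using sum_squares_bound[of "\<bar>a\<bar>" "\<bar>b\<bar>"] by (simp add: abs_mult)
    then show ?thesis by linarith
  qed
  then show "AE x in M. norm (f x * g x) \<le> norm ((f x)\<^sup>2 + (g x)\<^sup>2)"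
    by simp
qed

text \<open>
  Domination by a combination of two functions, because a product is controlled by two difference
  quotients, one for each factor.
\<close>
lemma square_integrable_bound:
  assumes "f \<in> borel_measurable M" "square_integrable M g" "square_integrable M h"
    and "AE x in M. \<bar>f x\<bar> \<le> a * \<bar>g x\<bar> + b * \<bar>h x\<bar>"
  shows "square_integrable M f"
  unfolding square_integrable_def
proof (intro conjI assms(1))
  show "integrable M (\<lambda>x. (f x)\<^sup>2)"
  proof (rule Bochner_Integration.integrable_bound)
    show "integrable M (\<lambda>x. 2 * a\<^sup>2 * (g x)\<^sup>2 + 2 * b\<^sup>2 * (h x)\<^sup>2)"
      using assms by (auto simp: square_integrable_def)
    show "(\<lambda>x. (f x)\<^sup>2) \<in> borel_measurable M"
      using assms(1) by measurable
    have *: "t\<^sup>2 \<le> 2 * a\<^sup>2 * p\<^sup>2 + 2 * b\<^sup>2 * q\<^sup>2" if "\<bar>t\<bar> \<le> a * \<bar>p\<bar> + b * \<bar>q\<bar>" for t p q :: real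
    proof -
      have "t\<^sup>2 \<le> (a * \<bar>p\<bar> + b * \<bar>q\<bar>)\<^sup>2"
        using that by (metis abs_ge_zero power2_abs power_mono)
      also have "\<dots> \<le> 2 * (a * \<bar>p\<bar>)\<^sup>2 + 2 * (b * \<bar>q\<bar>)\<^sup>2"
        using zero_le_power2[of "a * \<bar>p\<bar> - b * \<bar>q\<bar>"]
        by (simp add: power2_sum power2_diff algebra_simps del: zero_le_power2)
      finally show ?thesis by (simp add: power_mult_distrib)
    qed
    show "AE x in M. norm ((f x)\<^sup>2) \<le> norm (2 * a\<^sup>2 * (g x)\<^sup>2 + 2 * b\<^sup>2 * (h x)\<^sup>2)"
      using assms(4) by eventually_elim (use * in auto)
  qed
qed

lemma square_integrable_lincomb:
  assumes "square_integrable M g" "square_integrable M h"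
  shows "square_integrable M (\<lambda>x. a * g x + b * h x)"
proof (rule square_integrable_bound[OF _ assms, of _ "\<bar>a\<bar>" "\<bar>b\<bar>"])
  show "(\<lambda>x. a * g x + b * h x) \<in> borel_measurable M"
    using assms by (auto simp: square_integrable_def)
  show "AE x in M. \<bar>a * g x + b * h x\<bar> \<le> \<bar>a\<bar> * \<bar>g x\<bar> + \<bar>b\<bar> * \<bar>h x\<bar>"
    by (auto simp flip: abs_mult)
qed

text \<open>
  The square root of the kernel is put into the difference, so that the Gagliardo form becomes the
  plain inner product of \<open>L\<^sup>2\<close> on the product space, applied to functions that depend linearly on \<open>u\<close>.
\<close>
definition diff_quotient :: "real \<Rightarrow> ('a::euclidean_space \<Rightarrow> real) \<Rightarrow> 'a \<times> 'a \<Rightarrow> real" where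
  "diff_quotient s u z = (u (fst z) - u (snd z)) / norm (fst z - snd z) powr (real DIM('a) / 2 + s)"

lemma kernel_split:
  "norm (x - y :: 'a::euclidean_space) powr (real DIM('a) + 2 * s)
    = (norm (x - y) powr (real DIM('a) / 2 + s))\<^sup>2"
  by (simp add: power2_eq_square flip: powr_add)

lemma H0s_inner_eq:
  "H0s_inner s u v = (\<integral>z. diff_quotient s u z * diff_quotient s v z \<partial>lebesgue_pair)"
  unfolding H0s_inner_def diff_quotient_def kernel_split case_prod_beta power2_eq_square by simp

lemma Hs_iff:
  "u \<in> Hs s \<longleftrightarrow> square_integrable lebesgue u \<and> integrable lebesgue_pair (\<lambda>z. (diff_quotient s u z)\<^sup>2)"
  unfolding Hs_def diff_quotient_def kernel_split case_prod_beta square_integrable_def power_divide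
  by simp

lemma measurable_fst_lebesgue [measurable]: "fst \<in> lebesgue_pair \<rightarrow>\<^sub>M borel"
  and measurable_snd_lebesgue [measurable]: "snd \<in> lebesgue_pair \<rightarrow>\<^sub>M borel"
  by (rule measurable_compose[OF measurable_fst] measurable_compose[OF measurable_snd];
      simp add: measurable_completion)+

lemma diff_quotient_measurable [measurable]:
  assumes [measurable]: "u \<in> borel_measurable lebesgue"
  shows "diff_quotient s u \<in> borel_measurable lebesgue_pair"
  unfolding diff_quotient_def by measurable

lemma H0s_iff:
  "u \<in> H0s s \<Omega> \<longleftrightarrow> square_integrable lebesgue u \<and> square_integrable lebesgue_pair (diff_quotient s u)
    \<and> (AE x in lebesgue. x \<notin> \<Omega> \<longrightarrow> u x = 0)"
  unfolding H0s_def mem_Collect_eq Hs_iff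
  by (auto simp: square_integrable_def intro: diff_quotient_measurable)

lemma diff_quotient_lincomb:
  "diff_quotient s (\<lambda>x. a * u x + b * v x) z = a * diff_quotient s u z + b * diff_quotient s v z"
  by (simp add: diff_quotient_def algebra_simps add_divide_distrib diff_divide_distrib)

lemma H0s_lincomb:
  assumes "u \<in> H0s s \<Omega>" "v \<in> H0s s \<Omega>"
  shows "(\<lambda>x. a * u x + b * v x) \<in> H0s s \<Omega>"
  using assms unfolding H0s_iff diff_quotient_lincomb[abs_def]
  by (auto intro!: square_integrable_lincomb)

lemma H0s_zero: "(\<lambda>x. 0) \<in> H0s s \<Omega>"
  by (simp add: H0s_iff square_integrable_def diff_quotient_def)

text \<open>
  Absolute values, and products of a bounded function with a truncation of another one, stay in the
  space by this criterion, with one term of the bound for each factor.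
\<close>
lemma H0s_comparison:
  assumes "v \<in> borel_measurable lebesgue" "AE x in lebesgue. x \<notin> \<Omega> \<longrightarrow> v x = 0"
    and u: "u \<in> H0s s \<Omega>" and w: "w \<in> H0s s \<Omega>"
    and "\<And>x. \<bar>v x\<bar> \<le> a * \<bar>u x\<bar> + b * \<bar>w x\<bar>"
    and d: "\<And>x y. \<bar>v x - v y\<bar> \<le> a * \<bar>u x - u y\<bar> + b * \<bar>w x - w y\<bar>"
  shows "v \<in> H0s s \<Omega>"
  unfolding H0s_iff
proof (intro conjI assms(2))
  show "square_integrable lebesgue v"
    by (rule square_integrable_bound[of _ _ u w a b]) (use assms in \<open>auto simp: H0s_iff\<close>)
  show "square_integrable lebesgue_pair (diff_quotient s v)"
  proof (rule square_integrable_bound[of _ _ "diff_quotient s u" "diff_quotient s w" a b])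
    have "\<bar>diff_quotient s v z\<bar> \<le> a * \<bar>diff_quotient s u z\<bar> + b * \<bar>diff_quotient s w z\<bar>" for z
      using divide_right_mono[OF d[of "fst z" "snd z"], of "norm (fst z - snd z) powr (real DIM('a) / 2 + s)"]
      by (simp add: diff_quotient_def add_divide_distrib)
    then show "AE z in lebesgue_pair.
        \<bar>diff_quotient s v z\<bar> \<le> a * \<bar>diff_quotient s u z\<bar> + b * \<bar>diff_quotient s w z\<bar>"
      by simp
  qed (use assms in \<open>auto simp: H0s_iff intro: diff_quotient_measurable\<close>)
qed

lemma H0s_inner_integrable:
  assumes "u \<in> H0s s \<Omega>" "v \<in> H0s s \<Omega>"
  shows "integrable lebesgue_pair (\<lambda>z. diff_quotient s u z * diff_quotient s v z)"
  using assms by (auto simp: H0s_iff intro: square_integrable_mult)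

lemma H0s_inner_self_nonneg: "0 \<le> H0s_inner s u u"
  unfolding H0s_inner_eq by (intro integral_nonneg_AE) auto

lemma H0s_inner_lincomb_self:
  assumes u: "u \<in> H0s s \<Omega>" and v: "v \<in> H0s s \<Omega>"
  shows "H0s_inner s (\<lambda>x. a * u x + b * v x) (\<lambda>x. a * u x + b * v x)
     = a\<^sup>2 * H0s_inner s u u + 2 * a * b * H0s_inner s u v + b\<^sup>2 * H0s_inner s v v"
proof -
  note I = H0s_inner_integrable[OF u u] H0s_inner_integrable[OF u v] H0s_inner_integrable[OF v v]
  have "(\<lambda>z. diff_quotient s (\<lambda>x. a * u x + b * v x) z * diff_quotient s (\<lambda>x. a * u x + b * v x) z)
      = (\<lambda>z. a\<^sup>2 * (diff_quotient s u z * diff_quotient s u z)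
          + 2 * a * b * (diff_quotient s u z * diff_quotient s v z)
          + b\<^sup>2 * (diff_quotient s v z * diff_quotient s v z))"
    unfolding diff_quotient_lincomb by (auto simp: algebra_simps power2_eq_square)
  then show ?thesis
    unfolding H0s_inner_eq using I by simp
qed

lemma energy_eq:
  assumes "u \<in> H0s s \<Omega>"
  shows "(\<integral>\<^sup>+z. ennreal ((diff_quotient s u z)\<^sup>2) \<partial>lebesgue_pair) = ennreal (H0s_inner s u u)"
  using assms unfolding H0s_inner_eq H0s_iff square_integrable_def
  by (subst nn_integral_eq_integral) (auto simp: power2_eq_square)

text \<open>
  Fatou's lemma bounds the energy of a limit as a nonnegative integral; this turns such a bound into
  membership and a bound of the norm.
\<close>
lemma H0s_inner_le_energy:
  assumes "u \<in> borel_measurable lebesgue" "0 \<le> c"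
    and "(\<integral>\<^sup>+z. ennreal ((diff_quotient s u z)\<^sup>2) \<partial>lebesgue_pair) \<le> ennreal c"
  shows "square_integrable lebesgue_pair (diff_quotient s u)" "H0s_inner s u u \<le> c"
proof -
  have "integrable lebesgue_pair (\<lambda>z. (diff_quotient s u z)\<^sup>2)"
    using assms(3) order.strict_trans1[OF assms(3) ennreal_less_top]
    by (intro integrableI_bounded) (use assms(1) in auto)
  then show 1: "square_integrable lebesgue_pair (diff_quotient s u)"
    using assms(1) by (auto simp: square_integrable_def)
  then have "ennreal (H0s_inner s u u) \<le> ennreal c"
    using assms(3) unfolding H0s_inner_eq square_integrable_def
    by (subst (asm) nn_integral_eq_integral) (auto simp: power2_eq_square)
  then show "H0s_inner s u u \<le> c"
    using assms(2) by (simp add: ennreal_le_iff)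
qed

section \<open>Lipschitz functions in fractional Sobolev spaces\<close>

text \<open>
  Each ball of radius \<open>r k\<close> has measure proportional to \<open>r k ^ N\<close>, so a function that is at most \<open>a k\<close>
  on the \<open>k\<close>-th shell is dominated by a convergent sum of multiples of indicators of balls.
\<close>
lemma nn_integral_shells_finite:
  fixes f :: "'a::euclidean_space \<Rightarrow> ennreal"
  assumes a: "\<And>k. 0 \<le> a k" and r: "\<And>k. 0 \<le> r k"
    and sm: "summable (\<lambda>k. a k * r k ^ DIM('a))"
    and cover: "\<And>z. f z \<noteq> 0 \<Longrightarrow> \<exists>k. norm z \<le> r k \<and> f z \<le> ennreal (a k)"
  shows "(\<integral>\<^sup>+z. f z \<partial>lebesgue) < \<infinity>"
proof -
  have "f z \<le> (\<Sum>k. ennreal (a k) * indicator (cball 0 (r k)) z)" for z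
  proof (cases "f z = 0")
    case False
    then obtain k where k: "norm z \<le> r k" "f z \<le> ennreal (a k)"
      using cover by blast
    have "f z \<le> (\<Sum>i\<in>{k}. ennreal (a i) * indicator (cball 0 (r i)) z)"
      using k by simp
    also have "\<dots> \<le> (\<Sum>k. ennreal (a k) * indicator (cball 0 (r k)) z)"
      by (rule sum_le_suminf) auto
    finally show ?thesis .
  qed simp
  then have "(\<integral>\<^sup>+z. f z \<partial>lebesgue)
      \<le> (\<integral>\<^sup>+z. (\<Sum>k. ennreal (a k) * indicator (cball 0 (r k)) z) \<partial>(lebesgue :: 'a measure))"
    by (intro nn_integral_mono)
  also have "\<dots> = (\<Sum>k. \<integral>\<^sup>+z. ennreal (a k) * indicator (cball 0 (r k)) z \<partial>(lebesgue :: 'a measure))"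
    by (rule nn_integral_suminf) (intro borel_measurable_times_ennreal borel_measurable_indicator; simp)
  also have "\<dots> = (\<Sum>k. ennreal (unit_ball_vol (real DIM('a)) * (a k * r k ^ DIM('a))))"
  proof (rule arg_cong[of _ _ suminf], rule ext)
    fix k
    have "emeasure lebesgue (cball (0 :: 'a) (r k)) = ennreal (unit_ball_vol (real DIM('a)) * r k ^ DIM('a))"
      using r by (simp add: emeasure_completion emeasure_cball)
    then show "(\<integral>\<^sup>+z. ennreal (a k) * indicator (cball 0 (r k)) z \<partial>(lebesgue :: 'a measure))
        = ennreal (unit_ball_vol (real DIM('a)) * (a k * r k ^ DIM('a)))"
      using a[of k] r[of k]
      by (simp add: nn_integral_cmult_indicator mult.left_commute flip: ennreal_mult)
  qed
  also have "\<dots> = ennreal (\<Sum>k. unit_ball_vol (real DIM('a)) * (a k * r k ^ DIM('a)))"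
  proof (rule suminf_ennreal2)
    show "0 \<le> unit_ball_vol (real DIM('a)) * (a k * r k ^ DIM('a))" for k
      using a[of k] r[of k] by simp
    show "summable (\<lambda>k. unit_ball_vol (real DIM('a)) * (a k * r k ^ DIM('a)))"
      by (rule summable_mult[OF sm])
  qed
  finally show ?thesis
    by (rule order.strict_trans1) simp
qed

text \<open>
  For a bounded Lipschitz function, \<open>(v x - v y)\<^sup>2\<close> is at most a multiple of
  \<open>min 1 (norm (x - y)\<^sup>2)\<close>. This is the kernel of the Gagliardo form multiplied by that bound.
\<close>
definition truncated_kernel :: "real \<Rightarrow> 'a::euclidean_space \<Rightarrow> real" where
  "truncated_kernel s z = min 1 ((norm z)\<^sup>2) / norm z powr (real DIM('a) + 2 * s)"

lemma truncated_kernel_measurable [measurable]: "truncated_kernel s \<in> borel_measurable borel"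
  unfolding truncated_kernel_def by measurable

text \<open>
  On dyadic shells the integral is a geometric series: near the origin its ratio is \<open>2 powr (2 * s - 2)\<close>,
  which needs \<open>s < 1\<close>, and near infinity it is \<open>2 powr (- 2 * s)\<close>, which needs \<open>s > 0\<close>.
\<close>
lemma truncated_kernel_finite:
  assumes s: "0 < s" "s < 1"
  shows "(\<integral>\<^sup>+z. ennreal (truncated_kernel s z) \<partial>(lebesgue :: 'a::euclidean_space measure)) < \<infinity>"
proof -
  define p where "p = real DIM('a) + 2 * s"
  have q: "(2 powr x) ^ n = (2 :: real) powr (real n * x)" for x n
    by (simp add: powr_power)
  define inner where "inner z = ennreal (truncated_kernel s z) * indicator (ball 0 1) z" for z :: 'a
  define outer where "outer z = ennreal (truncated_kernel s z) * indicator (- ball 0 1) z" for z :: 'a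
  have "(\<integral>\<^sup>+z. inner z \<partial>lebesgue) < \<infinity>"
  proof (rule nn_integral_shells_finite)
    fix k :: nat
    show "0 \<le> ((1/2) ^ k)\<^sup>2 / ((1/2) ^ Suc k) powr p" and "0 \<le> (1/2 :: real) ^ k" by auto
  next
    have eq: "((1/2) ^ k)\<^sup>2 / ((1/2) ^ Suc k) powr p * ((1/2) ^ k) ^ DIM('a)
        = 2 powr p * (2 powr (2 * s - 2)) ^ k" for k :: nat
    proof -
      have e: "(1/2 :: real) ^ n = 2 powr (- real n)" for n
        by (simp add: powr_minus powr_realpow power_divide inverse_eq_divide)
      have "((1/2) ^ k)\<^sup>2 / ((1/2) ^ Suc k) powr p * ((1/2) ^ k) ^ DIM('a)
          = 2 powr (2 * - real k) / 2 powr (- real (Suc k) * p) * 2 powr (real DIM('a) * - real k)"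
        unfolding e powr_powr q by simp
      also have "\<dots> = 2 powr (2 * - real k - - real (Suc k) * p + real DIM('a) * - real k)"
        by (simp only: powr_add powr_diff)
      also have "2 * - real k - - real (Suc k) * p + real DIM('a) * - real k = p + real k * (2 * s - 2)"
        by (simp add: p_def algebra_simps)
      also have "2 powr (p + real k * (2 * s - 2)) = 2 powr p * (2 powr (2 * s - 2)) ^ k"
        unfolding q powr_add by simp
      finally show ?thesis .
    qed
    have "norm (2 powr (2 * s - 2)) < (1 :: real)"
      using s powr_less_mono[of "2 * s - 2" 0 2] by simp
    then show "summable (\<lambda>k. ((1/2) ^ k)\<^sup>2 / ((1/2) ^ Suc k) powr p * ((1/2) ^ k) ^ DIM('a))"
      unfolding eq by (intro summable_mult[OF summable_geometric])
  next
    fix z :: 'a assume "inner z \<noteq> 0"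
    then have z: "norm z < 1" "z \<noteq> 0"
      by (auto simp: inner_def truncated_kernel_def split: split_indicator_asm)
    then obtain n0 where "(1/2) ^ n0 < norm z"
      using real_arch_pow_inv[of "norm z" "1/2"] by auto
    define n where "n = (LEAST n. (1/2) ^ n < norm z)"
    have n: "(1/2) ^ n < norm z"
      unfolding n_def by (rule LeastI) fact
    obtain k where k: "n = Suc k"
      using n z(1) by (cases n) auto
    have le: "norm z \<le> (1/2) ^ k"
      using not_less_Least[of k "\<lambda>n. (1/2) ^ n < norm z"] k unfolding n_def by linarith
    have "truncated_kernel s z \<le> ((1/2) ^ k)\<^sup>2 / ((1/2) ^ Suc k) powr p"
      unfolding truncated_kernel_def p_def[symmetric]
    proof (rule frac_le)
      show "min 1 ((norm z)\<^sup>2) \<le> ((1/2) ^ k)\<^sup>2"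
        using power_mono[OF le, of 2] by (simp add: min.coboundedI2)
      show "((1/2) ^ Suc k) powr p \<le> norm z powr p"
        using n k s by (intro powr_mono2) (auto simp: p_def)
    qed auto
    then show "\<exists>k. norm z \<le> (1/2) ^ k \<and> inner z \<le> ennreal (((1/2) ^ k)\<^sup>2 / ((1/2) ^ Suc k) powr p)"
      using le z by (intro exI[of _ k]) (auto simp: inner_def intro: ennreal_leI)
  qed
  moreover have "(\<integral>\<^sup>+z. outer z \<partial>lebesgue) < \<infinity>"
  proof (rule nn_integral_shells_finite)
    fix k :: nat
    show "0 \<le> 1 / (2 ^ k) powr p" and "0 \<le> (2 :: real) ^ Suc k" by auto
  next
    have eq: "1 / (2 ^ k) powr p * (2 ^ Suc k) ^ DIM('a)
        = 2 powr (real DIM('a)) * (2 powr (- 2 * s)) ^ k" for k :: nat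
    proof -
      have e: "(2 :: real) ^ n = 2 powr (real n)" for n
        by (simp add: powr_realpow)
      have "1 / (2 ^ k) powr p * (2 ^ Suc k) ^ DIM('a)
          = 1 / 2 powr (real k * p) * 2 powr (real DIM('a) * real (Suc k))"
        unfolding e powr_powr q by simp
      also have "1 / 2 powr (real k * p) = 2 powr (- (real k * p))"
        by (simp add: powr_minus_divide)
      also have "2 powr (- (real k * p)) * 2 powr (real DIM('a) * real (Suc k))
          = 2 powr (- (real k * p) + real DIM('a) * real (Suc k))"
        by (simp only: powr_add)
      also have "- (real k * p) + real DIM('a) * real (Suc k) = real DIM('a) + real k * (- 2 * s)"
        by (simp add: p_def algebra_simps)
      also have "2 powr (real DIM('a) + real k * (- 2 * s))
          = 2 powr (real DIM('a)) * (2 powr (- 2 * s)) ^ k"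
        unfolding q powr_add by simp
      finally show ?thesis .
    qed
    have "norm (2 powr (- 2 * s)) < (1 :: real)"
      using s powr_less_mono[of "- 2 * s" 0 2] by simp
    then show "summable (\<lambda>k. 1 / (2 ^ k) powr p * (2 ^ Suc k) ^ DIM('a))"
      unfolding eq by (intro summable_mult[OF summable_geometric])
  next
    fix z :: 'a assume "outer z \<noteq> 0"
    then have z: "norm z \<ge> 1"
      by (auto simp: outer_def truncated_kernel_def split: split_indicator_asm)
    obtain n0 where "norm z < 2 ^ n0"
      using real_arch_pow[of 2 "norm z"] by auto
    define n where "n = (LEAST n. norm z < 2 ^ n)"
    have n: "norm z < 2 ^ n"
      unfolding n_def by (rule LeastI) fact
    obtain k where k: "n = Suc k"
      using n z by (cases n) auto
    have le: "2 ^ k \<le> norm z"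
      using not_less_Least[of k "\<lambda>n. norm z < 2 ^ n"] k unfolding n_def by linarith
    have "truncated_kernel s z \<le> 1 / (2 ^ k) powr p"
      unfolding truncated_kernel_def p_def[symmetric]
    proof (rule frac_le)
      show "(2 ^ k) powr p \<le> norm z powr p"
        using le s by (intro powr_mono2) (auto simp: p_def)
    qed auto
    then show "\<exists>k. norm z \<le> 2 ^ Suc k \<and> outer z \<le> ennreal (1 / (2 ^ k) powr p)"
      using n k z by (intro exI[of _ k]) (auto simp: outer_def intro: ennreal_leI)
  qed
  moreover have "(\<integral>\<^sup>+z. ennreal (truncated_kernel s z) \<partial>(lebesgue :: 'a measure))
      = (\<integral>\<^sup>+z. inner z + outer z \<partial>lebesgue)"
    by (intro nn_integral_cong) (auto simp: inner_def outer_def split: split_indicator)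
  moreover have "\<dots> = (\<integral>\<^sup>+z. inner z \<partial>lebesgue) + (\<integral>\<^sup>+z. outer z \<partial>lebesgue)"
    unfolding inner_def outer_def
    by (intro nn_integral_add measurable_completion borel_measurable_times_ennreal
        borel_measurable_indicator) auto
  ultimately show ?thesis
    by simp
qed

lemma nn_integral_lebesgue_translate:
  fixes f :: "'a::euclidean_space \<Rightarrow> ennreal"
  assumes "f \<in> borel_measurable borel"
  shows "(\<integral>\<^sup>+y. f (x + y) \<partial>lebesgue) = (\<integral>\<^sup>+y. f y \<partial>lebesgue)"
proof -
  have "(\<integral>\<^sup>+y. f y \<partial>lborel) = (\<integral>\<^sup>+y. f y \<partial>distr lborel borel ((+) x))"
    by (subst lborel_distr_plus) simp
  also have "\<dots> = (\<integral>\<^sup>+y. f (x + y) \<partial>lborel)"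
    using assms by (subst nn_integral_distr) auto
  finally show ?thesis
    by (simp add: nn_integral_completion)
qed

lemma truncated_kernel_translate:
  fixes x :: "'a::euclidean_space"
  shows "(\<integral>\<^sup>+y. ennreal (truncated_kernel s (x - y)) \<partial>lebesgue)
    = (\<integral>\<^sup>+y. ennreal (truncated_kernel s y) \<partial>(lebesgue :: 'a measure))"
proof -
  have "truncated_kernel s (x - y) = truncated_kernel s (- x + y)" for y
    using norm_minus_commute[of x y] by (simp add: truncated_kernel_def)
  then show ?thesis
    using nn_integral_lebesgue_translate[of "\<lambda>y. ennreal (truncated_kernel s y)" "- x"]
    by (simp only:) measurable
qed

text \<open>
  A pair \<open>(x, y)\<close> contributes to the energy only if one of the points lies in \<open>\<Omega>\<close>; integrating the
  other one first leaves the measure of \<open>\<Omega>\<close> times the integral of the truncated kernel, twice.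
\<close>
lemma lipschitz_in_H0s:
  fixes v :: "'a::euclidean_space \<Rightarrow> real"
  assumes s: "0 < s" "s < 1" and \<Omega>: "\<Omega> \<in> lmeasurable"
    and lip: "\<And>x y. \<bar>v x - v y\<bar> \<le> L * norm (x - y)"
    and bd: "\<And>x. \<bar>v x\<bar> \<le> C" and zero: "\<And>x. x \<notin> \<Omega> \<Longrightarrow> v x = 0"
  shows "v \<in> H0s s \<Omega>"
proof -
  have C: "0 \<le> C" using bd[of undefined] by linarith
  have "continuous_on UNIV v"
  proof (rule continuous_on_subset[OF Lipschitz.lipschitz_on_continuous_on[of "\<bar>L\<bar>"]])
    show "\<bar>L\<bar>-lipschitz_on UNIV v"
    proof (rule lipschitz_onI)
      show "dist (v x) (v y) \<le> \<bar>L\<bar> * dist x y" for x y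
        using lip[of x y] mult_right_mono[OF abs_ge_self[of L], of "norm (x - y)"]
        by (simp add: dist_norm)
    qed simp
  qed auto
  then have v[measurable]: "v \<in> borel_measurable lebesgue"
    by (intro measurable_completion) (simp add: borel_measurable_continuous_onI)
  have [measurable]: "\<Omega> \<in> sets lebesgue" using \<Omega> by auto
  have fin: "emeasure lebesgue \<Omega> < \<infinity>" using \<Omega> by (simp add: fmeasurable_def)
  have sq: "square_integrable lebesgue v"
  proof -
    have "integrable lebesgue (\<lambda>x. C\<^sup>2 * indicator \<Omega> x)"
      using fin by (intro integrable_mult_right integrable_real_indicator) auto
    moreover have "(v x)\<^sup>2 \<le> C\<^sup>2" for x
      using power_mono[OF bd[of x], of 2] by simp
    then have "AE x in lebesgue. norm ((v x)\<^sup>2) \<le> norm (C\<^sup>2 * indicator \<Omega> x)"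
      using zero by (auto split: split_indicator)
    ultimately have "integrable lebesgue (\<lambda>x. (v x)\<^sup>2)"
      by (rule Bochner_Integration.integrable_bound[OF _ borel_measurable_power[OF v]])
    then show ?thesis
      using v by (simp add: square_integrable_def)
  qed
  define I where "I = (\<integral>\<^sup>+y. ennreal (truncated_kernel s y) \<partial>(lebesgue :: 'a measure))"
  define K where "K = max (L\<^sup>2) ((2 * C)\<^sup>2)"
  have K: "0 \<le> K" by (simp add: K_def le_max_iff_disj)
  have pt: "ennreal ((diff_quotient s v (x, y))\<^sup>2)
      \<le> ennreal K * (indicator \<Omega> x * ennreal (truncated_kernel s (x - y)))
        + ennreal K * (indicator \<Omega> y * ennreal (truncated_kernel s (x - y)))" for x y
  proof (cases "x \<in> \<Omega> \<or> y \<in> \<Omega>")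
    case True
    have "(v x - v y)\<^sup>2 \<le> (L * norm (x - y))\<^sup>2"
      using power_mono[OF lip[of x y], of 2] by simp
    moreover have "\<bar>v x - v y\<bar> \<le> 2 * C"
      using bd[of x] bd[of y] by linarith
    then have "(v x - v y)\<^sup>2 \<le> (2 * C)\<^sup>2"
      using power_mono[of "\<bar>v x - v y\<bar>" "2 * C" 2] by simp
    moreover have "L\<^sup>2 * (norm (x - y))\<^sup>2 \<le> K * (norm (x - y))\<^sup>2"
      by (intro mult_right_mono) (auto simp: K_def)
    moreover have "(2 * C)\<^sup>2 \<le> K" by (simp add: K_def)
    ultimately have "(v x - v y)\<^sup>2 \<le> K * min 1 ((norm (x - y))\<^sup>2)"
      by (simp add: power_mult_distrib min_def)
    then have "(diff_quotient s v (x, y))\<^sup>2 \<le> K * truncated_kernel s (x - y)"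
      by (simp add: diff_quotient_def truncated_kernel_def kernel_split power_divide divide_right_mono)
    then have "ennreal ((diff_quotient s v (x, y))\<^sup>2) \<le> ennreal K * ennreal (truncated_kernel s (x - y))"
      using K by (simp add: ennreal_leI truncated_kernel_def flip: ennreal_mult)
    then show ?thesis
      using True by (auto split: split_indicator intro: order_trans)
  qed (simp add: diff_quotient_def zero)
  have [measurable]: "(\<lambda>z. fst z - snd z) \<in> lebesgue_pair \<rightarrow>\<^sub>M (borel :: 'a measure)"
    by measurable
  have [measurable]: "(\<lambda>y. truncated_kernel s (x - y)) \<in> borel_measurable lebesgue" for x :: 'a
    by (intro measurable_completion) measurable
  have i1: "(\<integral>\<^sup>+z. indicator \<Omega> (fst z) * ennreal (truncated_kernel s (fst z - snd z)) \<partial>lebesgue_pair)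
      = emeasure lebesgue \<Omega> * I"
    by (subst leb.nn_integral_fst[symmetric])
      (auto simp: nn_integral_cmult truncated_kernel_translate nn_integral_multc
        simp flip: I_def)
  have i2: "(\<integral>\<^sup>+z. indicator \<Omega> (snd z) * ennreal (truncated_kernel s (fst z - snd z)) \<partial>lebesgue_pair)
      = emeasure lebesgue \<Omega> * I"
  proof -
    have "(\<integral>\<^sup>+z. indicator \<Omega> (snd z) * ennreal (truncated_kernel s (fst z - snd z)) \<partial>lebesgue_pair)
        = (\<integral>\<^sup>+y. \<integral>\<^sup>+x. indicator \<Omega> y * ennreal (truncated_kernel s (x - y)) \<partial>lebesgue \<partial>lebesgue)"
      by (subst lebp.nn_integral_snd[symmetric]) auto
    also have "\<dots> = (\<integral>\<^sup>+y. \<integral>\<^sup>+x. indicator \<Omega> y * ennreal (truncated_kernel s (y - x)) \<partial>lebesgue \<partial>lebesgue)"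
      by (simp add: truncated_kernel_def norm_minus_commute)
    also have "\<dots> = emeasure lebesgue \<Omega> * I"
      by (auto simp: nn_integral_cmult truncated_kernel_translate nn_integral_multc simp flip: I_def)
    finally show ?thesis .
  qed
  have "(\<integral>\<^sup>+z. ennreal ((diff_quotient s v z)\<^sup>2) \<partial>lebesgue_pair)
      \<le> (\<integral>\<^sup>+z. ennreal K * (indicator \<Omega> (fst z) * ennreal (truncated_kernel s (fst z - snd z)))
        + ennreal K * (indicator \<Omega> (snd z) * ennreal (truncated_kernel s (fst z - snd z))) \<partial>lebesgue_pair)"
    using pt by (intro nn_integral_mono) (metis prod.collapse)
  also have "\<dots> = ennreal K * (emeasure lebesgue \<Omega> * I) + ennreal K * (emeasure lebesgue \<Omega> * I)"
    by (subst nn_integral_add) (auto simp: nn_integral_cmult i1 i2)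
  also have "\<dots> < \<infinity>"
    using fin truncated_kernel_finite[OF s, where 'a='a]
    by (auto simp: I_def ennreal_mult_less_top ennreal_add_less_top)
  finally have "square_integrable lebesgue_pair (diff_quotient s v)"
    unfolding square_integrable_def by (intro conjI integrableI_bounded) auto
  then show ?thesis
    using sq zero by (simp add: H0s_iff)
qed

section \<open>Bump functions and the Poincare inequality\<close>

lemma closed_subset_positive_measure:
  assumes S: "S \<in> lmeasurable" and pos: "emeasure lebesgue S \<noteq> 0"
  shows "\<exists>T. closed T \<and> T \<subseteq> S \<and> emeasure lebesgue T \<noteq> 0"
proof -
  have Ss: "S \<in> sets lebesgue" and fin: "emeasure lebesgue S \<noteq> \<infinity>"
    using S by (auto simp: fmeasurableD fmeasurableD2)
  have "0 < measure lebesgue S"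
    using pos fin by (auto simp: measure_def enn2real_positive_iff less_top zero_less_iff_neq_zero)
  then obtain T where T: "closed T" "T \<subseteq> S" "emeasure lebesgue (S - T) < ennreal (measure lebesgue S)"
    using sets_lebesgue_inner_closed[OF Ss] by metis
  have "emeasure lebesgue T \<noteq> 0"
  proof
    assume "emeasure lebesgue T = 0"
    then have "emeasure lebesgue (S - T) = emeasure lebesgue S"
      using T(1) Ss by (intro emeasure_Diff_null_set) (auto simp: null_sets_def)
    then show False
      using T(3) fin by (simp add: emeasure_eq_ennreal_measure)
  qed
  then show ?thesis using T by blast
qed

lemma H0s_measurable:
  assumes "u \<in> H0s s \<Omega>"
  shows "u \<in> borel_measurable lebesgue" and "u \<in> borel_measurable (lebesgue_on A)"
  using assms by (auto simp: H0s_iff square_integrable_def intro: measurable_restrict_space1)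

locale fractional_domain =
  fixes \<Omega> :: "'a::euclidean_space set" and s :: real
  assumes s_pos: "0 < s" and s_less: "s < 1" and open_domain: "open \<Omega>" and bounded_domain: "bounded \<Omega>"
begin

abbreviation "M \<equiv> lebesgue_on \<Omega>"

lemma domain_sets [measurable]: "\<Omega> \<in> sets lebesgue"
  using open_domain by auto

lemma domain_lmeasurable: "\<Omega> \<in> lmeasurable"
  using open_domain bounded_domain by (simp add: lmeasurable_open)

sublocale M: finite_measure M
  by (rule finite_measure_lebesgue_on[OF domain_lmeasurable])

lemma H0s_on:
  assumes "u \<in> H0s s \<Omega>"
  shows "square_integrable M u"
  using assms domain_sets integrable_mult_indicator[of \<Omega> lebesgue "\<lambda>x. (u x)\<^sup>2"]
  by (auto simp: H0s_iff square_integrable_def integrable_restrict_space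
      intro: measurable_restrict_space1)

lemma integral_H0s_square_on:
  assumes u: "u \<in> H0s s \<Omega>"
  shows "(\<integral>x. (u x)\<^sup>2 \<partial>M) = (\<integral>x. (u x)\<^sup>2 \<partial>lebesgue)"
proof -
  have "(\<integral>x. (u x)\<^sup>2 \<partial>M) = (\<integral>x. indicator \<Omega> x * (u x)\<^sup>2 \<partial>lebesgue)"
    using domain_sets by (simp add: integral_restrict_space)
  also have "\<dots> = (\<integral>x. (u x)\<^sup>2 \<partial>lebesgue)"
  proof (rule integral_cong_AE)
    show "(\<lambda>x. indicator \<Omega> x * (u x)\<^sup>2) \<in> borel_measurable lebesgue"
      using H0s_measurable(1)[OF u] domain_sets by measurable
    show "(\<lambda>x. (u x)\<^sup>2) \<in> borel_measurable lebesgue"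
      using H0s_measurable(1)[OF u] by measurable
    have "AE x in lebesgue. x \<notin> \<Omega> \<longrightarrow> u x = 0"
      using u by (simp add: H0s_iff)
    then show "AE x in lebesgue. indicator \<Omega> x * (u x)\<^sup>2 = (u x)\<^sup>2"
      by eventually_elim (auto split: split_indicator)
  qed
  finally show ?thesis .
qed

text \<open>
  Inside the set where \<open>w\<close> is positive there is a compact set \<open>T\<close> of positive measure, and the
  Lipschitz functions \<open>max 0 (1 - n * infdist x T)\<close> decrease to its indicator. The exponent serves
  two purposes: with 2 the quadratic form of \<open>w\<close> is seen to be positive somewhere, with 1 a function
  orthogonal to all test functions is seen to vanish.
\<close>
lemma bump_test_function:
  assumes w: "integrable M w" and pos: "emeasure lebesgue {x \<in> \<Omega>. w x > 0} \<noteq> 0"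
    and m: "m > (0 :: nat)"
  shows "\<exists>v\<in>H0s s \<Omega>. (\<forall>x. 0 \<le> v x \<and> v x \<le> 1) \<and> 0 < (\<integral>x. w x * v x ^ m \<partial>M)"
proof -
  have wm[measurable]: "w \<in> borel_measurable M"
    using w by auto
  define S where "S = {x \<in> \<Omega>. w x > 0}"
  have "S \<in> sets M"
    using measurable_sets[OF wm, of "{0<..}"] by (simp add: S_def vimage_def Int_def conj_commute)
  then have S: "S \<in> sets lebesgue"
    using domain_sets by (simp add: sets_restrict_space_iff)
  have "S \<in> lmeasurable"
    using fmeasurableI2[OF domain_lmeasurable _ S] by (auto simp: S_def)
  then obtain T where T: "closed T" "T \<subseteq> S" and Tpos: "emeasure lebesgue T \<noteq> 0"
    using closed_subset_positive_measure[of S] pos by (auto simp: S_def)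
  have "bounded T"
    using T(2) bounded_domain by (auto simp: S_def intro: bounded_subset)
  then have Tc: "compact T"
    using T(1) by (simp add: compact_eq_bounded_closed)
  have Ts[measurable]: "T \<in> sets lebesgue"
    using T(1) by auto
  have Tne: "T \<noteq> {}" using Tpos by auto
  have "T \<inter> - \<Omega> = {}"
    using T(2) by (auto simp: S_def)
  then obtain \<delta> where \<delta>: "\<delta> > 0" "\<And>x y. x \<in> T \<Longrightarrow> y \<in> - \<Omega> \<Longrightarrow> \<delta> \<le> dist x y"
    using separate_compact_closed[OF Tc, of "- \<Omega>"] open_domain unfolding open_closed by blast
  define v where "v n x = max 0 (1 - real n * infdist x T)" for n x
  have v01: "0 \<le> v n x" "v n x \<le> 1" for n x
    by (auto simp: v_def infdist_nonneg)
  have vH: "v n \<in> H0s s \<Omega>" if n: "1 < real n * \<delta>" for n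
  proof (rule lipschitz_in_H0s[OF s_pos s_less domain_lmeasurable, of _ "real n" 1])
    show "\<bar>v n x - v n y\<bar> \<le> real n * norm (x - y)" for x y
    proof -
      have "\<bar>v n x - v n y\<bar> \<le> \<bar>real n * infdist x T - real n * infdist y T\<bar>"
        unfolding v_def by linarith
      also have "\<dots> = real n * \<bar>infdist x T - infdist y T\<bar>"
        by (simp add: abs_mult flip: right_diff_distrib)
      also have "\<dots> \<le> real n * norm (x - y)"
        using infdist_triangle_abs[of x T y] by (intro mult_left_mono) (auto simp: dist_norm)
      finally show ?thesis .
    qed
    show "\<bar>v n x\<bar> \<le> 1" for x
      using v01[of n x] by simp
    show "v n x = 0" if "x \<notin> \<Omega>" for x
    proof -
      have "\<delta> \<le> infdist x T"
        using \<delta>(2) that Tne by (auto simp: infdist_def dist_commute intro!: cINF_greatest)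
      then have "real n * \<delta> \<le> real n * infdist x T"
        by (simp add: mult_left_mono)
      then show ?thesis using n by (simp add: v_def)
    qed
  qed
  have vm: "v n \<in> borel_measurable M" for n
    unfolding v_def
    by (intro measurable_restrict_space1 measurable_completion) (simp add: borel_measurable_continuous_onI continuous_intros)
  have lim: "(\<lambda>n. \<integral>x. w x * v n x ^ m \<partial>M) \<longlonglongrightarrow> (\<integral>x. w x * indicator T x \<partial>M)"
  proof (rule integral_dominated_convergence[where w = "\<lambda>x. \<bar>w x\<bar>"])
    show "(\<lambda>x. w x * indicator T x) \<in> borel_measurable M"
      by (intro borel_measurable_times wm measurable_restrict_space1 borel_measurable_indicator Ts)
    show "(\<lambda>x. w x * v n x ^ m) \<in> borel_measurable M" for n
      using vm wm by measurable
    show "integrable M (\<lambda>x. \<bar>w x\<bar>)"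
      using w by simp
    have "\<bar>w x * v n x ^ m\<bar> \<le> \<bar>w x\<bar>" for n x
      using v01[of n x] by (simp add: abs_mult mult_left_le power_le_one)
    then show "AE x in M. norm (w x * v n x ^ m) \<le> \<bar>w x\<bar>" for n
      by simp
    have "(\<lambda>n. v n x ^ m) \<longlonglongrightarrow> indicator T x" for x
    proof (cases "x \<in> T")
      case True
      then show ?thesis by (simp add: v_def)
    next
      case False
      then have d: "infdist x T > 0"
        using T(1) Tne by (simp add: infdist_pos_not_in_closed)
      obtain k where k: "1 < real k * infdist x T"
        using d reals_Archimedean3 by blast
      have "v n x ^ m = 0" if "n \<ge> k" for n
      proof -
        have "real k * infdist x T \<le> real n * infdist x T"
          using that d by (simp add: mult_right_mono)
        then show ?thesis using k m by (simp add: v_def)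
      qed
      then show ?thesis
        using False by (intro tendsto_eventually) (auto simp: eventually_sequentially)
    qed
    then show "AE x in M. (\<lambda>n. w x * v n x ^ m) \<longlonglongrightarrow> w x * indicator T x"
      by (intro AE_I2 tendsto_mult_left)
  qed
  have "0 < (\<integral>x. w x * indicator T x \<partial>M)"
  proof -
    have i: "integrable M (\<lambda>x. w x * indicator T x)"
    proof (rule Bochner_Integration.integrable_bound[OF w])
      show "(\<lambda>x. w x * indicator T x) \<in> borel_measurable M"
        by (intro borel_measurable_times wm measurable_restrict_space1 borel_measurable_indicator Ts)
    qed (auto split: split_indicator)
    have nn: "AE x in M. 0 \<le> w x * indicator T x"
      using T(2) by (auto simp: S_def split: split_indicator intro: less_imp_le)
    have "(\<integral>x. w x * indicator T x \<partial>M) \<noteq> 0"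
    proof
      assume "(\<integral>x. w x * indicator T x \<partial>M) = 0"
      then have "AE x in M. w x * indicator T x = 0"
        using integral_nonneg_eq_0_iff_AE[OF i nn] by simp
      then have "AE x in M. x \<notin> T"
        by eventually_elim (use T(2) in \<open>auto simp: S_def\<close>)
      then have "AE x in lebesgue. x \<in> \<Omega> \<longrightarrow> x \<notin> T"
        using domain_sets by (simp add: AE_restrict_space_iff)
      then have "AE x in lebesgue. x \<notin> T"
        by eventually_elim (use T(2) in \<open>auto simp: S_def\<close>)
      then show False
        using Tpos AE_iff_null_sets[OF Ts] by auto
    qed
    with integral_nonneg_AE[OF nn] show ?thesis by linarith
  qed
  then have "\<forall>\<^sub>F n in sequentially. 0 < (\<integral>x. w x * v n x ^ m \<partial>M)"
    using lim by (rule order_tendstoD(1)[rotated])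
  moreover obtain k where k: "1 < real k * \<delta>"
    using \<delta>(1) reals_Archimedean3 by blast
  then have "\<forall>\<^sub>F n in sequentially. 1 < real n * \<delta>"
    by (intro eventually_sequentiallyI[of k])
      (smt (verit, best) \<delta>(1) mult_right_mono of_nat_le_iff)
  ultimately have "\<forall>\<^sub>F n in sequentially. 0 < (\<integral>x. w x * v n x ^ m \<partial>M) \<and> 1 < real n * \<delta>"
    by (rule eventually_conj)
  then obtain n where "0 < (\<integral>x. w x * v n x ^ m \<partial>M)" "1 < real n * \<delta>"
    using eventually_happens by force
  then show ?thesis
    using vH v01 by blast
qed

text \<open>
  The nonlocal energy sees the exterior: the function vanishes on a ball \<open>B\<close> outside \<open>\<Omega>\<close>, and the kernel
  is bounded below on \<open>\<Omega> \<times> B\<close>, so these pairs alone contribute a multiple of \<open>\<integral> u\<^sup>2\<close>.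
\<close>
lemma poincare_inequality:
  obtains C where "C > 0" "\<And>u. u \<in> H0s s \<Omega> \<Longrightarrow> (\<integral>x. (u x)\<^sup>2 \<partial>M) \<le> C * H0s_inner s u u"
proof -
  obtain R where R: "R > 0" "\<Omega> \<subseteq> ball 0 R"
    using bounded_domain bounded_subset_ballD by blast
  obtain e :: 'a where e: "norm e = 1"
    using vector_choose_size[of 1] by auto
  \<comment> \<open>The unit ball around \<open>b\<close> lies outside the ball of radius \<open>R\<close> that contains \<open>\<Omega>\<close>.\<close>
  define b where "b = (R + 1) *\<^sub>R e"
  have b: "norm b = R + 1"
    using e R(1) by (simp add: b_def)
  define B where "B = ball b 1"
  have dist: "norm (x - y) \<le> 2 * R + 2" "norm (x - y) \<noteq> 0" "y \<notin> \<Omega>" if "x \<in> \<Omega>" "y \<in> B" for x y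
  proof -
    have x: "norm x < R" using that(1) R(2) by auto
    have y: "norm (b - y) < 1" using that(2) by (simp add: B_def dist_norm)
    have "norm y \<le> norm b + norm (b - y)" using norm_triangle_ineq4[of b "b - y"] by simp
    moreover have "norm (x - y) \<le> norm x + norm y" by (rule norm_triangle_ineq4)
    ultimately show "norm (x - y) \<le> 2 * R + 2" using b x y by linarith
    have "norm b \<le> norm y + norm (b - y)" using norm_triangle_ineq[of y "b - y"] by simp
    then have "norm y > R" using b y by linarith
    then show "y \<notin> \<Omega>" "norm (x - y) \<noteq> 0" using R(2) x by auto
  qed
  define c where "c = 1 / (2 * R + 2) powr (real DIM('a) + 2 * s)"
  have c: "c > 0" using R by (simp add: c_def)
  define V where "V = measure lebesgue B"
  have V: "V > 0" "emeasure lebesgue B = ennreal V"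
    using content_ball_pos[of 1 b]
    by (simp_all add: V_def B_def emeasure_eq_ennreal_measure fmeasurableD2)
  have Bm[measurable]: "B \<in> sets lebesgue" by (simp add: B_def)
  have "(\<integral>x. (u x)\<^sup>2 \<partial>M) \<le> 1 / (c * V) * H0s_inner s u u" if u: "u \<in> H0s s \<Omega>" for u
  proof -
    note [measurable] = H0s_measurable(1)[OF u]
    have ae: "AE x in lebesgue. x \<notin> \<Omega> \<longrightarrow> u x = 0"
      using u by (simp add: H0s_iff)
    have fib: "ennreal (c * V) * ennreal ((u x)\<^sup>2) \<le> (\<integral>\<^sup>+y. ennreal ((diff_quotient s u (x, y))\<^sup>2) \<partial>lebesgue)"
      if x: "x \<in> \<Omega>" for x
    proof -
      have "ennreal (c * V) * ennreal ((u x)\<^sup>2) = ennreal (c * (u x)\<^sup>2) * emeasure lebesgue B"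
        using c V by (simp add: mult_ac flip: ennreal_mult)
      also have "\<dots> = (\<integral>\<^sup>+y. ennreal (c * (u x)\<^sup>2) * indicator B y \<partial>lebesgue)"
        by (simp add: nn_integral_cmult_indicator)
      also have "\<dots> \<le> (\<integral>\<^sup>+y. ennreal ((diff_quotient s u (x, y))\<^sup>2) \<partial>lebesgue)"
      proof (rule nn_integral_mono_AE)
        show "AE y in lebesgue. ennreal (c * (u x)\<^sup>2) * indicator B y \<le> ennreal ((diff_quotient s u (x, y))\<^sup>2)"
          using ae
        proof eventually_elim
          case (elim y)
          show ?case
          proof (cases "y \<in> B")
            case True
            note d = dist[OF x True]
            have uy: "u y = 0" using elim d by simp
            have "norm (x - y) powr (real DIM('a) + 2 * s) \<le> (2 * R + 2) powr (real DIM('a) + 2 * s)"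
              using d s_pos by (intro powr_mono2) auto
            then have "c \<le> 1 / norm (x - y) powr (real DIM('a) + 2 * s)"
              unfolding c_def using d R by (intro divide_left_mono) auto
            then have "c * (u x)\<^sup>2 \<le> (diff_quotient s u (x, y))\<^sup>2"
              using mult_right_mono[of c _ "(u x)\<^sup>2"]
              by (fastforce simp: diff_quotient_def uy kernel_split power_divide)
            then show ?thesis using True by (simp add: ennreal_leI)
          qed simp
        qed
      qed
      finally show ?thesis .
    qed
    have "ennreal (c * V) * ennreal (\<integral>x. (u x)\<^sup>2 \<partial>lebesgue) = ennreal (c * V) * (\<integral>\<^sup>+x. ennreal ((u x)\<^sup>2) \<partial>lebesgue)"
      using u by (subst nn_integral_eq_integral) (auto simp: H0s_iff square_integrable_def)
    also have "\<dots> = (\<integral>\<^sup>+x. ennreal (c * V) * ennreal ((u x)\<^sup>2) \<partial>lebesgue)"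
      by (rule nn_integral_cmult[symmetric]) measurable
    also have "\<dots> \<le> (\<integral>\<^sup>+x. (\<integral>\<^sup>+y. ennreal ((diff_quotient s u (x, y))\<^sup>2) \<partial>lebesgue) \<partial>lebesgue)"
    proof (rule nn_integral_mono_AE)
      show "AE x in lebesgue. ennreal (c * V) * ennreal ((u x)\<^sup>2)
          \<le> (\<integral>\<^sup>+y. ennreal ((diff_quotient s u (x, y))\<^sup>2) \<partial>lebesgue)"
        using ae
      proof eventually_elim
        case (elim x)
        then show ?case using fib[of x] by (cases "x \<in> \<Omega>") simp_all
      qed
    qed
    also have "\<dots> = (\<integral>\<^sup>+z. ennreal ((diff_quotient s u z)\<^sup>2) \<partial>lebesgue_pair)"
      by (rule leb.nn_integral_fst) measurable
    also have "\<dots> = ennreal (H0s_inner s u u)"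
      by (rule energy_eq[OF u])
    finally have "c * V * (\<integral>x. (u x)\<^sup>2 \<partial>lebesgue) \<le> H0s_inner s u u"
      using c V H0s_inner_self_nonneg[of s u] by (simp flip: ennreal_mult)
    then show ?thesis
      using c V integral_H0s_square_on[OF u] by (simp add: field_simps)
  qed
  moreover have "1 / (c * V) > 0" using c V by simp
  ultimately show ?thesis using that by blast
qed

end

section \<open>Averages over dyadic cells\<close>

lemma AE_lebesgue_pair:
  assumes "AE x in (lebesgue :: 'a::euclidean_space measure). P x"
  shows "AE z in (lebesgue_pair :: ('a \<times> 'a) measure). P (fst z) \<and> P (snd z)"
proof -
  obtain N where N: "N \<in> null_sets (lebesgue :: 'a measure)" "{x \<in> space lebesgue. \<not> P x} \<subseteq> N"
    using assms by (auto elim!: AE_E3 simp: eventually_ae_filter)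
  have "(N \<times> UNIV) \<union> (UNIV \<times> N) \<in> null_sets lebesgue_pair"
    using N(1) by (intro null_sets.Un)
      (auto simp: null_sets_def leb.emeasure_pair_measure_Times space_pair_measure
        intro!: pair_measureI)
  then show ?thesis
    by (rule AE_I') (use N(2) in auto)
qed

lemma jensen_square_mean:
  fixes g :: "'b \<Rightarrow> real"
  assumes S: "S \<in> sets M" "emeasure M S < \<infinity>" "0 < measure M S"
    and g: "integrable M (\<lambda>x. indicator S x * g x)" "integrable M (\<lambda>x. indicator S x * (g x)\<^sup>2)"
  shows "((\<integral>x. indicator S x * g x \<partial>M) / measure M S)\<^sup>2
    \<le> (\<integral>x. indicator S x * (g x)\<^sup>2 \<partial>M) / measure M S"
proof -
  define t where "t = (\<integral>x. indicator S x * g x \<partial>M) / measure M S"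
  have iS: "integrable M (indicator S :: 'b \<Rightarrow> real)"
    using S by (intro integrable_real_indicator) auto
  have "(\<lambda>x. indicator S x * (g x - t)\<^sup>2)
      = (\<lambda>x. indicator S x * (g x)\<^sup>2 - (2 * t) * (indicator S x * g x) + t\<^sup>2 * indicator S x)"
    by (auto simp: power2_eq_square algebra_simps)
  then have "(\<integral>x. indicator S x * (g x - t)\<^sup>2 \<partial>M)
      = (\<integral>x. indicator S x * (g x)\<^sup>2 \<partial>M) - 2 * t * (\<integral>x. indicator S x * g x \<partial>M) + t\<^sup>2 * measure M S"
    using g iS S by simp
  moreover have "0 \<le> (\<integral>x. indicator S x * (g x - t)\<^sup>2 \<partial>M)"
    by (intro integral_nonneg_AE) auto
  moreover have "(\<integral>x. indicator S x * g x \<partial>M) = t * measure M S"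
    using S by (simp add: t_def)
  ultimately have "t\<^sup>2 * measure M S \<le> (\<integral>x. indicator S x * (g x)\<^sup>2 \<partial>M)"
    by (simp add: power2_eq_square algebra_simps)
  then show ?thesis
    unfolding t_def[symmetric] using S(3) by (simp add: pos_le_divide_eq)
qed

text \<open>
  The integer coordinates of the half-open cube of side \<open>2 powr (- k)\<close> that contains the point. Restricted
  to the basis, they agree for two points exactly if the cubes agree, and they take countably many values.
\<close>
definition dyadic_cell :: "nat \<Rightarrow> 'a::euclidean_space \<Rightarrow> 'a \<Rightarrow> int" where
  "dyadic_cell k x = (\<lambda>i\<in>Basis. \<lfloor>2 ^ k * (x \<bullet> i)\<rfloor>)"

definition same_cell :: "nat \<Rightarrow> 'a::euclidean_space \<Rightarrow> 'a set" where
  "same_cell k x = {y. dyadic_cell k y = dyadic_cell k x}"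

lemma mem_same_cell:
  "y \<in> same_cell k x \<longleftrightarrow> (\<forall>i\<in>Basis. \<lfloor>2 ^ k * (y \<bullet> i)\<rfloor> = \<lfloor>2 ^ k * (x \<bullet> i)\<rfloor>)"
  unfolding same_cell_def dyadic_cell_def mem_Collect_eq
  by (metis (no_types, lifting) restrict_apply' restrict_ext)

lemma same_cell_sets [measurable]: "same_cell k x \<in> sets lebesgue"
proof -
  have "same_cell k x = {y \<in> space borel. \<forall>i\<in>Basis. \<lfloor>2 ^ k * (y \<bullet> i)\<rfloor> = \<lfloor>2 ^ k * (x \<bullet> i)\<rfloor>}"
    by (auto simp: mem_same_cell)
  also have "\<dots> \<in> sets borel"
    by measurable
  finally show ?thesis by (metis sets_completionI_sets sets_lborel)
qed

lemma countable_dyadic_cells: "countable (range (dyadic_cell k :: 'a::euclidean_space \<Rightarrow> _))"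
proof (rule countable_subset)
  show "range (dyadic_cell k) \<subseteq> (Basis :: 'a set) \<rightarrow>\<^sub>E (UNIV :: int set)"
    by (auto simp: dyadic_cell_def)
  show "countable ((Basis :: 'a set) \<rightarrow>\<^sub>E (UNIV :: int set))"
    by (intro countable_PiE) auto
qed

lemma dyadic_cell_measurable:
  "dyadic_cell k \<in> lebesgue \<rightarrow>\<^sub>M count_space (range (dyadic_cell k :: 'a::euclidean_space \<Rightarrow> _))"
proof (rule measurable_count_space_eq_countable[OF countable_dyadic_cells, THEN iffD2], intro conjI ballI)
  fix z assume "z \<in> range (dyadic_cell k :: 'a \<Rightarrow> _)"
  then obtain x :: 'a where "z = dyadic_cell k x" by auto
  then have "dyadic_cell k -` {z} \<inter> space lebesgue = same_cell k x"
    by (auto simp: same_cell_def)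
  then show "dyadic_cell k -` {z} \<inter> space lebesgue \<in> sets lebesgue"
    by simp
qed auto

lemma same_cell_diameter:
  fixes x y :: "'a::euclidean_space"
  assumes "y \<in> same_cell k x"
  shows "norm (x - y) \<le> real DIM('a) / 2 ^ k"
proof -
  have "\<bar>(x - y) \<bullet> i\<bar> \<le> 1 / 2 ^ k" if "i \<in> Basis" for i
  proof -
    have "\<lfloor>2 ^ k * (y \<bullet> i)\<rfloor> = \<lfloor>2 ^ k * (x \<bullet> i)\<rfloor>"
      using assms that by (simp add: mem_same_cell)
    then have "\<bar>2 ^ k * (x \<bullet> i) - 2 ^ k * (y \<bullet> i)\<bar> \<le> 1"
      by linarith
    then have "2 ^ k * \<bar>(x - y) \<bullet> i\<bar> \<le> 1"
      by (simp add: inner_diff_left abs_mult flip: right_diff_distrib)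
    then show ?thesis by (simp add: field_simps)
  qed
  then have "(\<Sum>i\<in>Basis. \<bar>(x - y) \<bullet> i\<bar>) \<le> real DIM('a) * (1 / 2 ^ k)"
    by (intro sum_bounded_above) auto
  then show ?thesis
    using norm_le_l1[of "x - y"] by simp
qed

text \<open>
  The cell contains an open cube of this volume and is contained in a ball.
\<close>
lemma same_cell_measure:
  fixes x :: "'a::euclidean_space"
  shows "emeasure lebesgue (same_cell k x) < \<infinity>"
    and "(1 / 2 ^ k) ^ DIM('a) \<le> measure lebesgue (same_cell k x)"
proof -
  have "same_cell k x \<subseteq> cball x (real DIM('a) / 2 ^ k)"
    using same_cell_diameter by (auto simp: dist_norm)
  then have "emeasure lebesgue (same_cell k x) \<le> emeasure lebesgue (cball x (real DIM('a) / 2 ^ k))"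
    by (intro emeasure_mono) auto
  also have "\<dots> < \<infinity>"
    by (simp add: emeasure_completion emeasure_cball)
  finally show fin: "emeasure lebesgue (same_cell k x) < \<infinity>" .
  define a where "a = (\<Sum>i\<in>Basis. (real_of_int \<lfloor>2 ^ k * (x \<bullet> i)\<rfloor> / 2 ^ k) *\<^sub>R i)"
  define b where "b = a + (\<Sum>i\<in>Basis. (1 / 2 ^ k) *\<^sub>R i)"
  have a: "a \<bullet> i = real_of_int \<lfloor>2 ^ k * (x \<bullet> i)\<rfloor> / 2 ^ k" and b: "b \<bullet> i = a \<bullet> i + 1 / 2 ^ k"
    if "i \<in> Basis" for i
    using that by (simp_all add: a_def b_def inner_add_left)
  have "box a b \<subseteq> same_cell k x"
  proof
    fix y assume y: "y \<in> box a b"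
    have "\<lfloor>2 ^ k * (y \<bullet> i)\<rfloor> = \<lfloor>2 ^ k * (x \<bullet> i)\<rfloor>" if "i \<in> Basis" for i
    proof (rule floor_eq2)
      have *: "a \<bullet> i < y \<bullet> i" "y \<bullet> i < b \<bullet> i"
        using y that by (auto simp: mem_box)
      then show "real_of_int \<lfloor>2 ^ k * (x \<bullet> i)\<rfloor> \<le> 2 ^ k * (y \<bullet> i)"
        using a[OF that] by (simp add: field_simps)
      show "2 ^ k * (y \<bullet> i) < real_of_int \<lfloor>2 ^ k * (x \<bullet> i)\<rfloor> + 1"
        using * a[OF that] b[OF that] by (simp add: field_simps)
    qed
    then show "y \<in> same_cell k x" by (simp add: mem_same_cell)
  qed
  then have "measure lebesgue (box a b) \<le> measure lebesgue (same_cell k x)"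
    using fin by (intro measure_mono_fmeasurable) (auto simp: fmeasurable_def)
  moreover have "measure lebesgue (box a b) = (1 / 2 ^ k) ^ DIM('a)"
    using b by (subst measure_completion) (auto simp: measure_lborel_box_eq inner_diff_left)
  ultimately show "(1 / 2 ^ k) ^ DIM('a) \<le> measure lebesgue (same_cell k x)"
    by simp
qed

definition cell_mean :: "nat \<Rightarrow> ('a::euclidean_space \<Rightarrow> real) \<Rightarrow> 'a \<Rightarrow> real" where
  "cell_mean k h x = (\<integral>y. indicator (same_cell k x) y * h y \<partial>lebesgue) / measure lebesgue (same_cell k x)"

text \<open>
  The mean depends on the point only through its cell, and there are countably many cells.
\<close>
lemma cell_mean_measurable: "cell_mean k h \<in> borel_measurable lebesgue"
proof -
  define F where "F z = (\<integral>y. indicator {y. dyadic_cell k y = z} y * h y \<partial>lebesgue)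
      / measure lebesgue {y. dyadic_cell k y = z}" for z
  have "cell_mean k h = (\<lambda>x. F (dyadic_cell k x))"
    by (auto simp: cell_mean_def F_def same_cell_def)
  also have "\<dots> \<in> borel_measurable lebesgue"
    by (rule measurable_compose[OF dyadic_cell_measurable]) simp
  finally show ?thesis .
qed

lemma square_integrable_on_cell:
  assumes "square_integrable lebesgue h"
  shows "integrable lebesgue (\<lambda>y. indicator (same_cell k x) y * h y)"
    and "integrable lebesgue (\<lambda>y. indicator (same_cell k x) y * (h y)\<^sup>2)"
proof -
  have i: "integrable lebesgue (indicator (same_cell k x) :: _ \<Rightarrow> real)"
    using same_cell_measure(1)[of k x] by (intro integrable_real_indicator) auto
  then have "square_integrable lebesgue (indicator (same_cell k x))"
    by (simp add: square_integrable_def power2_eq_square flip: indicator_inter_arith)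
  then show "integrable lebesgue (\<lambda>y. indicator (same_cell k x) y * h y)"
    by (rule square_integrable_mult[OF _ assms])
  show "integrable lebesgue (\<lambda>y. indicator (same_cell k x) y * (h y)\<^sup>2)"
    using assms integrable_mult_indicator[of "same_cell k x" lebesgue "\<lambda>x. (h x)\<^sup>2"]
    by (simp add: square_integrable_def)
qed

lemma cell_mean_diff:
  assumes "square_integrable lebesgue f" "square_integrable lebesgue g"
  shows "cell_mean k (\<lambda>x. 1 * f x + (- 1) * g x) x = cell_mean k f x - cell_mean k g x"
  using square_integrable_on_cell[OF assms(1)] square_integrable_on_cell[OF assms(2)]
  by (simp add: cell_mean_def right_diff_distrib diff_divide_distrib)

lemma cell_mean_bound:
  fixes h :: "'a::euclidean_space \<Rightarrow> real"
  assumes h: "square_integrable lebesgue h"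
  shows "\<bar>cell_mean k h x\<bar> \<le> 1 + (2 ^ k) ^ DIM('a) * (\<integral>y. (h y)\<^sup>2 \<partial>lebesgue)"
proof -
  define V where "V = measure lebesgue (same_cell k x)"
  have V: "(1 / 2 ^ k) ^ DIM('a) \<le> V" "0 < V"
    using same_cell_measure(2)[of k x] by (auto simp: V_def intro: less_le_trans[rotated])
  note i = square_integrable_on_cell[OF h, of k x]
  have "(cell_mean k h x)\<^sup>2 \<le> (\<integral>y. indicator (same_cell k x) y * (h y)\<^sup>2 \<partial>lebesgue) / V"
    unfolding cell_mean_def V_def
    using V by (intro jensen_square_mean same_cell_sets same_cell_measure i) (simp add: V_def)
  also have "\<dots> \<le> (\<integral>y. (h y)\<^sup>2 \<partial>lebesgue) / (1 / 2 ^ k) ^ DIM('a)"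
  proof (rule frac_le)
    show "(\<integral>y. indicator (same_cell k x) y * (h y)\<^sup>2 \<partial>lebesgue) \<le> (\<integral>y. (h y)\<^sup>2 \<partial>lebesgue)"
      using h i by (intro integral_mono) (auto simp: square_integrable_def split: split_indicator)
  qed (use V in auto)
  also have "\<dots> = (2 ^ k) ^ DIM('a) * (\<integral>y. (h y)\<^sup>2 \<partial>lebesgue)"
    by (simp add: power_divide)
  finally have "(cell_mean k h x)\<^sup>2 \<le> (2 ^ k) ^ DIM('a) * (\<integral>y. (h y)\<^sup>2 \<partial>lebesgue)" .
  moreover have "\<bar>t\<bar> \<le> 1 + t\<^sup>2" for t :: real
    using zero_le_power2[of "\<bar>t\<bar> - 1"] by (simp add: power2_diff del: zero_le_power2)
  ultimately show ?thesis
    by (smt (verit))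
qed

text \<open>
  The \<open>(N + 2 * s)\<close>-th power of a bound for the diameter of a cell, divided by its volume. The
  factors \<open>(2 ^ k) ^ N\<close> cancel and leave a constant times \<open>2 powr (- 2 * s * k)\<close>. The type argument
  carries the dimension.
\<close>
definition cell_error :: "real \<Rightarrow> 'a::euclidean_space itself \<Rightarrow> nat \<Rightarrow> real" where
  "cell_error s T k = (real DIM('a) / 2 ^ k) powr (real DIM('a) + 2 * s) * (2 ^ k) ^ DIM('a)"

lemma cell_error_tendsto_0:
  assumes "0 < s"
  shows "cell_error s TYPE('a::euclidean_space) \<longlonglongrightarrow> 0"
proof -
  have "cell_error s TYPE('a) k = real DIM('a) powr (real DIM('a) + 2 * s) * (2 powr (- 2 * s)) ^ k" for k
  proof -
    define p where "p = real DIM('a) + 2 * s"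
    have e: "(2 :: real) ^ k = 2 powr real k" by (simp add: powr_realpow)
    have "cell_error s TYPE('a) k = real DIM('a) powr p * (2 powr (- (real k * p)) * 2 powr (real DIM('a) * real k))"
      unfolding cell_error_def p_def[symmetric]
      by (simp add: powr_divide e powr_powr powr_power powr_minus_divide)
    also have "2 powr (- (real k * p)) * 2 powr (real DIM('a) * real k) = 2 powr (- (real k * p) + real DIM('a) * real k)"
      by (simp only: powr_add)
    also have "- (real k * p) + real DIM('a) * real k = real k * (- 2 * s)"
      by (simp add: p_def algebra_simps)
    also have "2 powr (real k * (- 2 * s)) = (2 powr (- 2 * s)) ^ k"
      by (simp add: powr_power)
    finally show ?thesis by (simp add: p_def)
  qed
  moreover have "(\<lambda>k. (2 powr (- 2 * s)) ^ k) \<longlonglongrightarrow> 0"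
    using assms powr_less_mono[of "- 2 * s" 0 2] by (intro LIMSEQ_realpow_zero) auto
  ultimately show ?thesis
    using tendsto_mult_right_zero[of "\<lambda>k. (2 powr (- 2 * s)) ^ k" sequentially] by presburger
qed

text \<open>
  By Jensen's inequality \<open>(h x - mean)\<^sup>2\<close> is at most the mean of \<open>(h x - h y)\<^sup>2\<close> over the cell of \<open>x\<close>. There
  \<open>norm (x - y)\<close> is at most the diameter, so the kernel is bounded below and the mean is at most a
  multiple of the energy of the fiber over \<open>x\<close>.
\<close>
lemma cell_mean_error:
  fixes h :: "'a::euclidean_space \<Rightarrow> real"
  assumes h: "h \<in> H0s s \<Omega>" and s: "0 < s"
  shows "square_integrable lebesgue (\<lambda>x. h x - cell_mean k h x)"
    and "(\<integral>x. (h x - cell_mean k h x)\<^sup>2 \<partial>lebesgue) \<le> cell_error s TYPE('a) k * H0s_inner s h h"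
proof -
  define E where "E = cell_error s TYPE('a) k"
  have E: "E \<ge> 0" by (simp add: E_def cell_error_def)
  note hm[measurable] = H0s_measurable(1)[OF h]
  have hs: "square_integrable lebesgue h"
    using h by (simp add: H0s_iff)
  have m: "(\<lambda>x. (h x - cell_mean k h x)\<^sup>2) \<in> borel_measurable lebesgue"
    using hm cell_mean_measurable[of k h] by measurable
  have fib: "ennreal ((h x - cell_mean k h x)\<^sup>2)
      \<le> ennreal E * (\<integral>\<^sup>+y. ennreal ((diff_quotient s h (x, y))\<^sup>2) \<partial>lebesgue)" for x
  proof -
    define Q where "Q = same_cell k x"
    define V where "V = measure lebesgue Q"
    have V: "(1 / 2 ^ k) ^ DIM('a) \<le> V"
      using same_cell_measure(2)[of k x] by (auto simp: V_def Q_def)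
    then have V0: "V > 0"
      by (rule less_le_trans[rotated]) simp
    have [measurable]: "Q \<in> sets lebesgue" and fin: "emeasure lebesgue Q < \<infinity>"
      using same_cell_measure(1)[of k x] by (auto simp: Q_def)
    note i = square_integrable_on_cell[OF hs, of k x, folded Q_def]
    have iQ: "integrable lebesgue (indicator Q :: _ \<Rightarrow> real)"
      using fin by (intro integrable_real_indicator) auto
    have "indicator Q y * (h x - h y) = h x * indicator Q y - indicator Q y * h y" for y
      by (simp add: algebra_simps)
    then have i1: "integrable lebesgue (\<lambda>y. indicator Q y * (h x - h y))"
      and e1: "(\<integral>y. indicator Q y * (h x - h y) \<partial>lebesgue) = h x * V - (\<integral>y. indicator Q y * h y \<partial>lebesgue)"
      using i iQ fin by (simp_all add: V_def)
    have "indicator Q y * (h x - h y)\<^sup>2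
        = (h x)\<^sup>2 * indicator Q y - 2 * h x * (indicator Q y * h y) + indicator Q y * (h y)\<^sup>2" for y
      by (simp add: algebra_simps power2_eq_square)
    then have i2: "integrable lebesgue (\<lambda>y. indicator Q y * (h x - h y)\<^sup>2)"
      using i iQ by simp
    have "h x - cell_mean k h x = (\<integral>y. indicator Q y * (h x - h y) \<partial>lebesgue) / V"
      using V0 by (simp add: e1 cell_mean_def Q_def[symmetric] V_def[symmetric] diff_divide_distrib)
    then have "(h x - cell_mean k h x)\<^sup>2 \<le> (\<integral>y. indicator Q y * (h x - h y)\<^sup>2 \<partial>lebesgue) / V"
      using jensen_square_mean[of Q lebesgue "\<lambda>y. h x - h y"] fin i1 i2 V0 by (simp add: V_def)
    then have "ennreal ((h x - cell_mean k h x)\<^sup>2) \<le> ennreal (\<integral>y. indicator Q y * (h x - h y)\<^sup>2 / V \<partial>lebesgue)"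
      by (simp add: ennreal_leI)
    also have "\<dots> = (\<integral>\<^sup>+y. ennreal (indicator Q y * (h x - h y)\<^sup>2 / V) \<partial>lebesgue)"
      using i2 V0 by (intro nn_integral_eq_integral[symmetric]) auto
    also have "\<dots> \<le> (\<integral>\<^sup>+y. ennreal E * ennreal ((diff_quotient s h (x, y))\<^sup>2) \<partial>lebesgue)"
    proof (rule nn_integral_mono)
      fix y
      have "indicator Q y * (h x - h y)\<^sup>2 / V \<le> E * (diff_quotient s h (x, y))\<^sup>2"
      proof (cases "y \<in> Q \<and> x \<noteq> y")
        case True
        define n where "n = norm (x - y) powr (real DIM('a) + 2 * s)"
        have n: "n > 0" using True by (simp add: n_def)
        have "n \<le> (real DIM('a) / 2 ^ k) powr (real DIM('a) + 2 * s)"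
          unfolding n_def using True s by (intro powr_mono2 same_cell_diameter) (auto simp: Q_def)
        moreover have "1 / V \<le> (2 ^ k) ^ DIM('a)"
          using V V0 by (simp add: field_simps power_divide)
        ultimately have "n * (1 / V) \<le> E"
          unfolding E_def cell_error_def using V0 by (intro mult_mono) auto
        then have "(n * (1 / V)) * ((h x - h y)\<^sup>2 / n) \<le> E * ((h x - h y)\<^sup>2 / n)"
          using n by (intro mult_right_mono) auto
        then show ?thesis
          using True n V0 by (simp add: diff_quotient_def power_divide n_def kernel_split)
      qed (use E in auto)
      then show "ennreal (indicator Q y * (h x - h y)\<^sup>2 / V) \<le> ennreal E * ennreal ((diff_quotient s h (x, y))\<^sup>2)"
        using E by (simp add: ennreal_leI flip: ennreal_mult)
    qed
    also have "\<dots> = ennreal E * (\<integral>\<^sup>+y. ennreal ((diff_quotient s h (x, y))\<^sup>2) \<partial>lebesgue)"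
      by (rule nn_integral_cmult) measurable
    finally show ?thesis .
  qed
  have "(\<integral>\<^sup>+x. ennreal ((h x - cell_mean k h x)\<^sup>2) \<partial>lebesgue)
      \<le> (\<integral>\<^sup>+x. ennreal E * (\<integral>\<^sup>+y. ennreal ((diff_quotient s h (x, y))\<^sup>2) \<partial>lebesgue) \<partial>lebesgue)"
    using fib by (rule nn_integral_mono)
  also have "\<dots> = ennreal E * (\<integral>\<^sup>+x. (\<integral>\<^sup>+y. ennreal ((diff_quotient s h (x, y))\<^sup>2) \<partial>lebesgue) \<partial>lebesgue)"
    by (rule nn_integral_cmult) measurable
  also have "\<dots> = ennreal E * (\<integral>\<^sup>+z. ennreal ((diff_quotient s h z)\<^sup>2) \<partial>lebesgue_pair)"
    by (subst leb.nn_integral_fst) measurable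
  also have "\<dots> = ennreal (E * H0s_inner s h h)"
    using E by (simp add: energy_eq[OF h] ennreal_mult H0s_inner_self_nonneg)
  finally have b: "(\<integral>\<^sup>+x. ennreal ((h x - cell_mean k h x)\<^sup>2) \<partial>lebesgue) \<le> ennreal (E * H0s_inner s h h)" .
  then have i: "integrable lebesgue (\<lambda>x. (h x - cell_mean k h x)\<^sup>2)"
    using m by (intro integrableI_bounded) (auto intro: order.strict_trans1)
  then show "square_integrable lebesgue (\<lambda>x. h x - cell_mean k h x)"
    using hm cell_mean_measurable[of k h] by (simp add: square_integrable_def)
  show "(\<integral>x. (h x - cell_mean k h x)\<^sup>2 \<partial>lebesgue) \<le> cell_error s TYPE('a) k * H0s_inner s h h"
    using b E H0s_inner_self_nonneg[of s h] unfolding nn_integral_eq_integral[OF i, simplified]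
    by (simp add: E_def)
qed

section \<open>Compact embedding into square-integrable functions\<close>

text \<open>
  The parallelogram identity, without the term of the sum.
\<close>
lemma H0s_inner_diff_le:
  assumes u: "u \<in> H0s s \<Omega>" and v: "v \<in> H0s s \<Omega>"
  shows "H0s_inner s (\<lambda>x. 1 * u x + (- 1) * v x) (\<lambda>x. 1 * u x + (- 1) * v x)
    \<le> 2 * H0s_inner s u u + 2 * H0s_inner s v v"
  using H0s_inner_lincomb_self[OF u v, of 1 "- 1"] H0s_inner_lincomb_self[OF u v, of 1 1]
    H0s_inner_self_nonneg[of s "\<lambda>x. 1 * u x + 1 * v x"] by simp

lemma integral_square_add_le:
  assumes "square_integrable M f" "square_integrable M g"
  shows "(\<integral>x. (f x + g x)\<^sup>2 \<partial>M) \<le> 2 * (\<integral>x. (f x)\<^sup>2 \<partial>M) + 2 * (\<integral>x. (g x)\<^sup>2 \<partial>M)"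
proof -
  have "integrable M (\<lambda>x. (f x + g x)\<^sup>2)"
    using square_integrable_lincomb[OF assms, of 1 1] by (simp add: square_integrable_def)
  then have "(\<integral>x. (f x + g x)\<^sup>2 \<partial>M) \<le> (\<integral>x. 2 * (f x)\<^sup>2 + 2 * (g x)\<^sup>2 \<partial>M)"
  proof (rule integral_mono)
    show "integrable M (\<lambda>x. 2 * (f x)\<^sup>2 + 2 * (g x)\<^sup>2)"
      using assms by (simp add: square_integrable_def)
    show "(f x + g x)\<^sup>2 \<le> 2 * (f x)\<^sup>2 + 2 * (g x)\<^sup>2" for x
      using zero_le_power2[of "f x - g x"]
      by (simp add: power2_diff power2_sum del: zero_le_power2)
  qed
  then show ?thesis
    using assms by (simp add: square_integrable_def)
qed

lemma young_abs_le:
  fixes t \<delta> :: real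
  assumes "\<delta> > 0"
  shows "\<bar>t\<bar> \<le> \<delta> + t\<^sup>2 / \<delta>"
proof -
  have "2 * (\<bar>t\<bar> * \<delta>) \<le> \<delta>\<^sup>2 + t\<^sup>2" and "0 \<le> \<bar>t\<bar> * \<delta>"
    using sum_squares_bound[of "\<bar>t\<bar>" \<delta>] assms by simp_all
  then have "\<bar>t\<bar> * \<delta> \<le> \<delta>\<^sup>2 + t\<^sup>2"
    by linarith
  then show ?thesis using assms by (simp add: field_simps power2_eq_square)
qed

lemma diagonal_convergent_subsequence:
  fixes c :: "nat \<Rightarrow> 'i \<Rightarrow> real"
  assumes I: "countable I" and bd: "\<And>i. i \<in> I \<Longrightarrow> \<exists>B. \<forall>n. \<bar>c n i\<bar> \<le> B"
  shows "\<exists>r. strict_mono r \<and> (\<forall>i\<in>I. convergent (\<lambda>n. c (r n) i))"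
proof (cases "I = {}")
  case True
  then show ?thesis using strict_mono_id by blast
next
  case False
  define e where "e = from_nat_into I"
  have e: "e j \<in> I" for j using False by (simp add: e_def from_nat_into)
  define P where "P j r \<longleftrightarrow> convergent (\<lambda>n. c (r n) (e j))" for j and r :: "nat \<Rightarrow> nat"
  interpret D: subseqs P
  proof
    fix j and r :: "nat \<Rightarrow> nat" assume "strict_mono r"
    obtain B where "\<forall>n. \<bar>c n (e j)\<bar> \<le> B" using bd[OF e] by blast
    then have "bounded (range (\<lambda>n. c (r n) (e j)))"
      by (auto simp: bounded_iff)
    then obtain l r' where "strict_mono r'" "((\<lambda>n. c (r n) (e j)) \<circ> r') \<longlonglongrightarrow> l"
      using bounded_imp_convergent_subsequence by blast
    then show "\<exists>r'. strict_mono r' \<and> P j (r \<circ> r')"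
      by (auto simp: P_def o_def convergent_def)
  qed
  have "P j D.diagseq" for j
  proof -
    have "P j (D.diagseq \<circ> (+) (Suc j))"
    proof (rule D.diagseq_holds)
      fix r s :: "nat \<Rightarrow> nat" and n assume "strict_mono r" "P n s"
      then show "P n (s \<circ> r)"
        using convergent_subseq_convergent[of "\<lambda>i. c (s i) (e n)" r] by (simp add: P_def o_def)
    qed
    then have "convergent (\<lambda>n. c (D.diagseq (n + Suc j)) (e j))"
      by (simp add: P_def o_def add.commute)
    then show ?thesis
      using convergent_ignore_initial_segment[of "\<lambda>n. c (D.diagseq n) (e j)" "Suc j"] by (simp add: P_def)
  qed
  moreover have "\<exists>j. e j = i" if "i \<in> I" for i
    using from_nat_into_surj[OF I that] by (simp add: e_def)
  ultimately have "\<forall>i\<in>I. convergent (\<lambda>n. c (D.diagseq n) i)"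
    unfolding P_def by metis
  then show ?thesis using D.subseq_diagseq by blast
qed

context fractional_domain
begin

lemma integral_lebesgue_on_le:
  fixes f :: "'a \<Rightarrow> real"
  assumes "integrable lebesgue f" "\<And>x. 0 \<le> f x"
  shows "integrable M f" "(\<integral>x. f x \<partial>M) \<le> (\<integral>x. f x \<partial>lebesgue)"
proof -
  have i: "integrable lebesgue (\<lambda>x. indicator \<Omega> x * f x)"
    using integrable_mult_indicator[OF domain_sets assms(1)] by simp
  then show "integrable M f"
    using domain_sets by (simp add: integrable_restrict_space)
  have "(\<integral>x. f x \<partial>M) = (\<integral>x. indicator \<Omega> x * f x \<partial>lebesgue)"
    using domain_sets by (simp add: integral_restrict_space)
  also have "\<dots> \<le> (\<integral>x. f x \<partial>lebesgue)"
    using i assms by (intro integral_mono) (auto split: split_indicator)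
  finally show "(\<integral>x. f x \<partial>M) \<le> (\<integral>x. f x \<partial>lebesgue)" .
qed

text \<open>
  Along a diagonal subsequence the means over all dyadic cells converge. For a fixed cell size the
  functions differ from their means by a uniformly small amount, and the means are bounded and converge
  pointwise, hence in \<open>L\<^sup>2\<close> of the bounded set \<open>\<Omega>\<close>.
\<close>
lemma H0s_bounded_L2_cauchy_subsequence:
  fixes f :: "nat \<Rightarrow> 'a \<Rightarrow> real"
  assumes f: "\<And>n. f n \<in> H0s s \<Omega>" "\<And>n. H0s_inner s (f n) (f n) \<le> 1"
  shows "\<exists>r :: nat \<Rightarrow> nat. strict_mono r \<and>
    (\<forall>e>0. \<exists>N. \<forall>i\<ge>N. \<forall>j\<ge>N. (\<integral>x. (f (r i) x - f (r j) x)\<^sup>2 \<partial>M) < e)"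
proof -
  obtain C where C: "C > 0" "\<And>u. u \<in> H0s s \<Omega> \<Longrightarrow> (\<integral>x. (u x)\<^sup>2 \<partial>M) \<le> C * H0s_inner s u u"
    using poincare_inequality by blast
  have fsq: "square_integrable lebesgue (f n)" for n
    using f(1)[of n] by (simp add: H0s_iff)
  have fC: "(\<integral>x. (f n x)\<^sup>2 \<partial>lebesgue) \<le> C" for n
    using C(2)[OF f(1)[of n]] integral_H0s_square_on[OF f(1)[of n]]
      mult_left_mono[OF f(2)[of n] less_imp_le[OF C(1)]] by linarith
  define I where "I = Sigma (UNIV :: nat set) (\<lambda>k. range (dyadic_cell k :: 'a \<Rightarrow> _))"
  define mean where "mean n p = (\<integral>y. indicator {y. dyadic_cell (fst p) y = snd p} y * f n y \<partial>lebesgue)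
      / measure lebesgue {y. dyadic_cell (fst p) y = snd p}" for n p
  have mean: "mean n (k, dyadic_cell k x) = cell_mean k (f n) x" for n k x
    by (simp add: mean_def cell_mean_def same_cell_def)
  have cbd: "\<bar>cell_mean k (f n) x\<bar> \<le> 1 + (2 ^ k) ^ DIM('a) * C" for k n x
  proof -
    have "(2 ^ k) ^ DIM('a) * (\<integral>x. (f n x)\<^sup>2 \<partial>lebesgue) \<le> (2 ^ k) ^ DIM('a) * C"
      by (intro mult_left_mono fC) simp
    then show ?thesis
      using cell_mean_bound[OF fsq[of n], of k x] by linarith
  qed
  have "countable I"
    unfolding I_def by (intro countable_SIGMA countable_dyadic_cells) simp
  moreover have "\<exists>B. \<forall>n. \<bar>mean n p\<bar> \<le> B" if p: "p \<in> I" for p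
  proof -
    obtain k x where "p = (k, dyadic_cell k x)" using p by (auto simp: I_def)
    then show ?thesis using cbd mean by metis
  qed
  ultimately obtain r where r: "strict_mono r" "\<forall>p\<in>I. convergent (\<lambda>n. mean (r n) p)"
    using diagonal_convergent_subsequence by blast
  have conv: "convergent (\<lambda>n. cell_mean k (f (r n)) x)" for k x
    using bspec[OF r(2), of "(k, dyadic_cell k x)"] mean by (simp add: I_def)
  have "\<exists>N. \<forall>i\<ge>N. \<forall>j\<ge>N. (\<integral>x. (f (r i) x - f (r j) x)\<^sup>2 \<partial>M) < e" if e: "e > 0" for e
  proof -
    have "\<forall>\<^sub>F k in sequentially. cell_error s TYPE('a) k < e / 16"
      using cell_error_tendsto_0[OF s_pos, where 'a='a] e by (intro order_tendstoD) auto
    then obtain k where k: "cell_error s TYPE('a) k < e / 16"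
      using eventually_happens by force
    define B where "B = 1 + (2 ^ k) ^ DIM('a) * C"
    define a where "a x = lim (\<lambda>n. cell_mean k (f (r n)) x)" for x
    have lim: "(\<lambda>n. cell_mean k (f (r n)) x) \<longlonglongrightarrow> a x" for x
      unfolding a_def using conv convergent_LIMSEQ_iff by blast
    have cm: "cell_mean k (f n) \<in> borel_measurable M" for n
      by (intro measurable_restrict_space1 cell_mean_measurable)
    have am: "a \<in> borel_measurable M"
      by (rule borel_measurable_LIMSEQ_real[OF lim cm])
    have abd: "\<bar>a x\<bar> \<le> B" for x
      using tendsto_rabs[OF lim[of x]] cbd[of k _ x] by (intro tendsto_upperbound) (auto simp: B_def)
    have bsq: "square_integrable M h"
      if "h \<in> borel_measurable M" "\<And>x. \<bar>h x\<bar> \<le> B" for h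
    proof -
      have "(h x)\<^sup>2 \<le> B\<^sup>2" for x
        using power_mono[OF that(2)[of x], of 2] by simp
      then have "integrable M (\<lambda>x. (h x)\<^sup>2)"
        using that(1) by (intro M.integrable_const_bound[of _ "B\<^sup>2"]) auto
      then show ?thesis using that(1) by (simp add: square_integrable_def)
    qed
    have "(\<lambda>n. \<integral>x. (cell_mean k (f (r n)) x - a x)\<^sup>2 \<partial>M) \<longlonglongrightarrow> (\<integral>x. 0 \<partial>M)"
    proof (rule integral_dominated_convergence[where w = "\<lambda>x. (2 * B)\<^sup>2"])
      show "(\<lambda>x. (cell_mean k (f (r n)) x - a x)\<^sup>2) \<in> borel_measurable M" for n
        using cm am by measurable
      show "integrable M (\<lambda>x. (2 * B)\<^sup>2)"
        by simp
      have "(\<lambda>n. (cell_mean k (f (r n)) x - a x)\<^sup>2) \<longlonglongrightarrow> (a x - a x)\<^sup>2" for x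
        by (intro tendsto_intros lim)
      then show "AE x in M. (\<lambda>n. (cell_mean k (f (r n)) x - a x)\<^sup>2) \<longlonglongrightarrow> 0"
        by simp
      have "\<bar>cell_mean k (f (r n)) x - a x\<bar> \<le> 2 * B" for n x
        using cbd[of k "r n" x] abd[of x] by (simp add: B_def)
      then have "(cell_mean k (f (r n)) x - a x)\<^sup>2 \<le> (2 * B)\<^sup>2" for n x
        using power_mono[of "\<bar>cell_mean k (f (r n)) x - a x\<bar>" "2 * B" 2] by simp
      then show "AE x in M. norm ((cell_mean k (f (r n)) x - a x)\<^sup>2) \<le> (2 * B)\<^sup>2" for n
        by simp
    qed simp
    then have "\<forall>\<^sub>F n in sequentially. (\<integral>x. (cell_mean k (f (r n)) x - a x)\<^sup>2 \<partial>M) < e / 16"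
      using e by (intro order_tendstoD) auto
    then obtain N where N: "\<And>n. n \<ge> N \<Longrightarrow> (\<integral>x. (cell_mean k (f (r n)) x - a x)\<^sup>2 \<partial>M) < e / 16"
      unfolding eventually_sequentially by blast
    have "(\<integral>x. (f (r i) x - f (r j) x)\<^sup>2 \<partial>M) < e" if ij: "i \<ge> N" "j \<ge> N" for i j
    proof -
      define h where "h x = 1 * f (r i) x + (- 1) * f (r j) x" for x
      have hH: "h \<in> H0s s \<Omega>"
        unfolding h_def by (intro H0s_lincomb f)
      have hinner: "H0s_inner s h h \<le> 4"
        using H0s_inner_diff_le[OF f(1)[of "r i"] f(1)[of "r j"]] f(2)[of "r i"] f(2)[of "r j"]
        unfolding h_def[abs_def] by linarith
      define p where "p x = h x - cell_mean k h x" for x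
      define q1 where "q1 x = cell_mean k (f (r i)) x - a x" for x
      define q2 where "q2 x = a x - cell_mean k (f (r j)) x" for x
      have ce: "0 \<le> cell_error s TYPE('a) k" by (simp add: cell_error_def)
      have psq: "square_integrable lebesgue p" and pint: "(\<integral>x. (p x)\<^sup>2 \<partial>lebesgue) \<le> cell_error s TYPE('a) k * H0s_inner s h h"
        using cell_mean_error[OF hH s_pos, of k] by (auto simp: p_def[abs_def])
      have psq': "square_integrable M p"
        and pint': "(\<integral>x. (p x)\<^sup>2 \<partial>M) \<le> (\<integral>x. (p x)\<^sup>2 \<partial>lebesgue)"
        using integral_lebesgue_on_le[of "\<lambda>x. (p x)\<^sup>2"] psq
        by (auto simp: square_integrable_def intro: measurable_restrict_space1)
      have "cell_error s TYPE('a) k * H0s_inner s h h \<le> cell_error s TYPE('a) k * 4"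
        using hinner ce by (intro mult_left_mono)
      then have p4: "(\<integral>x. (p x)\<^sup>2 \<partial>M) < e / 4"
        using pint pint' k by linarith
      have csq: "square_integrable M (cell_mean k (f n))" for n
        using cbd[of k n] by (intro bsq cm) (simp add: B_def)
      have asq: "square_integrable M a"
        using abd by (intro bsq am)
      have q1sq: "square_integrable M q1"
        using square_integrable_lincomb[OF csq[of "r i"] asq, of 1 "- 1"] by (simp add: q1_def[abs_def])
      have q2sq: "square_integrable M q2"
        using square_integrable_lincomb[OF asq csq[of "r j"], of 1 "- 1"] by (simp add: q2_def[abs_def])
      have qsq: "square_integrable M (\<lambda>x. q1 x + q2 x)"
        using square_integrable_lincomb[OF q1sq q2sq, of 1 1] by simp
      have "(\<integral>x. (f (r i) x - f (r j) x)\<^sup>2 \<partial>M) = (\<integral>x. (p x + (q1 x + q2 x))\<^sup>2 \<partial>M)"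
      proof (rule Bochner_Integration.integral_cong[OF refl])
        fix x
        have "cell_mean k h x = cell_mean k (f (r i)) x - cell_mean k (f (r j)) x"
          unfolding h_def[abs_def] by (rule cell_mean_diff[OF fsq fsq])
        then show "(f (r i) x - f (r j) x)\<^sup>2 = (p x + (q1 x + q2 x))\<^sup>2"
          by (simp add: p_def q1_def q2_def h_def)
      qed
      also have "\<dots> \<le> 2 * (\<integral>x. (p x)\<^sup>2 \<partial>M) + 2 * (\<integral>x. (q1 x + q2 x)\<^sup>2 \<partial>M)"
        by (rule integral_square_add_le[OF psq' qsq])
      also have "(\<integral>x. (q1 x + q2 x)\<^sup>2 \<partial>M)
          \<le> 2 * (\<integral>x. (q1 x)\<^sup>2 \<partial>M) + 2 * (\<integral>x. (q2 x)\<^sup>2 \<partial>M)"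
        by (rule integral_square_add_le[OF q1sq q2sq])
      also have "(\<integral>x. (q1 x)\<^sup>2 \<partial>M) < e / 16"
        using N[OF ij(1)] by (simp add: q1_def)
      also have "(\<integral>x. (q2 x)\<^sup>2 \<partial>M) = (\<integral>x. (cell_mean k (f (r j)) x - a x)\<^sup>2 \<partial>M)"
        by (simp add: q2_def power2_commute)
      also have "\<dots> < e / 16"
        by (rule N[OF ij(2)])
      finally show ?thesis using p4 by simp
    qed
    then show ?thesis by blast
  qed
  then show ?thesis using r(1) by blast
qed

text \<open>
  A further subsequence converges almost everywhere; Fatou's lemma on the product space shows that the
  limit has energy at most 1, and on \<open>\<Omega>\<close> that the convergence also holds in \<open>L\<^sup>2\<close>.
\<close>
theorem H0s_compact_embedding:
  fixes f :: "nat \<Rightarrow> 'a \<Rightarrow> real"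
  assumes f: "\<And>n. f n \<in> H0s s \<Omega>" "\<And>n. H0s_inner s (f n) (f n) \<le> 1"
  shows "\<exists>g (r :: nat \<Rightarrow> nat). strict_mono r \<and> g \<in> H0s s \<Omega> \<and> H0s_inner s g g \<le> 1 \<and>
    (\<lambda>n. \<integral>x. (f (r n) x - g x)\<^sup>2 \<partial>M) \<longlonglongrightarrow> 0"
proof -
  obtain r0 :: "nat \<Rightarrow> nat" where r0: "strict_mono r0"
    "\<And>e. e > 0 \<Longrightarrow> \<exists>N. \<forall>i\<ge>N. \<forall>j\<ge>N. (\<integral>x. (f (r0 i) x - f (r0 j) x)\<^sup>2 \<partial>M) < e"
    using H0s_bounded_L2_cauchy_subsequence[of f, OF f] by auto
  have sq: "square_integrable M (f n)" for n
    by (rule H0s_on[OF f(1)])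
  have one: "square_integrable M (\<lambda>x. 1)"
    using M.integrable_const by (simp add: square_integrable_def)
  have int: "integrable M (f n)" for n
    using square_integrable_mult[OF sq one] by simp
  have dsq: "integrable M (\<lambda>x. (f i x - f j x)\<^sup>2)" for i j
    using square_integrable_lincomb[OF sq[of i] sq[of j], of 1 "- 1"] by (simp add: square_integrable_def)
  obtain r1 where r1: "strict_mono r1" "AE x in M. Cauchy (\<lambda>i. f (r0 (r1 i)) x)"
  proof (rule cauchy_L1_AE_cauchy_subseq[of "M" "\<lambda>i. f (r0 i)"])
    show "integrable M (f (r0 n))" for n by (rule int)
    fix e :: real assume e: "e > 0"
    define V where "V = measure M \<Omega>"
    \<comment> \<open>Young's inequality with parameter \<open>\<delta>\<close> bounds the \<open>L\<^sup>1\<close> norm by \<open>\<delta> * V\<close> plus the squared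
      \<open>L\<^sup>2\<close> norm divided by \<open>\<delta>\<close>; each part is made smaller than \<open>e / 2\<close>.\<close>
    define \<delta> where "\<delta> = e / (2 * (V + 1))"
    have V: "V \<ge> 0" by (simp add: V_def)
    then have \<delta>: "\<delta> > 0" using e by (simp add: \<delta>_def)
    have \<delta>V: "\<delta> * V < e / 2" using e V by (simp add: \<delta>_def field_simps)
    obtain N where N: "\<And>i j. i \<ge> N \<Longrightarrow> j \<ge> N \<Longrightarrow>
        (\<integral>x. (f (r0 i) x - f (r0 j) x)\<^sup>2 \<partial>M) < \<delta> * e / 2"
      using r0(2)[of "\<delta> * e / 2"] \<delta> e by auto
    have "(\<integral>x. norm (f (r0 i) x - f (r0 j) x) \<partial>M) < e" if "i \<ge> N" "j \<ge> N" for i j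
    proof -
      have "(\<integral>x. norm (f (r0 i) x - f (r0 j) x) \<partial>M)
          \<le> (\<integral>x. \<delta> + (f (r0 i) x - f (r0 j) x)\<^sup>2 / \<delta> \<partial>M)"
      proof (rule integral_mono)
        show "integrable M (\<lambda>x. norm (f (r0 i) x - f (r0 j) x))"
          using int by simp
        show "integrable M (\<lambda>x. \<delta> + (f (r0 i) x - f (r0 j) x)\<^sup>2 / \<delta>)"
          using dsq[of "r0 i" "r0 j"] M.integrable_const
          by (intro Bochner_Integration.integrable_add) auto
        show "norm (f (r0 i) x - f (r0 j) x) \<le> \<delta> + (f (r0 i) x - f (r0 j) x)\<^sup>2 / \<delta>" for x
          using young_abs_le[OF \<delta>] by simp
      qed
      also have "\<dots> = (\<integral>x. \<delta> \<partial>M) + (\<integral>x. (f (r0 i) x - f (r0 j) x)\<^sup>2 / \<delta> \<partial>M)"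
        using dsq[of "r0 i" "r0 j"] M.integrable_const
        by (intro Bochner_Integration.integral_add) auto
      also have "\<dots> = \<delta> * V + (\<integral>x. (f (r0 i) x - f (r0 j) x)\<^sup>2 \<partial>M) / \<delta>"
        by (simp add: V_def)
      also have "\<dots> < e / 2 + e / 2"
        using N[OF that] \<delta>V \<delta> by (intro add_strict_mono) (auto simp: field_simps)
      finally show ?thesis by simp
    qed
    then show "\<exists>N. \<forall>i\<ge>N. \<forall>j\<ge>N. (\<integral>x. norm (f (r0 i) x - f (r0 j) x) \<partial>M) < e"
      by blast
  qed auto
  define G where "G n = f (r0 (r1 n))" for n
  define g where "g x = (if x \<in> \<Omega> then lim (\<lambda>n. G n x) else 0)" for x
  have Gm: "G n \<in> borel_measurable lebesgue" for n
    unfolding G_def by (rule H0s_measurable(1)[OF f(1)])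
  have gm[measurable]: "g \<in> borel_measurable lebesgue"
    unfolding g_def using domain_sets Gm by (intro measurable_If_set borel_measurable_lim_metric) auto
  have conv: "AE x in lebesgue. (\<lambda>n. G n x) \<longlonglongrightarrow> g x"
  proof -
    have "AE x in lebesgue. x \<in> \<Omega> \<longrightarrow> Cauchy (\<lambda>n. G n x)"
      using r1(2) domain_sets by (simp add: AE_restrict_space_iff G_def)
    moreover have "AE x in lebesgue. \<forall>n. x \<notin> \<Omega> \<longrightarrow> G n x = 0"
      using f(1) unfolding AE_all_countable G_def by (simp add: H0s_iff)
    ultimately show ?thesis
    proof eventually_elim
      case (elim x)
      show ?case
      proof (cases "x \<in> \<Omega>")
        case True
        then have "convergent (\<lambda>n. G n x)" using elim by (simp add: Cauchy_convergent_iff)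
        then show ?thesis using True by (simp add: g_def convergent_LIMSEQ_iff)
      next
        case False
        then have "(\<lambda>n. G n x) = (\<lambda>n. 0)" using elim by auto
        then show ?thesis using False by (simp add: g_def)
      qed
    qed
  qed
  have "(\<integral>\<^sup>+z. ennreal ((diff_quotient s g z)\<^sup>2) \<partial>lebesgue_pair)
      = (\<integral>\<^sup>+z. liminf (\<lambda>n. ennreal ((diff_quotient s (G n) z)\<^sup>2)) \<partial>lebesgue_pair)"
  proof (rule nn_integral_cong_AE)
    show "AE z in lebesgue_pair. ennreal ((diff_quotient s g z)\<^sup>2)
        = liminf (\<lambda>n. ennreal ((diff_quotient s (G n) z)\<^sup>2))"
      using AE_lebesgue_pair[OF conv]
    proof eventually_elim
      case (elim z)
      then have "(\<lambda>n. (G n (fst z) - G n (snd z)) / norm (fst z - snd z) powr (real DIM('a) / 2 + s))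
          \<longlonglongrightarrow> (g (fst z) - g (snd z)) / norm (fst z - snd z) powr (real DIM('a) / 2 + s)"
        unfolding divide_inverse by (intro tendsto_mult_right tendsto_diff) auto
      then have "(\<lambda>n. diff_quotient s (G n) z) \<longlonglongrightarrow> diff_quotient s g z"
        by (simp add: diff_quotient_def)
      then have "(\<lambda>n. ennreal ((diff_quotient s (G n) z)\<^sup>2)) \<longlonglongrightarrow> ennreal ((diff_quotient s g z)\<^sup>2)"
        by (intro tendsto_ennrealI tendsto_power)
      then show ?case
        by (intro lim_imp_Liminf[symmetric]) auto
    qed
  qed
  also have "\<dots> \<le> liminf (\<lambda>n. \<integral>\<^sup>+z. ennreal ((diff_quotient s (G n) z)\<^sup>2) \<partial>lebesgue_pair)"
    using Gm by (intro nn_integral_liminf) measurable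
  also have "\<dots> \<le> liminf (\<lambda>n. ennreal 1)"
    using f(2) by (intro Liminf_mono always_eventually allI)
      (simp add: G_def energy_eq[OF f(1)] del: ennreal_1)
  also have "\<dots> = ennreal 1"
    by (simp add: Liminf_const)
  finally have en: "square_integrable lebesgue_pair (diff_quotient s g)" "H0s_inner s g g \<le> 1"
    using H0s_inner_le_energy[OF gm, of 1] by auto
  have Gsq: "square_integrable M (G n)" for n
    unfolding G_def by (rule sq)
  have fatou: "(\<integral>\<^sup>+x. ennreal ((G n x - g x)\<^sup>2) \<partial>M) \<le> ennreal e"
    if e: "e > 0" and N: "\<And>m. m \<ge> N \<Longrightarrow> (\<integral>x. (G n x - G m x)\<^sup>2 \<partial>M) < e" for n N e
  proof -
    have "AE x in M. (\<lambda>n. G n x) \<longlonglongrightarrow> g x"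
      using conv domain_sets by (auto simp: AE_restrict_space_iff)
    then have "(\<integral>\<^sup>+x. ennreal ((G n x - g x)\<^sup>2) \<partial>M)
        = (\<integral>\<^sup>+x. liminf (\<lambda>m. ennreal ((G n x - G m x)\<^sup>2)) \<partial>M)"
    proof (intro nn_integral_cong_AE, eventually_elim)
      case (elim x)
      then have "(\<lambda>m. ennreal ((G n x - G m x)\<^sup>2)) \<longlonglongrightarrow> ennreal ((G n x - g x)\<^sup>2)"
        by (intro tendsto_ennrealI tendsto_power tendsto_diff tendsto_const)
      then show ?case
        by (intro lim_imp_Liminf[symmetric]) auto
    qed
    also have "\<dots> \<le> liminf (\<lambda>m. \<integral>\<^sup>+x. ennreal ((G n x - G m x)\<^sup>2) \<partial>M)"
      using Gsq by (intro nn_integral_liminf measurable_compose[OF _ measurable_ennreal]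
          borel_measurable_power borel_measurable_diff) (auto simp: square_integrable_def)
    also have "\<dots> \<le> liminf (\<lambda>m. ennreal e)"
    proof (rule Liminf_mono)
      show "\<forall>\<^sub>F m in sequentially. (\<integral>\<^sup>+x. ennreal ((G n x - G m x)\<^sup>2) \<partial>M) \<le> ennreal e"
      proof (rule eventually_sequentiallyI[of N])
        fix m assume "m \<ge> N"
        then show "(\<integral>\<^sup>+x. ennreal ((G n x - G m x)\<^sup>2) \<partial>M) \<le> ennreal e"
          using N[of m] dsq[of "r0 (r1 n)" "r0 (r1 m)"]
          by (subst nn_integral_eq_integral) (auto simp: G_def intro: ennreal_leI)
      qed
    qed
    also have "\<dots> = ennreal e"
      by (simp add: Liminf_const)
    finally show ?thesis .
  qed
  have cauchyG: "\<exists>N. \<forall>i\<ge>N. \<forall>j\<ge>N. (\<integral>x. (G i x - G j x)\<^sup>2 \<partial>M) < e" if "e > 0" for e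
  proof -
    obtain N where "\<forall>i\<ge>N. \<forall>j\<ge>N. (\<integral>x. (f (r0 i) x - f (r0 j) x)\<^sup>2 \<partial>M) < e"
      using r0(2)[OF \<open>e > 0\<close>] by blast
    moreover have "r1 i \<ge> N" if "i \<ge> N" for i
      using seq_suble[OF r1(1), of i] that by linarith
    ultimately show ?thesis unfolding G_def by blast
  qed
  have gmO: "g \<in> borel_measurable M"
    using gm by (rule measurable_restrict_space1)
  have GmO: "G n \<in> borel_measurable M" for n
    using Gm by (rule measurable_restrict_space1)
  have close: "\<exists>N. \<forall>n\<ge>N. integrable M (\<lambda>x. (G n x - g x)\<^sup>2) \<and>
      (\<integral>x. (G n x - g x)\<^sup>2 \<partial>M) \<le> e" if e: "e > 0" for e
  proof -
    obtain N where N: "\<And>i j. i \<ge> N \<Longrightarrow> j \<ge> N \<Longrightarrow> (\<integral>x. (G i x - G j x)\<^sup>2 \<partial>M) < e"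
      using cauchyG[OF e] by blast
    have "integrable M (\<lambda>x. (G n x - g x)\<^sup>2) \<and>
        (\<integral>x. (G n x - g x)\<^sup>2 \<partial>M) \<le> e" if n: "n \<ge> N" for n
    proof -
      have b: "(\<integral>\<^sup>+x. ennreal ((G n x - g x)\<^sup>2) \<partial>M) \<le> ennreal e"
        using N[OF n] by (intro fatou[OF e, of N]) auto
      then have i: "integrable M (\<lambda>x. (G n x - g x)\<^sup>2)"
        using gmO GmO[of n] by (intro integrableI_bounded) (auto intro: order.strict_trans1)
      then have "ennreal (\<integral>x. (G n x - g x)\<^sup>2 \<partial>M) \<le> ennreal e"
        using b by (subst (asm) nn_integral_eq_integral) auto
      then show ?thesis using i e by (simp add: ennreal_le_iff)
    qed
    then show ?thesis by blast
  qed
  have gsq: "square_integrable M g"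
  proof -
    obtain N where "integrable M (\<lambda>x. (G N x - g x)\<^sup>2)"
      using close[of 1] by force
    then have "square_integrable M (\<lambda>x. G N x - g x)"
      using gmO GmO[of N] by (simp add: square_integrable_def)
    from square_integrable_lincomb[OF Gsq[of N] this, of 1 "- 1"] show ?thesis by simp
  qed
  then have "integrable lebesgue (\<lambda>x. indicator \<Omega> x * (g x)\<^sup>2)"
    using domain_sets by (simp add: square_integrable_def integrable_restrict_space)
  moreover have "(\<lambda>x. indicator \<Omega> x * (g x)\<^sup>2) = (\<lambda>x. (g x)\<^sup>2)"
    by (auto simp: g_def split: split_indicator)
  ultimately have gH: "g \<in> H0s s \<Omega>"
    using en(1) by (simp add: H0s_iff square_integrable_def g_def)
  have "(\<lambda>n. \<integral>x. (G n x - g x)\<^sup>2 \<partial>M) \<longlonglongrightarrow> 0"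
  proof (rule LIMSEQ_I)
    fix e :: real assume "e > 0"
    then obtain N where "\<forall>n\<ge>N. (\<integral>x. (G n x - g x)\<^sup>2 \<partial>M) \<le> e / 2"
      using close[of "e / 2"] by auto
    moreover have "0 \<le> (\<integral>x. (G n x - g x)\<^sup>2 \<partial>M)" for n
      by (intro integral_nonneg_AE) auto
    ultimately have "\<forall>n\<ge>N. norm ((\<integral>x. (G n x - g x)\<^sup>2 \<partial>M) - 0) < e"
      using \<open>e > 0\<close> by fastforce
    then show "\<exists>N. \<forall>n\<ge>N. norm ((\<integral>x. (G n x - g x)\<^sup>2 \<partial>M) - 0) < e" ..
  qed
  moreover have "strict_mono (r0 \<circ> r1)"
    using r0(1) r1(1) by (rule strict_mono_o)
  ultimately show ?thesis
    using gH en(2) unfolding G_def by (intro exI[of _ g] exI[of _ "r0 \<circ> r1"]) simp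
qed

end

section \<open>The variational characterization of the first eigenvalue\<close>

definition weight_form :: "'a::euclidean_space set \<Rightarrow> ('a \<Rightarrow> real) \<Rightarrow> ('a \<Rightarrow> real) \<Rightarrow> ('a \<Rightarrow> real) \<Rightarrow> real" where
  "weight_form \<Omega> \<rho> u v = (\<integral>x. \<rho> x * u x * v x \<partial>lebesgue_on \<Omega>)"

text \<open>
  The bound is a parameter, because estimates have to be uniform over a whole rearrangement class.
\<close>
definition bounded_weight :: "'a::euclidean_space set \<Rightarrow> real \<Rightarrow> ('a \<Rightarrow> real) \<Rightarrow> bool" where
  "bounded_weight \<Omega> C \<rho> \<longleftrightarrow> \<rho> \<in> borel_measurable (lebesgue_on \<Omega>) \<and>
    (AE x in lebesgue_on \<Omega>. \<bar>\<rho> x\<bar> \<le> C)"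

text \<open>
  A point of the unit sphere at which the quadratic form of the weight is positive and has its maximum
  over the sphere, stated in homogeneous form.
\<close>
definition maximizer ::
    "real \<Rightarrow> 'a::euclidean_space set \<Rightarrow> ('a \<Rightarrow> real) \<Rightarrow> ('a \<Rightarrow> real) \<Rightarrow> bool" where
  "maximizer s \<Omega> \<rho> u \<longleftrightarrow> u \<in> H0s s \<Omega> \<and> H0s_inner s u u = 1 \<and> 0 < weight_form \<Omega> \<rho> u u \<and>
    (\<forall>v\<in>H0s s \<Omega>. weight_form \<Omega> \<rho> v v \<le> weight_form \<Omega> \<rho> u u * H0s_inner s v v)"

text \<open>
  For small \<open>t\<close> of the right sign the linear term would dominate.
\<close>
lemma linear_coefficient_zero:
  fixes a b :: real
  assumes "\<And>t. 0 \<le> 2 * t * a + t\<^sup>2 * b"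
  shows "a = 0"
proof (rule ccontr)
  assume a: "a \<noteq> 0"
  define B where "B = \<bar>b\<bar> + 1"
  have B: "B > 0" "b < B" by (auto simp: B_def)
  have "0 \<le> 2 * (- a / B) * a + (- a / B)\<^sup>2 * b" by (rule assms)
  also have "\<dots> = (a\<^sup>2 / B\<^sup>2) * (b - 2 * B)"
    using B by (simp add: field_simps power2_eq_square)
  also have "\<dots> < 0"
    using a B by (intro mult_pos_neg) auto
  finally show False by simp
qed

context fractional_domain
begin

abbreviation "W \<equiv> weight_form \<Omega>"

lemma H0s_scale: "u \<in> H0s s \<Omega> \<Longrightarrow> (\<lambda>x. c * u x) \<in> H0s s \<Omega>"
  using H0s_lincomb[of u s \<Omega> u c 0] by simp

lemma H0s_inner_scale: "u \<in> H0s s \<Omega> \<Longrightarrow> H0s_inner s (\<lambda>x. c * u x) (\<lambda>x. c * u x) = c\<^sup>2 * H0s_inner s u u"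
  using H0s_inner_lincomb_self[of u s \<Omega> u c 0] by simp

lemma weight_integrable:
  assumes \<rho>: "bounded_weight \<Omega> C \<rho>" and w: "integrable M w"
  shows "integrable M (\<lambda>x. \<rho> x * w x)"
proof (rule Bochner_Integration.integrable_bound)
  show "integrable M (\<lambda>x. C * w x)"
    using w by simp
  show "(\<lambda>x. \<rho> x * w x) \<in> borel_measurable M"
    using \<rho> w by (intro borel_measurable_times) (auto simp: bounded_weight_def)
  have "AE x in M. \<bar>\<rho> x\<bar> \<le> C"
    using \<rho> by (simp add: bounded_weight_def)
  then show "AE x in M. norm (\<rho> x * w x) \<le> norm (C * w x)"
    by eventually_elim (auto simp: abs_mult intro!: mult_right_mono)
qed

lemma weight_form_integrable:
  assumes "bounded_weight \<Omega> C \<rho>" "u \<in> H0s s \<Omega>" "v \<in> H0s s \<Omega>"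
  shows "integrable M (\<lambda>x. \<rho> x * u x * v x)"
  using weight_integrable[OF assms(1) square_integrable_mult[OF H0s_on[OF assms(2)] H0s_on[OF assms(3)]]]
  by (simp add: mult.assoc)

lemma weight_form_lincomb_self:
  assumes \<rho>: "bounded_weight \<Omega> C \<rho>" and u: "u \<in> H0s s \<Omega>" and v: "v \<in> H0s s \<Omega>"
  shows "W \<rho> (\<lambda>x. a * u x + b * v x) (\<lambda>x. a * u x + b * v x)
     = a\<^sup>2 * W \<rho> u u + 2 * a * b * W \<rho> u v + b\<^sup>2 * W \<rho> v v"
proof -
  note I = weight_form_integrable[OF \<rho> u u] weight_form_integrable[OF \<rho> u v] weight_form_integrable[OF \<rho> v v]
  have "(\<lambda>x. \<rho> x * (a * u x + b * v x) * (a * u x + b * v x))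
      = (\<lambda>x. a\<^sup>2 * (\<rho> x * u x * u x) + 2 * a * b * (\<rho> x * u x * v x) + b\<^sup>2 * (\<rho> x * v x * v x))"
    by (auto simp: algebra_simps power2_eq_square)
  then show ?thesis
    unfolding weight_form_def using I by simp
qed

lemma weight_form_scale:
  assumes "bounded_weight \<Omega> C \<rho>" "u \<in> H0s s \<Omega>"
  shows "W \<rho> (\<lambda>x. c * u x) (\<lambda>x. c * u x) = c\<^sup>2 * W \<rho> u u"
  using weight_form_lincomb_self[OF assms assms(2), of c 0] by simp

lemma weighted_integral_le:
  assumes \<rho>: "bounded_weight \<Omega> C \<rho>" and w: "integrable M w"
  shows "\<bar>\<integral>x. \<rho> x * w x \<partial>M\<bar> \<le> C * (\<integral>x. \<bar>w x\<bar> \<partial>M)"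
proof -
  note i = weight_integrable[OF assms]
  have "\<bar>\<integral>x. \<rho> x * w x \<partial>M\<bar> \<le> (\<integral>x. \<bar>\<rho> x * w x\<bar> \<partial>M)"
    by (rule integral_abs_bound)
  also have "\<dots> \<le> (\<integral>x. C * \<bar>w x\<bar> \<partial>M)"
  proof (rule integral_mono_AE)
    have "AE x in M. \<bar>\<rho> x\<bar> \<le> C"
      using \<rho> by (simp add: bounded_weight_def)
    then show "AE x in M. \<bar>\<rho> x * w x\<bar> \<le> C * \<bar>w x\<bar>"
      by eventually_elim (auto simp: abs_mult intro!: mult_right_mono)
  qed (use i w in auto)
  finally show ?thesis by simp
qed

lemma weight_form_le:
  assumes "bounded_weight \<Omega> C \<rho>" "u \<in> H0s s \<Omega>"
  shows "\<bar>W \<rho> u u\<bar> \<le> C * (\<integral>x. (u x)\<^sup>2 \<partial>M)"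
proof -
  have "W \<rho> u u = (\<integral>x. \<rho> x * (u x)\<^sup>2 \<partial>M)"
    by (simp add: weight_form_def power2_eq_square mult.assoc)
  moreover have "\<bar>\<integral>x. \<rho> x * (u x)\<^sup>2 \<partial>M\<bar> \<le> C * (\<integral>x. \<bar>(u x)\<^sup>2\<bar> \<partial>M)"
    using H0s_on[OF assms(2)] by (intro weighted_integral_le[OF assms(1)]) (simp add: square_integrable_def)
  ultimately show ?thesis by simp
qed

lemma H0s_inner_pos:
  assumes u: "u \<in> H0s s \<Omega>" and nz: "\<not> (AE x in lebesgue. u x = 0)"
  shows "0 < H0s_inner s u u"
proof (rule ccontr)
  assume "\<not> 0 < H0s_inner s u u"
  then have z: "H0s_inner s u u = 0"
    using H0s_inner_self_nonneg[of s u] by linarith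
  obtain P where "(\<integral>x. (u x)\<^sup>2 \<partial>M) \<le> P * H0s_inner s u u"
    using poincare_inequality u by metis
  then have "(\<integral>x. (u x)\<^sup>2 \<partial>lebesgue) \<le> 0"
    using z integral_H0s_square_on[OF u] by simp
  moreover have "integrable lebesgue (\<lambda>x. (u x)\<^sup>2)"
    using u by (simp add: H0s_iff square_integrable_def)
  moreover have "0 \<le> (\<integral>x. (u x)\<^sup>2 \<partial>lebesgue)"
    by (intro integral_nonneg_AE) auto
  ultimately have "AE x in lebesgue. (u x)\<^sup>2 = 0"
    using integral_nonneg_eq_0_iff_AE[of lebesgue "\<lambda>x. (u x)\<^sup>2"] by auto
  then show False using nz by simp
qed

text \<open>
  Write \<open>f\<^sup>2 - g\<^sup>2 = (f - g) * (f + g)\<close>. The first factor is small in \<open>L\<^sup>2\<close> and the second one is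
  bounded by the Poincare inequality, so the difference of the forms is small uniformly in all weights
  with the bound \<open>C\<close>.
\<close>
lemma weight_form_tendsto:
  assumes \<rho>: "\<And>n. bounded_weight \<Omega> C (\<rho> n)" and C: "0 \<le> C"
    and f: "\<And>n. f n \<in> H0s s \<Omega>" "\<And>n. H0s_inner s (f n) (f n) \<le> 1"
    and g: "g \<in> H0s s \<Omega>" "H0s_inner s g g \<le> 1"
    and lim: "(\<lambda>n. \<integral>x. (f n x - g x)\<^sup>2 \<partial>M) \<longlonglongrightarrow> 0"
  shows "(\<lambda>n. W (\<rho> n) (f n) (f n) - W (\<rho> n) g g) \<longlonglongrightarrow> 0"
proof -
  obtain P where P: "P > 0" "\<And>u. u \<in> H0s s \<Omega> \<Longrightarrow> (\<integral>x. (u x)\<^sup>2 \<partial>M) \<le> P * H0s_inner s u u"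
    using poincare_inequality by blast
  have P1: "(\<integral>x. (u x)\<^sup>2 \<partial>M) \<le> P" if "u \<in> H0s s \<Omega>" "H0s_inner s u u \<le> 1" for u
    using P(2)[OF that(1)] mult_left_mono[OF that(2) less_imp_le[OF P(1)]] by linarith
  define D where "D n = (\<integral>x. (f n x - g x)\<^sup>2 \<partial>M)" for n
  have D0: "0 \<le> D n" for n
    unfolding D_def by (intro integral_nonneg_AE) auto
  \<comment> \<open>The summand \<open>1 / Suc n\<close> keeps the parameter of Young's inequality positive if \<open>D n = 0\<close>.\<close>
  define \<delta> where "\<delta> n = sqrt (D n) + 1 / real (Suc n)" for n
  have \<delta>: "\<delta> n > 0" for n
    using D0[of n] by (auto simp: \<delta>_def intro: add_nonneg_pos)
  have D\<delta>: "D n / \<delta> n \<le> \<delta> n" for n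
  proof -
    have "sqrt (D n) \<le> \<delta> n" by (simp add: \<delta>_def)
    then have "D n \<le> (\<delta> n)\<^sup>2"
      using D0[of n] \<delta>[of n] by (simp add: real_sqrt_le_iff' sqrt_le_D)
    then show ?thesis using \<delta>[of n] by (simp add: field_simps power2_eq_square)
  qed
  have bound: "\<bar>W (\<rho> n) (f n) (f n) - W (\<rho> n) g g\<bar> \<le> C * (4 * P + 1) * \<delta> n" for n
  proof -
    have sqf: "square_integrable M (f n)" and sqg: "square_integrable M g"
      using H0s_on f(1) g(1) by auto
    have sqd: "square_integrable M (\<lambda>x. f n x - g x)"
      using square_integrable_lincomb[OF sqf sqg, of 1 "- 1"] by simp
    have sqp: "square_integrable M (\<lambda>x. f n x + g x)"
      using square_integrable_lincomb[OF sqf sqg, of 1 1] by simp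
    note ip = square_integrable_mult[OF sqd sqp]
    have "W (\<rho> n) (f n) (f n) - W (\<rho> n) g g = (\<integral>x. \<rho> n x * ((f n x - g x) * (f n x + g x)) \<partial>M)"
      unfolding weight_form_def
      using weight_form_integrable[OF \<rho> f(1) f(1), of n n n] weight_form_integrable[OF \<rho> g(1) g(1), of n]
      by (subst Bochner_Integration.integral_diff[symmetric]) (auto simp: algebra_simps)
    then have le: "\<bar>W (\<rho> n) (f n) (f n) - W (\<rho> n) g g\<bar>
        \<le> C * (\<integral>x. \<bar>(f n x - g x) * (f n x + g x)\<bar> \<partial>M)"
      using weighted_integral_le[OF \<rho> ip] by simp
    have "(\<integral>x. \<bar>(f n x - g x) * (f n x + g x)\<bar> \<partial>M)
        \<le> (\<integral>x. \<delta> n * (f n x + g x)\<^sup>2 + (f n x - g x)\<^sup>2 / \<delta> n \<partial>M)"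
    proof (rule integral_mono)
      show "integrable M (\<lambda>x. \<bar>(f n x - g x) * (f n x + g x)\<bar>)"
        using ip by simp
      show "integrable M (\<lambda>x. \<delta> n * (f n x + g x)\<^sup>2 + (f n x - g x)\<^sup>2 / \<delta> n)"
        using sqd sqp by (simp add: square_integrable_def)
      have "\<bar>a * b\<bar> \<le> \<delta> n * b\<^sup>2 + a\<^sup>2 / \<delta> n" for a b :: real
      proof -
        have "2 * (\<bar>a\<bar> * (\<delta> n * \<bar>b\<bar>)) \<le> a\<^sup>2 + (\<delta> n)\<^sup>2 * b\<^sup>2" and "0 \<le> \<bar>a\<bar> * (\<delta> n * \<bar>b\<bar>)"
          using sum_squares_bound[of "\<bar>a\<bar>" "\<delta> n * \<bar>b\<bar>"] \<delta>[of n] by (simp_all add: power_mult_distrib)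
        then have "\<bar>a\<bar> * (\<delta> n * \<bar>b\<bar>) \<le> a\<^sup>2 + (\<delta> n)\<^sup>2 * b\<^sup>2"
          by linarith
        then show ?thesis using \<delta>[of n] by (simp add: field_simps power2_eq_square abs_mult)
      qed
      then show "\<bar>(f n x - g x) * (f n x + g x)\<bar> \<le> \<delta> n * (f n x + g x)\<^sup>2 + (f n x - g x)\<^sup>2 / \<delta> n" for x
        by blast
    qed
    also have "\<dots> = \<delta> n * (\<integral>x. (f n x + g x)\<^sup>2 \<partial>M) + D n / \<delta> n"
      using sqd sqp by (simp add: square_integrable_def D_def)
    also have "\<dots> \<le> \<delta> n * (4 * P) + \<delta> n"
      using integral_square_add_le[OF sqf sqg] P1[OF f(1) f(2), of n] P1[OF g] \<delta>[of n] D\<delta>[of n]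
      by (intro add_mono mult_left_mono) auto
    finally have "C * (\<integral>x. \<bar>(f n x - g x) * (f n x + g x)\<bar> \<partial>M) \<le> C * (\<delta> n * (4 * P) + \<delta> n)"
      using C by (rule mult_left_mono)
    then show ?thesis using le by (simp add: algebra_simps)
  qed
  have "D \<longlonglongrightarrow> 0" using lim by (simp add: D_def[abs_def])
  then have "\<delta> \<longlonglongrightarrow> sqrt 0 + 0"
    unfolding \<delta>_def by (intro tendsto_add tendsto_real_sqrt LIMSEQ_Suc[OF lim_1_over_n])
  then have "(\<lambda>n. C * (4 * P + 1) * \<delta> n) \<longlonglongrightarrow> 0"
    using tendsto_mult_right_zero by fastforce
  then show ?thesis
    by (rule Lim_null_comparison[rotated]) (use bound in auto)
qed

text \<open>
  Only the functions of a maximizing sequence are made to converge. The weights need no limit, since the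
  assumption \<open>attain\<close> offers a weight that is best for the limit function. A single weight is the
  special case in which \<open>attain\<close> is trivial.
\<close>
lemma joint_maximizer_exists:
  assumes ne: "G \<noteq> {}" and C: "0 \<le> C" and G: "\<And>\<rho>. \<rho> \<in> G \<Longrightarrow> bounded_weight \<Omega> C \<rho>"
    and attain: "\<And>f. f \<in> H0s s \<Omega> \<Longrightarrow> \<exists>\<sigma>\<in>G. \<forall>\<rho>\<in>G. W \<rho> f f \<le> W \<sigma> f f"
  shows "\<exists>\<sigma>\<in>G. \<exists>f\<in>H0s s \<Omega>. H0s_inner s f f \<le> 1 \<and>
    (\<forall>\<rho>\<in>G. \<forall>v\<in>H0s s \<Omega>. H0s_inner s v v \<le> 1 \<longrightarrow> W \<rho> v v \<le> W \<sigma> f f)"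
proof -
  define X where "X = {W \<rho> v v | \<rho> v. \<rho> \<in> G \<and> v \<in> H0s s \<Omega> \<and> H0s_inner s v v \<le> 1}"
  obtain P where P: "P > 0" "\<And>u. u \<in> H0s s \<Omega> \<Longrightarrow> (\<integral>x. (u x)\<^sup>2 \<partial>M) \<le> P * H0s_inner s u u"
    using poincare_inequality by blast
  have bdd: "bdd_above X"
  proof (rule bdd_aboveI)
    fix y assume "y \<in> X"
    then obtain \<rho> v where y: "y = W \<rho> v v" "\<rho> \<in> G" "v \<in> H0s s \<Omega>" "H0s_inner s v v \<le> 1"
      by (auto simp: X_def)
    have "y \<le> C * (\<integral>x. (v x)\<^sup>2 \<partial>M)"
      using weight_form_le[OF G[OF y(2)] y(3)] y(1) by simp
    also have "\<dots> \<le> C * (P * H0s_inner s v v)"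
      using P(2)[OF y(3)] C by (rule mult_left_mono)
    also have "\<dots> \<le> C * (P * 1)"
      using y(4) P(1) C by (intro mult_left_mono) auto
    finally show "y \<le> C * (P * 1)" .
  qed
  have "H0s_inner s (\<lambda>x :: 'a. 0) (\<lambda>x. 0) = 0"
    by (simp add: H0s_inner_eq diff_quotient_def)
  then have Xne: "X \<noteq> {}"
    unfolding X_def using ne H0s_zero[of s \<Omega>] by fastforce
  define S where "S = Sup X"
  have up: "y \<le> S" if "y \<in> X" for y
    unfolding S_def using that bdd by (rule cSup_upper)
  have "\<exists>y\<in>X. S - 1 / real (Suc n) < y" for n
    using less_cSup_iff[OF Xne bdd, of "S - 1 / real (Suc n)"] by (simp add: S_def)
  then have "\<forall>n. \<exists>\<rho> v. \<rho> \<in> G \<and> v \<in> H0s s \<Omega> \<and> H0s_inner s v v \<le> 1 \<and> S - 1 / real (Suc n) < W \<rho> v v"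
    unfolding X_def by blast
  then obtain \<rho> v where \<rho>v: "\<And>n. \<rho> n \<in> G" "\<And>n. v n \<in> H0s s \<Omega>" "\<And>n. H0s_inner s (v n) (v n) \<le> 1"
      "\<And>n. S - 1 / real (Suc n) < W (\<rho> n) (v n) (v n)"
    by metis
  obtain g r where g: "strict_mono r" "g \<in> H0s s \<Omega>" "H0s_inner s g g \<le> 1"
      "(\<lambda>n. \<integral>x. (v (r n) x - g x)\<^sup>2 \<partial>M) \<longlonglongrightarrow> 0"
    using H0s_compact_embedding[of v] \<rho>v(2,3) by blast
  obtain \<sigma> where \<sigma>: "\<sigma> \<in> G" "\<And>\<rho>. \<rho> \<in> G \<Longrightarrow> W \<rho> g g \<le> W \<sigma> g g"
    using attain[OF g(2)] by blast
  have diff: "(\<lambda>n. W (\<rho> (r n)) (v (r n)) (v (r n)) - W (\<rho> (r n)) g g) \<longlonglongrightarrow> 0"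
    by (rule weight_form_tendsto[OF _ C _ _ g(2,3,4)]) (use \<rho>v G in auto)
  have "(\<lambda>n. 1 / real (Suc (r n))) \<longlonglongrightarrow> 0"
    using LIMSEQ_subseq_LIMSEQ[OF LIMSEQ_Suc[OF lim_1_over_n] g(1)] by (simp add: o_def)
  then have "(\<lambda>n. S - 1 / real (Suc (r n))
      - (W (\<rho> (r n)) (v (r n)) (v (r n)) - W (\<rho> (r n)) g g)) \<longlonglongrightarrow> S - 0 - 0"
    by (intro tendsto_intros diff)
  moreover have "S - 1 / real (Suc (r n)) - (W (\<rho> (r n)) (v (r n)) (v (r n)) - W (\<rho> (r n)) g g) \<le> W \<sigma> g g" for n
    using \<rho>v(4)[of "r n"] \<sigma>(2)[OF \<rho>v(1)[of "r n"]] by linarith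
  ultimately have "S \<le> W \<sigma> g g"
    by (intro tendsto_upperbound[of _ S sequentially]) auto
  then have "\<forall>\<rho>\<in>G. \<forall>v\<in>H0s s \<Omega>. H0s_inner s v v \<le> 1 \<longrightarrow> W \<rho> v v \<le> W \<sigma> g g"
    using up unfolding X_def by fastforce
  then show ?thesis using \<sigma>(1) g(2,3) by blast
qed

text \<open>
  Comparison within the unit ball is enough: a bump function makes the form positive, so a maximum
  over the ball cannot lie inside it.
\<close>
lemma maximizerI:
  assumes \<rho>: "bounded_weight \<Omega> C \<rho>" and pos: "emeasure lebesgue {x \<in> \<Omega>. \<rho> x > 0} \<noteq> 0"
    and u: "u \<in> H0s s \<Omega>" "H0s_inner s u u \<le> 1"
    and max: "\<And>v. v \<in> H0s s \<Omega> \<Longrightarrow> H0s_inner s v v \<le> 1 \<Longrightarrow> W \<rho> v v \<le> W \<rho> u u"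
  shows "maximizer s \<Omega> \<rho> u"
proof -
  have scaled: "W \<rho> v v \<le> W \<rho> u u * H0s_inner s v v" if v: "v \<in> H0s s \<Omega>" for v
  proof (cases "AE x in lebesgue. v x = 0")
    case True
    have "AE x in M. v x = 0"
      using True by (auto simp: AE_restrict_space_iff)
    then have "AE x in M. \<rho> x * v x * v x = 0"
      by eventually_elim simp
    then have "W \<rho> v v = 0"
      unfolding weight_form_def by (rule integral_eq_zero_AE)
    moreover have "0 \<le> W \<rho> u u"
      using max[OF H0s_zero] by (simp add: H0s_inner_eq diff_quotient_def weight_form_def)
    ultimately show ?thesis using H0s_inner_self_nonneg[of s v] by simp
  next
    case False
    define n where "n = H0s_inner s v v"
    have n: "n > 0" unfolding n_def by (rule H0s_inner_pos[OF v False])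
    have "H0s_inner s (\<lambda>x. (1 / sqrt n) * v x) (\<lambda>x. (1 / sqrt n) * v x) = 1"
      using n by (subst H0s_inner_scale[OF v]) (simp add: n_def[symmetric] power_divide)
    then have "W \<rho> (\<lambda>x. (1 / sqrt n) * v x) (\<lambda>x. (1 / sqrt n) * v x) \<le> W \<rho> u u"
      by (intro max H0s_scale v) simp
    then have "W \<rho> v v / n \<le> W \<rho> u u"
      using n by (subst (asm) weight_form_scale[OF \<rho> v]) (simp add: power_divide)
    then show ?thesis using n by (simp add: n_def field_simps)
  qed
  have "integrable M \<rho>"
    using weight_integrable[OF \<rho> M.integrable_const, of 1] by simp
  then obtain v where v: "v \<in> H0s s \<Omega>" "0 < (\<integral>x. \<rho> x * v x ^ 2 \<partial>M)"
    using bump_test_function[OF _ pos, of 2] by auto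
  then have "0 < W \<rho> v v"
    by (simp add: weight_form_def power2_eq_square mult.assoc)
  then have "0 < W \<rho> u u * H0s_inner s v v"
    using scaled[OF v(1)] by linarith
  then have m: "0 < W \<rho> u u"
    using H0s_inner_self_nonneg[of s v] by (simp add: zero_less_mult_iff)
  then have "1 \<le> H0s_inner s u u"
    using scaled[OF u(1)] by simp
  then show ?thesis
    using u m scaled by (simp add: maximizer_def)
qed

lemma maximizer_exists:
  assumes \<rho>: "bounded_weight \<Omega> C \<rho>" and pos: "emeasure lebesgue {x \<in> \<Omega>. \<rho> x > 0} \<noteq> 0"
  shows "\<exists>u. maximizer s \<Omega> \<rho> u"
proof -
  have "bounded_weight \<Omega> \<bar>C\<bar> \<rho>"
    using \<rho> by (auto simp: bounded_weight_def)
  then obtain f where "f \<in> H0s s \<Omega>" "H0s_inner s f f \<le> 1"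
      "\<And>v. v \<in> H0s s \<Omega> \<Longrightarrow> H0s_inner s v v \<le> 1 \<Longrightarrow> W \<rho> v v \<le> W \<rho> f f"
    using joint_maximizer_exists[of "{\<rho>}" "\<bar>C\<bar>"] by auto
  then show ?thesis using maximizerI[OF \<rho> pos] by blast
qed

text \<open>
  The Euler-Lagrange equation: along \<open>u + t \<phi>\<close> the nonnegative difference between the maximum times the
  squared norm and the form vanishes at \<open>t = 0\<close>, so its linear coefficient vanishes.
\<close>
lemma maximizer_eigenfunction:
  assumes \<rho>: "bounded_weight \<Omega> C \<rho>" and u: "maximizer s \<Omega> \<rho> u"
  shows "eigenfunction s \<Omega> \<rho> (1 / W \<rho> u u) u"
proof -
  define m where "m = W \<rho> u u"
  have uH: "u \<in> H0s s \<Omega>" and u1: "H0s_inner s u u = 1" and m: "m > 0"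
    and max: "\<And>v. v \<in> H0s s \<Omega> \<Longrightarrow> W \<rho> v v \<le> m * H0s_inner s v v"
    using u by (auto simp: maximizer_def m_def)
  have "\<not> (AE x in lebesgue. u x = 0)"
  proof
    assume "AE x in lebesgue. u x = 0"
    then have "AE x in M. u x = 0"
      by (auto simp: AE_restrict_space_iff)
    then have "AE x in M. \<rho> x * u x * u x = 0"
      by eventually_elim simp
    then have "W \<rho> u u = 0"
      unfolding weight_form_def by (rule integral_eq_zero_AE)
    then show False using m by (simp add: m_def)
  qed
  moreover have "H0s_inner s u \<phi> = 1 / m * W \<rho> u \<phi>" if \<phi>: "\<phi> \<in> H0s s \<Omega>" for \<phi>
  proof -
    have "m * H0s_inner s u \<phi> - W \<rho> u \<phi> = 0"
    proof (rule linear_coefficient_zero)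
      fix t :: real
      have "W \<rho> (\<lambda>x. 1 * u x + t * \<phi> x) (\<lambda>x. 1 * u x + t * \<phi> x)
          \<le> m * H0s_inner s (\<lambda>x. 1 * u x + t * \<phi> x) (\<lambda>x. 1 * u x + t * \<phi> x)"
        by (intro max H0s_lincomb uH \<phi>)
      then have "m + 2 * t * W \<rho> u \<phi> + t\<^sup>2 * W \<rho> \<phi> \<phi>
          \<le> m * (1 + 2 * t * H0s_inner s u \<phi> + t\<^sup>2 * H0s_inner s \<phi> \<phi>)"
        unfolding weight_form_lincomb_self[OF \<rho> uH \<phi>] H0s_inner_lincomb_self[OF uH \<phi>]
        by (simp add: u1 m_def)
      then show "0 \<le> 2 * t * (m * H0s_inner s u \<phi> - W \<rho> u \<phi>) + t\<^sup>2 * (m * H0s_inner s \<phi> \<phi> - W \<rho> \<phi> \<phi>)"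
        by (simp add: algebra_simps)
    qed
    then show ?thesis using m by (simp add: field_simps)
  qed
  ultimately show ?thesis
    using uH by (simp add: eigenfunction_def weight_form_def m_def)
qed

lemma eigenfunction_inner_self:
  assumes "eigenfunction s \<Omega> \<rho> \<mu> u"
  shows "u \<in> H0s s \<Omega>" "0 < H0s_inner s u u" "H0s_inner s u u = \<mu> * W \<rho> u u"
proof -
  show u: "u \<in> H0s s \<Omega>"
    using assms by (simp add: eigenfunction_def)
  then show "0 < H0s_inner s u u"
    using assms by (intro H0s_inner_pos) (simp_all add: eigenfunction_def)
  show "H0s_inner s u u = \<mu> * W \<rho> u u"
    using assms u by (simp add: eigenfunction_def weight_form_def)
qed

text \<open>
  Testing the equation of any eigenfunction with itself shows that its eigenvalue is the quotient of the
  squared norm and the form, which the maximality of \<open>u\<close> bounds below if it is positive.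
\<close>
lemma lambda1_eq:
  assumes \<rho>: "bounded_weight \<Omega> C \<rho>" and u: "maximizer s \<Omega> \<rho> u"
  shows "lambda1 s \<Omega> \<rho> = 1 / W \<rho> u u"
  unfolding lambda1_def
proof (rule Least_equality)
  have m: "W \<rho> u u > 0" using u by (simp add: maximizer_def)
  then show "0 < 1 / W \<rho> u u \<and> eigenvalue s \<Omega> \<rho> (1 / W \<rho> u u)"
    using maximizer_eigenfunction[OF assms] by (auto simp: eigenvalue_def)
  fix \<mu> assume \<mu>: "0 < \<mu> \<and> eigenvalue s \<Omega> \<rho> \<mu>"
  then obtain v where v: "eigenfunction s \<Omega> \<rho> \<mu> v" by (auto simp: eigenvalue_def)
  note e = eigenfunction_inner_self[OF v]
  have "W \<rho> v v \<le> W \<rho> u u * H0s_inner s v v"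
    using u e(1) by (simp add: maximizer_def)
  then have "\<mu> * W \<rho> v v \<le> \<mu> * (W \<rho> u u * H0s_inner s v v)"
    using \<mu> by (simp add: mult_left_mono)
  then have "1 * H0s_inner s v v \<le> (\<mu> * W \<rho> u u) * H0s_inner s v v"
    unfolding e(3)[symmetric] by (simp add: mult.assoc)
  then have "1 \<le> \<mu> * W \<rho> u u"
    using e(2) by (rule mult_right_le_imp_le)
  then show "1 / W \<rho> u u \<le> \<mu>"
    using m by (simp add: field_simps)
qed

lemma maximizer_unit_norm:
  assumes u: "maximizer s \<Omega> \<rho> u" and v: "v \<in> H0s s \<Omega>" "W \<rho> v v = W \<rho> u u" "H0s_inner s v v \<le> 1"
  shows "H0s_inner s v v = 1"
proof -
  have "0 < W \<rho> u u" and "W \<rho> v v \<le> W \<rho> u u * H0s_inner s v v"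
    using u v(1) by (auto simp: maximizer_def)
  then have "1 \<le> H0s_inner s v v"
    using v(2) by simp
  then show ?thesis using v(3) by simp
qed

text \<open>
  Taking absolute values does not increase difference quotients and leaves the quadratic form of the
  weight unchanged.
\<close>
lemma maximizer_abs:
  assumes u: "maximizer s \<Omega> \<rho> u"
  shows "maximizer s \<Omega> \<rho> (\<lambda>x. \<bar>u x\<bar>)"
proof -
  have uH: "u \<in> H0s s \<Omega>" using u by (simp add: maximizer_def)
  have aH: "(\<lambda>x. \<bar>u x\<bar>) \<in> H0s s \<Omega>"
    by (rule H0s_comparison[OF _ _ uH uH, of _ 1 0])
      (use uH H0s_measurable(1)[OF uH] in \<open>auto simp: H0s_iff\<close>)
  have "H0s_inner s (\<lambda>x. \<bar>u x\<bar>) (\<lambda>x. \<bar>u x\<bar>) \<le> H0s_inner s u u"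
    unfolding H0s_inner_eq
  proof (rule integral_mono[OF H0s_inner_integrable[OF aH aH] H0s_inner_integrable[OF uH uH]])
    fix z :: "'a \<times> 'a"
    have "\<bar>diff_quotient s (\<lambda>x. \<bar>u x\<bar>) z\<bar> \<le> \<bar>diff_quotient s u z\<bar>"
      unfolding diff_quotient_def by (simp add: divide_right_mono)
    then show "diff_quotient s (\<lambda>x. \<bar>u x\<bar>) z * diff_quotient s (\<lambda>x. \<bar>u x\<bar>) z
        \<le> diff_quotient s u z * diff_quotient s u z"
      by (simp add: abs_le_square_iff power2_eq_square)
  qed
  moreover have "W \<rho> (\<lambda>x. \<bar>u x\<bar>) (\<lambda>x. \<bar>u x\<bar>) = W \<rho> u u"
    by (simp add: weight_form_def mult.assoc)
  ultimately show ?thesis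
    using u aH maximizer_unit_norm[OF u aH] by (auto simp: maximizer_def)
qed

end

section \<open>The strong maximum principle\<close>

context fractional_domain
begin

text \<open>
  Take the distance to the complement of \<open>\<Omega>\<close>, which is 1-Lipschitz, and bounded like \<open>\<Omega>\<close>.
\<close>
lemma distance_cutoff:
  obtains \<eta> :: "'a \<Rightarrow> real" and B :: real where "\<eta> \<in> H0s s \<Omega>" "\<And>x. 0 \<le> \<eta> x" "\<And>x. \<eta> x \<le> B"
    "\<And>x. x \<in> \<Omega> \<Longrightarrow> 0 < \<eta> x" "\<And>x. x \<notin> \<Omega> \<Longrightarrow> \<eta> x = 0"
proof -
  have cl: "closed (- \<Omega>)"
    using open_domain by (simp add: closed_Compl)
  have ne: "- \<Omega> \<noteq> {}"
    using bounded_domain not_bounded_UNIV by (metis Compl_UNIV_eq double_compl)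
  then obtain y where y: "y \<in> - \<Omega>" by blast
  obtain R where R: "\<Omega> \<subseteq> ball 0 R" "R > 0"
    using bounded_domain bounded_subset_ballD by blast
  define \<eta> where "\<eta> x = infdist x (- \<Omega>)" for x
  have out: "\<eta> x = 0" if "x \<notin> \<Omega>" for x
    using that by (simp add: \<eta>_def)
  have bd: "\<eta> x \<le> R + norm y" for x
  proof (cases "x \<in> \<Omega>")
    case True
    have "\<eta> x \<le> dist x y"
      unfolding \<eta>_def by (rule infdist_le[OF y])
    also have "\<dots> \<le> norm x + norm y"
      by (simp add: dist_norm norm_triangle_ineq4)
    finally show ?thesis using R(1) True by auto
  next
    case False
    then show ?thesis using out R(2) by simp
  qed
  have "\<eta> \<in> H0s s \<Omega>"
  proof (rule lipschitz_in_H0s[OF s_pos s_less domain_lmeasurable, of _ 1 "R + norm y"])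
    show "\<bar>\<eta> x - \<eta> z\<bar> \<le> 1 * norm (x - z)" for x z
      using infdist_triangle_abs[of x "- \<Omega>" z] by (simp add: \<eta>_def dist_norm)
    show "\<bar>\<eta> x\<bar> \<le> R + norm y" for x
      using bd[of x] by (simp add: \<eta>_def infdist_nonneg)
  qed (rule out)
  moreover have "0 < \<eta> x" if "x \<in> \<Omega>" for x
    using that ne cl unfolding \<eta>_def by (intro infdist_pos_not_in_closed) auto
  ultimately show ?thesis
    using that[of \<eta> "R + norm y"] bd out by (simp add: \<eta>_def infdist_nonneg)
qed

text \<open>
  Test the equation with \<open>\<phi> n = \<eta> * max 0 (1 - (n + 1) * u)\<close>, which decreases to \<open>\<eta>\<close> times the
  indicator of the zero set of \<open>u\<close>. The right hand side tends to 0 because \<open>u * \<phi> n\<close> is of order \<open>1 / n\<close>.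
  The integrand of the left hand side is at most \<open>D\<close>, the absolute value of the product of the
  difference quotients of \<open>u\<close> and \<open>\<eta>\<close>, since the cutoff is a nonincreasing function of \<open>u\<close> with values
  in the unit interval. Fatou's lemma for \<open>D\<close> minus the integrand shows that the limit \<open>P\<close> of minus the
  integrand, which is nonnegative, has integral 0. At a pair of a zero \<open>x \<in> \<Omega>\<close> of \<open>u\<close> and a point \<open>y\<close>
  with \<open>u y > 0\<close> this limit is strictly positive. Hence the zeros in \<open>\<Omega>\<close> or the points where \<open>u\<close> is
  positive form a null set, and the latter is impossible.
\<close>
theorem strong_maximum_principle:
  assumes \<rho>: "bounded_weight \<Omega> C \<rho>" and u: "eigenfunction s \<Omega> \<rho> \<mu> u" and nonneg: "\<And>x. 0 \<le> u x"
  shows "AE x in M. 0 < u x"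
proof -
  have uH: "u \<in> H0s s \<Omega>" using u by (simp add: eigenfunction_def)
  note um[measurable] = H0s_measurable(1)[OF uH]
  obtain \<eta> B where \<eta>: "\<eta> \<in> H0s s \<Omega>" "\<And>x. 0 \<le> \<eta> x" "\<And>x. \<eta> x \<le> B"
    "\<And>x. x \<in> \<Omega> \<Longrightarrow> 0 < \<eta> x" "\<And>x. x \<notin> \<Omega> \<Longrightarrow> \<eta> x = 0"
    by (rule distance_cutoff) blast
  have B: "0 \<le> B" using \<eta>(2,3)[of undefined] by linarith
  note \<eta>m[measurable] = H0s_measurable(1)[OF \<eta>(1)]
  define cut where "cut n t = max 0 (1 - real (Suc n) * t)" for n t
  have cut01: "0 \<le> cut n t" "t \<ge> 0 \<Longrightarrow> cut n t \<le> 1" for n t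
    by (auto simp: cut_def)
  have cut_lip: "\<bar>cut n a - cut n b\<bar> \<le> real (Suc n) * \<bar>a - b\<bar>" for n a b
  proof -
    have "\<bar>cut n a - cut n b\<bar> \<le> \<bar>real (Suc n) * a - real (Suc n) * b\<bar>"
      unfolding cut_def by linarith
    also have "\<dots> = real (Suc n) * \<bar>a - b\<bar>"
      by (metis abs_mult abs_of_nat right_diff_distrib)
    finally show ?thesis .
  qed
  have cut_mono: "cut n a \<le> cut n b" if "b \<le> a" for n a b
    using mult_left_mono[OF that, of "real (Suc n)"] unfolding cut_def by linarith
  have cut_lim: "(\<lambda>n. cut n t) \<longlonglongrightarrow> (if t = 0 then 1 else 0)" if t: "t \<ge> 0" for t
  proof (cases "t = 0")
    case False
    then obtain k where k: "1 < real k * t"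
      using t reals_Archimedean3[of t] by (metis less_le)
    have "cut n t = 0" if "n \<ge> k" for n
    proof -
      have "real k * t \<le> real (Suc n) * t"
        using that \<open>t \<ge> 0\<close> by (intro mult_right_mono) auto
      then show ?thesis using k by (simp add: cut_def)
    qed
    then show ?thesis
      using False by (intro tendsto_eventually) (auto simp: eventually_sequentially)
  qed (simp add: cut_def)
  define \<phi> where "\<phi> n x = \<eta> x * cut n (u x)" for n x
  have \<phi>H: "\<phi> n \<in> H0s s \<Omega>" for n
  proof (rule H0s_comparison[OF _ _ \<eta>(1) uH, of _ 1 "B * real (Suc n)"])
    show "\<phi> n \<in> borel_measurable lebesgue"
      unfolding \<phi>_def cut_def by measurable
    show "AE x in lebesgue. x \<notin> \<Omega> \<longrightarrow> \<phi> n x = 0"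
      using \<eta>(5) by (simp add: \<phi>_def)
    have "\<bar>\<phi> n x\<bar> \<le> \<eta> x" for x
      using \<eta>(2)[of x] cut01(1)[of n "u x"] cut01(2)[OF nonneg, of n x] by (simp add: \<phi>_def abs_mult mult_left_le)
    moreover have "0 \<le> B * real (Suc n) * \<bar>u x\<bar>" for x
      using B by simp
    ultimately show "\<bar>\<phi> n x\<bar> \<le> 1 * \<bar>\<eta> x\<bar> + B * real (Suc n) * \<bar>u x\<bar>" for x
      using \<eta>(2)[of x] by (simp add: add_increasing2)
    show "\<bar>\<phi> n x - \<phi> n y\<bar> \<le> 1 * \<bar>\<eta> x - \<eta> y\<bar> + B * real (Suc n) * \<bar>u x - u y\<bar>" for x y
    proof -
      have "\<phi> n x - \<phi> n y = (\<eta> x - \<eta> y) * cut n (u x) + \<eta> y * (cut n (u x) - cut n (u y))"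
        by (simp add: \<phi>_def algebra_simps)
      then have "\<bar>\<phi> n x - \<phi> n y\<bar> \<le> \<bar>\<eta> x - \<eta> y\<bar> * cut n (u x) + \<eta> y * \<bar>cut n (u x) - cut n (u y)\<bar>"
        using abs_triangle_ineq[of "(\<eta> x - \<eta> y) * cut n (u x)" "\<eta> y * (cut n (u x) - cut n (u y))"]
          cut01(1)[of n "u x"] \<eta>(2)[of y] by (simp add: abs_mult)
      also have "\<dots> \<le> \<bar>\<eta> x - \<eta> y\<bar> * 1 + B * (real (Suc n) * \<bar>u x - u y\<bar>)"
        using cut01(2)[OF nonneg, of n x] cut_lip[of n "u x" "u y"] \<eta>(2)[of y] \<eta>(3)[of y] B
          cut01(1)[of n "u x"]
        by (intro add_mono mult_mono) auto
      finally show ?thesis by (simp add: mult.assoc)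
    qed
  qed
  define \<phi>0 where "\<phi>0 x = \<eta> x * (if u x = 0 then 1 else 0)" for x
  have \<phi>lim: "(\<lambda>n. \<phi> n x) \<longlonglongrightarrow> \<phi>0 x" for x
    unfolding \<phi>_def \<phi>0_def by (intro tendsto_mult_left cut_lim nonneg)
  have [measurable]: "\<phi>0 \<in> borel_measurable lebesgue"
    unfolding \<phi>0_def by measurable
  have [measurable]: "\<phi> n \<in> borel_measurable lebesgue" for n
    by (rule H0s_measurable(1)[OF \<phi>H])
  define D where "D z = \<bar>diff_quotient s u z * diff_quotient s \<eta> z\<bar>" for z
  have Di: "integrable lebesgue_pair D"
    unfolding D_def by (intro integrable_abs H0s_inner_integrable[OF uH \<eta>(1)])
  have [measurable]: "D \<in> borel_measurable lebesgue_pair"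
    using Di by auto
  define H where "H n z = D z - diff_quotient s u z * diff_quotient s (\<phi> n) z" for n z
  have Hi: "integrable lebesgue_pair (H n)" for n
    unfolding H_def by (intro Bochner_Integration.integrable_diff Di H0s_inner_integrable[OF uH \<phi>H])
  \<comment> \<open>If \<open>a \<ge> b\<close>, replacing \<open>cut n a\<close> by the larger \<open>cut n b\<close> increases the left hand side.\<close>
  have key: "(a - b) * (p * cut n a - q * cut n b) \<le> \<bar>(a - b) * (p - q)\<bar>"
    if "0 \<le> a" "0 \<le> b" "0 \<le> p" "0 \<le> q" for a b p q :: real and n
  proof -
    have *: "(a - b) * (p * cut n a - q * cut n b) \<le> \<bar>(a - b) * (p - q)\<bar>"
      if ab: "b \<le> a" and pos: "0 \<le> b" "0 \<le> p" for a b p q :: real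
    proof -
      have "p * cut n a \<le> p * cut n b"
        using cut_mono[OF ab] pos by (intro mult_left_mono)
      then have "p * cut n a - q * cut n b \<le> (p - q) * cut n b"
        by (simp add: algebra_simps)
      also have "\<dots> \<le> \<bar>p - q\<bar> * cut n b"
        using cut01(1)[of n b] by (intro mult_right_mono) auto
      also have "\<dots> \<le> \<bar>p - q\<bar> * 1"
        using cut01(2)[OF pos(1)] by (intro mult_left_mono) auto
      finally have "(a - b) * (p * cut n a - q * cut n b) \<le> (a - b) * \<bar>p - q\<bar>"
        using ab by (intro mult_left_mono) auto
      then show ?thesis using ab by (simp add: abs_mult)
    qed
    show ?thesis
    proof (cases "b \<le> a")
      case True
      then show ?thesis using * that by blast
    next
      case False
      then have "(b - a) * (q * cut n b - p * cut n a) \<le> \<bar>(b - a) * (q - p)\<bar>"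
        using that by (intro *) auto
      moreover have "(b - a) * (q * cut n b - p * cut n a) = (a - b) * (p * cut n a - q * cut n b)"
        by (simp add: algebra_simps)
      moreover have "(b - a) * (q - p) = (a - b) * (p - q)"
        by (simp add: algebra_simps)
      ultimately show ?thesis by simp
    qed
  qed
  have H0: "0 \<le> H n z" for n z
  proof -
    obtain x y where z: "z = (x, y)" by (cases z)
    define k where "k = norm (x - y) powr (real DIM('a) / 2 + s)"
    have "(u x - u y) * (\<phi> n x - \<phi> n y) / k\<^sup>2 \<le> \<bar>(u x - u y) * (\<eta> x - \<eta> y)\<bar> / k\<^sup>2"
      unfolding \<phi>_def by (intro divide_right_mono key nonneg \<eta>(2)) auto
    then show ?thesis
      by (simp add: H_def D_def diff_quotient_def z k_def[symmetric] power2_eq_square abs_mult)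
  qed
  have int\<phi>: "(\<lambda>n. H0s_inner s u (\<phi> n)) \<longlonglongrightarrow> 0"
  proof -
    define V where "V = measure M \<Omega>"
    have C: "\<bar>W \<rho> u (\<phi> n)\<bar> \<le> \<bar>C\<bar> * (B * V) * (1 / real (Suc n))" for n
    proof -
      have \<rho>': "bounded_weight \<Omega> \<bar>C\<bar> \<rho>" using \<rho> by (auto simp: bounded_weight_def)
      have i: "integrable M (\<lambda>x. u x * \<phi> n x)"
        by (intro square_integrable_mult H0s_on uH \<phi>H)
      have bd: "\<bar>u x * \<phi> n x\<bar> \<le> B * (1 / real (Suc n))" for x
      proof -
        have "u x * cut n (u x) \<le> 1 / real (Suc n)"
        proof (cases "1 - real (Suc n) * u x \<le> 0")
          case True
          then show ?thesis by (simp add: cut_def)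
        next
          case False
          then have "u x \<le> 1 / real (Suc n)" by (simp add: field_simps)
          then show ?thesis
            using mult_left_le[OF cut01(2)[OF nonneg[of x], of n] nonneg[of x]] by linarith
        qed
        then have "\<eta> x * (u x * cut n (u x)) \<le> B * (1 / real (Suc n))"
          using \<eta>(2,3)[of x] nonneg[of x] cut01(1)[of n "u x"] B by (intro mult_mono) auto
        then show ?thesis
          using \<eta>(2)[of x] nonneg[of x] cut01(1)[of n "u x"] by (simp add: \<phi>_def abs_mult mult_ac)
      qed
      have "\<bar>W \<rho> u (\<phi> n)\<bar> \<le> \<bar>C\<bar> * (\<integral>x. \<bar>u x * \<phi> n x\<bar> \<partial>M)"
        using weighted_integral_le[OF \<rho>' i] by (simp add: weight_form_def mult.assoc)
      also have "\<dots> \<le> \<bar>C\<bar> * (\<integral>x. B * (1 / real (Suc n)) \<partial>M)"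
        using i bd M.integrable_const
        by (intro mult_left_mono integral_mono) auto
      finally show ?thesis by (simp add: V_def mult.commute)
    qed
    have "(\<lambda>n. \<bar>C\<bar> * (B * V) * (1 / real (Suc n))) \<longlonglongrightarrow> 0"
      by (intro tendsto_mult_right_zero LIMSEQ_Suc[OF lim_1_over_n])
    then have "(\<lambda>n. W \<rho> u (\<phi> n)) \<longlonglongrightarrow> 0"
      by (rule Lim_null_comparison[rotated]) (use C in auto)
    then have "(\<lambda>n. \<mu> * W \<rho> u (\<phi> n)) \<longlonglongrightarrow> 0"
      by (rule tendsto_mult_right_zero)
    moreover have "H0s_inner s u (\<phi> n) = \<mu> * W \<rho> u (\<phi> n)" for n
      using u \<phi>H[of n] by (simp add: eigenfunction_def weight_form_def)
    ultimately show ?thesis by simp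
  qed
  define P where "P z = - (diff_quotient s u z * diff_quotient s \<phi>0 z)" for z
  have P0: "0 \<le> P z" for z
  proof -
    have "(u x - u y) * (\<phi>0 x - \<phi>0 y) \<le> 0" for x y
      using \<eta>(2)[of x] \<eta>(2)[of y] nonneg[of x] nonneg[of y]
      by (auto simp: \<phi>0_def mult_nonneg_nonneg)
    then show ?thesis
      by (simp add: P_def diff_quotient_def divide_nonpos_nonneg)
  qed
  have [measurable]: "P \<in> borel_measurable lebesgue_pair"
    unfolding P_def by measurable
  have Hlim: "(\<lambda>n. ennreal (H n z)) \<longlonglongrightarrow> ennreal (D z + P z)" for z
  proof (rule tendsto_ennrealI)
    have "(\<lambda>n. (\<phi> n (fst z) - \<phi> n (snd z)) / norm (fst z - snd z) powr (real DIM('a) / 2 + s))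
        \<longlonglongrightarrow> (\<phi>0 (fst z) - \<phi>0 (snd z)) / norm (fst z - snd z) powr (real DIM('a) / 2 + s)"
      unfolding divide_inverse by (intro tendsto_mult_right tendsto_diff \<phi>lim)
    then have "(\<lambda>n. diff_quotient s (\<phi> n) z) \<longlonglongrightarrow> diff_quotient s \<phi>0 z"
      by (simp add: diff_quotient_def)
    then have "(\<lambda>n. H n z) \<longlonglongrightarrow> D z - diff_quotient s u z * diff_quotient s \<phi>0 z"
      unfolding H_def by (intro tendsto_intros)
    then show "(\<lambda>n. H n z) \<longlonglongrightarrow> D z + P z"
      by (simp add: P_def)
  qed
  have "(\<integral>\<^sup>+z. ennreal (D z + P z) \<partial>lebesgue_pair) = (\<integral>\<^sup>+z. liminf (\<lambda>n. ennreal (H n z)) \<partial>lebesgue_pair)"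
    using lim_imp_Liminf[OF _ Hlim] by (intro nn_integral_cong) auto
  also have "\<dots> \<le> liminf (\<lambda>n. \<integral>\<^sup>+z. ennreal (H n z) \<partial>lebesgue_pair)"
    using Hi by (intro nn_integral_liminf) auto
  also have "(\<lambda>n. \<integral>\<^sup>+z. ennreal (H n z) \<partial>lebesgue_pair) = (\<lambda>n. ennreal ((\<integral>z. D z \<partial>lebesgue_pair) - H0s_inner s u (\<phi> n)))"
  proof
    fix n
    have "(\<integral>\<^sup>+z. ennreal (H n z) \<partial>lebesgue_pair) = ennreal (\<integral>z. H n z \<partial>lebesgue_pair)"
      using H0 by (intro nn_integral_eq_integral Hi) auto
    also have "(\<integral>z. H n z \<partial>lebesgue_pair) = (\<integral>z. D z \<partial>lebesgue_pair) - H0s_inner s u (\<phi> n)"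
      unfolding H_def H0s_inner_eq using Di H0s_inner_integrable[OF uH \<phi>H]
      by (intro Bochner_Integration.integral_diff) auto
    finally show "(\<integral>\<^sup>+z. ennreal (H n z) \<partial>lebesgue_pair) = ennreal ((\<integral>z. D z \<partial>lebesgue_pair) - H0s_inner s u (\<phi> n))" .
  qed
  also have "liminf (\<lambda>n. ennreal ((\<integral>z. D z \<partial>lebesgue_pair) - H0s_inner s u (\<phi> n))) = ennreal (\<integral>z. D z \<partial>lebesgue_pair)"
  proof (rule lim_imp_Liminf)
    show "(\<lambda>n. ennreal ((\<integral>z. D z \<partial>lebesgue_pair) - H0s_inner s u (\<phi> n))) \<longlonglongrightarrow> ennreal (\<integral>z. D z \<partial>lebesgue_pair)"
      using tendsto_diff[OF tendsto_const int\<phi>, of "\<integral>z. D z \<partial>lebesgue_pair"] by (intro tendsto_ennrealI) simp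
  qed simp
  also have "\<dots> = (\<integral>\<^sup>+z. ennreal (D z) \<partial>lebesgue_pair)"
    by (rule nn_integral_eq_integral[symmetric, OF Di]) (simp add: D_def)
  finally have "(\<integral>\<^sup>+z. ennreal (D z + P z) \<partial>lebesgue_pair) \<le> (\<integral>\<^sup>+z. ennreal (D z) \<partial>lebesgue_pair)" .
  moreover have "(\<integral>\<^sup>+z. ennreal (D z + P z) \<partial>lebesgue_pair)
      = (\<integral>\<^sup>+z. ennreal (D z) \<partial>lebesgue_pair) + (\<integral>\<^sup>+z. ennreal (P z) \<partial>lebesgue_pair)"
    using P0 by (subst nn_integral_add[symmetric]) (auto simp: D_def)
  moreover have "(\<integral>\<^sup>+z. ennreal (D z) \<partial>lebesgue_pair) < \<infinity>"
    by (subst nn_integral_eq_integral[OF Di]) (auto simp: D_def)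
  ultimately have "(\<integral>\<^sup>+z. ennreal (P z) \<partial>lebesgue_pair) = 0"
    using ennreal_add_left_cancel_le[of "\<integral>\<^sup>+z. ennreal (D z) \<partial>lebesgue_pair"
        "\<integral>\<^sup>+z. ennreal (P z) \<partial>lebesgue_pair" 0] by auto
  then have "AE z in lebesgue_pair. ennreal (P z) = 0"
    by (subst (asm) nn_integral_0_iff_AE) auto
  then have "AE z in lebesgue_pair. \<not> (fst z \<in> \<Omega> \<and> u (fst z) = 0 \<and> u (snd z) > 0)"
  proof eventually_elim
    case (elim z)
    show ?case
    proof
      assume z: "fst z \<in> \<Omega> \<and> u (fst z) = 0 \<and> u (snd z) > 0"
      then have "fst z \<noteq> snd z" by auto
      then have "P z > 0"
        using z \<eta>(4)[of "fst z"]
        by (auto simp: P_def diff_quotient_def \<phi>0_def intro!: divide_pos_pos mult_pos_pos)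
      then show False using elim by simp
    qed
  qed
  define Z where "Z = {x \<in> \<Omega>. u x = 0}"
  define Y where "Y = {y. u y > 0}"
  have Zm: "Z \<in> sets lebesgue" and Ym: "Y \<in> sets lebesgue"
  proof -
    have "Z = {x \<in> space lebesgue. x \<in> \<Omega> \<and> u x = 0}" and "Y = {x \<in> space lebesgue. u x > 0}"
      by (auto simp: Z_def Y_def)
    moreover have "{x \<in> space lebesgue. x \<in> \<Omega> \<and> u x = 0} \<in> sets lebesgue"
      and "{x \<in> space lebesgue. u x > 0} \<in> sets lebesgue"
      by measurable
    ultimately show "Z \<in> sets lebesgue" "Y \<in> sets lebesgue"
      by simp_all
  qed
  have "AE z in lebesgue_pair. z \<notin> Z \<times> Y"
    using \<open>AE z in lebesgue_pair. \<not> (fst z \<in> \<Omega> \<and> u (fst z) = 0 \<and> u (snd z) > 0)\<close>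
    by eventually_elim (auto simp: Z_def Y_def)
  then have "emeasure lebesgue_pair (Z \<times> Y) = 0"
    using Zm Ym by (subst (asm) AE_iff_null_sets[symmetric]) (auto simp: null_sets_def)
  then have "emeasure lebesgue Z * emeasure lebesgue Y = 0"
    using Zm Ym by (simp add: leb.emeasure_pair_measure_Times)
  moreover have "emeasure lebesgue Y \<noteq> 0"
  proof
    assume "emeasure lebesgue Y = 0"
    then have "AE x in lebesgue. x \<notin> Y"
      using Ym by (intro AE_not_in) (auto simp: null_sets_def)
    then have "AE x in lebesgue. u x = 0"
      by eventually_elim (use nonneg in \<open>auto simp: Y_def not_less intro: antisym\<close>)
    then show False using u by (simp add: eigenfunction_def)
  qed
  ultimately have "Z \<in> null_sets lebesgue"
    using Zm by (auto simp: null_sets_def)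
  then have "AE x in lebesgue. x \<notin> Z"
    by (rule AE_not_in)
  then have "AE x in lebesgue. x \<in> \<Omega> \<longrightarrow> 0 < u x"
    by eventually_elim (use nonneg in \<open>auto simp: Z_def less_le\<close>)
  then show ?thesis
    by (simp add: AE_restrict_space_iff)
qed

end

section \<open>Superlevel sets of prescribed measure\<close>

text \<open>
  Finite unions in a chain are members of the chain, so continuity from below applies to them.
\<close>
lemma emeasure_chain_Union_le:
  assumes I: "countable I" and X: "\<And>i. i \<in> I \<Longrightarrow> X i \<in> sets M"
    and chain: "\<And>i j. i \<in> I \<Longrightarrow> j \<in> I \<Longrightarrow> X i \<subseteq> X j \<or> X j \<subseteq> X i"
    and le: "\<And>i. i \<in> I \<Longrightarrow> emeasure M (X i) \<le> b"
  shows "emeasure M (\<Union>i\<in>I. X i) \<le> b"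
proof (cases "I = {}")
  case False
  define e where "e = from_nat_into I"
  have e: "e n \<in> I" for n using False by (simp add: e_def from_nat_into)
  define A where "A n = (\<Union>i\<le>n. X (e i))" for n :: nat
  have "\<exists>j. A n = X (e j)" for n
  proof (induction n)
    case 0
    then show ?case by (auto simp: A_def)
  next
    case (Suc n)
    then obtain j where "A n = X (e j)" by blast
    moreover have "A (Suc n) = A n \<union> X (e (Suc n))"
      by (auto simp: A_def le_Suc_eq)
    ultimately show ?case
      using chain[OF e e, of j "Suc n"] by (metis sup.absorb1 sup.absorb2)
  qed
  then have A: "A n \<in> sets M" "emeasure M (A n) \<le> b" for n
    using X[OF e] le[OF e] by metis+
  have "(\<Union>i\<in>I. X i) = (\<Union>n. A n)"
  proof -
    have "I = range e"
      using range_from_nat_into[OF False I] by (simp add: e_def)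
    then show ?thesis by (auto simp: A_def)
  qed
  moreover have "(SUP n. emeasure M (A n)) = emeasure M (\<Union>n. A n)"
    using A by (intro SUP_emeasure_incseq) (auto simp: incseq_def A_def intro: order_trans)
  ultimately show ?thesis
    using A(2) by (metis SUP_least)
qed simp

text \<open>
  Hyperplanes are null sets, so indicators of half-spaces converge almost everywhere when their
  positions converge.
\<close>
lemma continuous_measure_halfspace:
  fixes e :: "'a::euclidean_space"
  assumes e: "e \<in> Basis" and S: "S \<in> lmeasurable"
  shows "continuous_on UNIV (\<lambda>d. measure lebesgue (S \<inter> {x. x \<bullet> e > d}))"
proof -
  have H[measurable]: "{x. x \<bullet> e > d} \<in> sets lebesgue" for d
    by simp
  have Ss[measurable]: "S \<in> sets lebesgue" using S by auto
  have iS: "integrable lebesgue (indicator S :: 'a \<Rightarrow> real)"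
    using S by (intro integrable_real_indicator) (auto simp: fmeasurable_def)
  have eq: "measure lebesgue (S \<inter> {x. x \<bullet> e > d}) = (\<integral>x. indicat_real (S \<inter> {x. x \<bullet> e > d}) x \<partial>lebesgue)" for d
    by simp
  have "(\<lambda>n. \<integral>x. indicator (S \<inter> {x. x \<bullet> e > a n}) x \<partial>lebesgue)
      \<longlonglongrightarrow> (\<integral>x. indicat_real (S \<inter> {x. x \<bullet> e > d}) x \<partial>lebesgue)" if a: "a \<longlonglongrightarrow> d" for a :: "nat \<Rightarrow> real" and d
  proof (rule integral_dominated_convergence[where w = "indicat_real S"])
    have "{x. x \<bullet> e = d} \<in> null_sets lebesgue"
      using negligible_standard_hyperplane[OF e, of d] by (simp add: negligible_iff_null_sets)
    then have "AE x in lebesgue. x \<notin> {x. x \<bullet> e = d}"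
      by (rule AE_not_in)
    then show "AE x in lebesgue. (\<lambda>n. indicator (S \<inter> {x. x \<bullet> e > a n}) x)
        \<longlonglongrightarrow> (indicator (S \<inter> {x. x \<bullet> e > d}) x :: real)"
    proof eventually_elim
      case (elim x)
      then have "x \<bullet> e < d \<or> d < x \<bullet> e" by auto
      then have "\<forall>\<^sub>F n in sequentially. (x \<bullet> e > a n) = (x \<bullet> e > d)"
      proof
        assume "x \<bullet> e < d"
        then have "\<forall>\<^sub>F n in sequentially. x \<bullet> e < a n"
          using a by (rule order_tendstoD(1)[rotated])
        then show ?thesis by eventually_elim (use \<open>x \<bullet> e < d\<close> in auto)
      next
        assume "d < x \<bullet> e"
        then have "\<forall>\<^sub>F n in sequentially. a n < x \<bullet> e"
          using a by (rule order_tendstoD(2)[rotated])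
        then show ?thesis by eventually_elim (use \<open>d < x \<bullet> e\<close> in auto)
      qed
      then have "\<forall>\<^sub>F n in sequentially. indicat_real (S \<inter> {x. x \<bullet> e > a n}) x = indicat_real (S \<inter> {x. x \<bullet> e > d}) x"
        by eventually_elim (auto split: split_indicator)
      then show ?case
        by (rule tendsto_eventually)
    qed
  qed (use iS in \<open>auto split: split_indicator\<close>)
  then show ?thesis
    unfolding continuous_on_sequentially eq by (auto simp: o_def)
qed

context fractional_domain
begin

text \<open>
  Superlevel sets of the pair \<open>(g x, x \<bullet> e)\<close> in lexicographic order. The coordinate,
  whose level sets are null, breaks the ties on the level sets of \<open>g\<close>, which may have positive measure.
\<close>
definition upper_set :: "('a \<Rightarrow> real) \<Rightarrow> 'a \<Rightarrow> 'a set \<Rightarrow> bool" where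
  "upper_set g e E \<longleftrightarrow> E \<subseteq> \<Omega> \<and> E \<in> sets lebesgue \<and>
    (\<forall>x\<in>E. \<forall>y\<in>\<Omega>. g x < g y \<or> (g x = g y \<and> x \<bullet> e \<le> y \<bullet> e) \<longrightarrow> y \<in> E)"

lemma upper_setD:
  assumes "upper_set g e E" "x \<in> E" "y \<in> \<Omega>" "g x < g y \<or> (g x = g y \<and> x \<bullet> e \<le> y \<bullet> e)"
  shows "y \<in> E"
  using assms(1) unfolding upper_set_def using assms(2-) by blast

lemma upper_set_sets: "upper_set g e E \<Longrightarrow> E \<in> sets lebesgue" "upper_set g e E \<Longrightarrow> E \<subseteq> \<Omega>"
  unfolding upper_set_def by blast+

text \<open>
  The order is total.
\<close>
lemma upper_set_chain:
  assumes E: "upper_set g e E" and F: "upper_set g e F"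
  shows "E \<subseteq> F \<or> F \<subseteq> E"
proof (rule ccontr)
  assume "\<not> ?thesis"
  then obtain x y where xy: "x \<in> E" "x \<notin> F" "y \<in> F" "y \<notin> E" by blast
  have "x \<in> \<Omega>" "y \<in> \<Omega>"
    using upper_set_sets(2)[OF E] upper_set_sets(2)[OF F] xy(1,3) by blast+
  then have 1: "\<not> (g x < g y \<or> (g x = g y \<and> x \<bullet> e \<le> y \<bullet> e))"
    and 2: "\<not> (g y < g x \<or> (g y = g x \<and> y \<bullet> e \<le> x \<bullet> e))"
    using upper_setD[OF E xy(1), of y] upper_setD[OF F xy(3), of x] xy(2,4) by blast+
  consider "g x < g y" | "g x = g y" | "g y < g x"
    using less_linear by blast
  then show False
  proof cases
    case 2
    then show False
      using \<open>\<not> (g x < g y \<or> (g x = g y \<and> x \<bullet> e \<le> y \<bullet> e))\<close>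
        \<open>\<not> (g y < g x \<or> (g y = g x \<and> y \<bullet> e \<le> x \<bullet> e))\<close> linear[of "x \<bullet> e" "y \<bullet> e"] by simp
  qed (use 1 2 in simp_all)
qed

lemma domain_level_sets:
  fixes g :: "'a \<Rightarrow> real"
  assumes "g \<in> borel_measurable M"
  shows "{x \<in> \<Omega>. g x > c} \<in> sets lebesgue" "{x \<in> \<Omega>. g x \<ge> c} \<in> sets lebesgue"
    "{x \<in> \<Omega>. g x = c} \<in> sets lebesgue" "{x \<in> \<Omega>. g x \<le> c} \<in> sets lebesgue"
proof -
  have *: "{x \<in> \<Omega>. g x \<in> B} \<in> sets lebesgue" if "B \<in> sets borel" for B
  proof -
    have "g -` B \<inter> space M \<in> sets M"
      by (rule measurable_sets[OF assms that])
    moreover have "g -` B \<inter> space M = {x \<in> \<Omega>. g x \<in> B}"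
      by auto
    ultimately show ?thesis by (simp add: sets_restrict_space_iff)
  qed
  show "{x \<in> \<Omega>. g x > c} \<in> sets lebesgue" "{x \<in> \<Omega>. g x \<ge> c} \<in> sets lebesgue"
    "{x \<in> \<Omega>. g x = c} \<in> sets lebesgue" "{x \<in> \<Omega>. g x \<le> c} \<in> sets lebesgue"
    using *[of "{c<..}"] *[of "{c..}"] *[of "{c}"] *[of "{..c}"] by simp_all
qed

lemma subset_domain_lmeasurable: "A \<in> sets lebesgue \<Longrightarrow> A \<subseteq> \<Omega> \<Longrightarrow> A \<in> lmeasurable"
  using fmeasurableI2[OF domain_lmeasurable] by blast

lemma measurable_onI:
  fixes f :: "'a \<Rightarrow> real"
  assumes "\<And>t. {x \<in> \<Omega>. f x > t} \<in> sets lebesgue"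
  shows "f \<in> borel_measurable M"
  unfolding borel_measurable_iff_greater using assms by (simp add: sets_restrict_space_iff)

text \<open>
  The cases in which \<open>m\<close> is 0 or the full measure are trivial. Otherwise, with \<open>c\<close> the infimum of the levels \<open>a\<close> at which \<open>{g > a}\<close> has measure at most \<open>m\<close>, the value \<open>m\<close> lies between the
  measures of \<open>{g > c}\<close> and \<open>{g \<ge> c}\<close>. The part of the level set \<open>{g = c}\<close> beyond a moving hyperplane has
  continuously varying measure and fills the gap by the intermediate value theorem.
\<close>
lemma upper_set_exists:
  fixes g :: "'a \<Rightarrow> real"
  assumes gm: "g \<in> borel_measurable M" and g0: "\<And>x. 0 \<le> g x" and e: "e \<in> Basis"
    and m: "0 \<le> m" "m \<le> measure lebesgue \<Omega>"
  shows "\<exists>E. upper_set g e E \<and> measure lebesgue E = m"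
proof -
  consider "m = 0" | "m = measure lebesgue \<Omega>" | "0 < m" "m < measure lebesgue \<Omega>"
    using m by linarith
  then show ?thesis
  proof cases
    case 1
    then show ?thesis by (intro exI[of _ "{}"]) (simp add: upper_set_def)
  next
    case 2
    then show ?thesis by (intro exI[of _ \<Omega>]) (simp add: upper_set_def)
  next
    case 3
    note ls = domain_level_sets[OF gm]
    have lm: "{x \<in> \<Omega>. g x > c} \<in> lmeasurable" "{x \<in> \<Omega>. g x \<ge> c} \<in> lmeasurable"
        "{x \<in> \<Omega>. g x = c} \<in> lmeasurable" for c
      by (intro subset_domain_lmeasurable ls; blast)+
    define V where "V c = measure lebesgue {x \<in> \<Omega>. g x > c}" for c
    define A where "A = {c. V c \<le> m}"
    have Amono: "c' \<in> A" if "c \<in> A" "c \<le> c'" for c c'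
    proof -
      have "V c' \<le> V c"
        unfolding V_def using that lm by (intro measure_mono_fmeasurable) auto
      then show ?thesis using that by (simp add: A_def)
    qed
    have Ane: "A \<noteq> {}"
    proof -
      have "(\<lambda>n. measure lebesgue {x \<in> \<Omega>. g x > real n}) \<longlonglongrightarrow> measure lebesgue (\<Inter>n. {x \<in> \<Omega>. g x > real n})"
        using lm by (intro Lim_measure_decseq) (auto simp: decseq_def fmeasurableD2 image_subset_iff intro: fmeasurableD)
      moreover have "(\<Inter>n. {x \<in> \<Omega>. g x > real n}) = {}"
      proof -
        have "\<exists>n. \<not> real n < g x" for x
          using reals_Archimedean2[of "g x"] by (auto simp: not_less intro: less_imp_le)
        then show ?thesis by auto
      qed
      ultimately have "(\<lambda>n. V (real n)) \<longlonglongrightarrow> 0" by (simp add: V_def)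
      then have "\<forall>\<^sub>F n in sequentially. V (real n) < m"
        using 3(1) by (intro order_tendstoD) auto
      then obtain n where "V (real n) < m"
        using eventually_happens by force
      then show ?thesis by (auto simp: A_def intro: less_imp_le)
    qed
    have Alow: "0 \<le> c" if "c \<in> A" for c
    proof (rule ccontr)
      assume "\<not> 0 \<le> c"
      then have "{x \<in> \<Omega>. g x > c} = \<Omega>"
        using g0 by (auto simp: not_le intro: less_le_trans)
      then show False using that 3(2) by (simp add: A_def V_def)
    qed
    then have Abdd: "bdd_below A" by (intro bdd_belowI)
    define c where "c = Inf A"
    have above: "V a \<le> m" if a: "a > c" for a
    proof -
      obtain a' where "a' \<in> A" "a' < a"
        using a cInf_less_iff[OF Ane Abdd, of a] by (auto simp: c_def)
      then have "a \<in> A" by (intro Amono[of a' a]) auto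
      then show ?thesis by (simp add: A_def)
    qed
    have below: "m < V a" if a: "a < c" for a
    proof (rule ccontr)
      assume "\<not> m < V a"
      then have "a \<in> A" by (simp add: A_def)
      then have "c \<le> a"
        unfolding c_def by (rule cInf_lower[OF _ Abdd])
      then show False using a by simp
    qed
    have lo: "V c \<le> m"
    proof -
      have "(\<lambda>n. measure lebesgue {x \<in> \<Omega>. g x > c + 1 / real (Suc n)})
          \<longlonglongrightarrow> measure lebesgue (\<Union>n. {x \<in> \<Omega>. g x > c + 1 / real (Suc n)})"
      proof (rule Lim_measure_incseq)
        have "c + 1 / real (Suc n) \<le> c + 1 / real (Suc k)" if "k \<le> n" for k n
          using that by (simp add: frac_le)
        then show "incseq (\<lambda>n. {x \<in> \<Omega>. g x > c + 1 / real (Suc n)})"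
          unfolding incseq_def by (blast intro: le_less_trans)
        have "emeasure lebesgue (\<Union>n. {x \<in> \<Omega>. g x > c + 1 / real (Suc n)}) \<le> emeasure lebesgue \<Omega>"
          by (intro emeasure_mono) auto
        also have "\<dots> < \<infinity>" using domain_lmeasurable by (simp add: fmeasurable_def)
        finally show "emeasure lebesgue (\<Union>n. {x \<in> \<Omega>. g x > c + 1 / real (Suc n)}) \<noteq> \<infinity>" by simp
      qed (use ls in auto)
      moreover have "(\<Union>n. {x \<in> \<Omega>. g x > c + 1 / real (Suc n)}) = {x \<in> \<Omega>. g x > c}"
      proof -
        have "\<exists>n. c + 1 / real (Suc n) < g x" if "c < g x" for x
          using reals_Archimedean[of "g x - c"] that by (auto simp: inverse_eq_divide algebra_simps)
        moreover have "c < g x" if "c + 1 / real (Suc n) < g x" for x n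
        proof -
          have "0 < 1 / real (Suc n)" by simp
          then show ?thesis using that by linarith
        qed
        ultimately show ?thesis by blast
      qed
      ultimately have "(\<lambda>n. V (c + 1 / real (Suc n))) \<longlonglongrightarrow> V c" by (simp add: V_def)
      then show ?thesis
        using above by (intro tendsto_upperbound[of _ "V c" sequentially]) auto
    qed
    have hi: "m \<le> measure lebesgue {x \<in> \<Omega>. g x \<ge> c}"
    proof -
      have "(\<lambda>n. measure lebesgue {x \<in> \<Omega>. g x > c - 1 / real (Suc n)})
          \<longlonglongrightarrow> measure lebesgue (\<Inter>n. {x \<in> \<Omega>. g x > c - 1 / real (Suc n)})"
      proof (rule Lim_measure_decseq)
        have "c - 1 / real (Suc k) \<le> c - 1 / real (Suc n)" if "k \<le> n" for k n
          using that by (simp add: frac_le)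
        then show "decseq (\<lambda>n. {x \<in> \<Omega>. g x > c - 1 / real (Suc n)})"
          unfolding decseq_def by (blast intro: le_less_trans)
      qed (use lm in \<open>auto simp: fmeasurableD2 image_subset_iff intro: fmeasurableD\<close>)
      moreover have "(\<Inter>n. {x \<in> \<Omega>. g x > c - 1 / real (Suc n)}) = {x \<in> \<Omega>. g x \<ge> c}"
      proof -
        have "c \<le> g x" if "\<And>n. c - 1 / real (Suc n) < g x" for x
        proof (rule ccontr)
          assume "\<not> c \<le> g x"
          then obtain n where "inverse (real (Suc n)) < c - g x"
            using reals_Archimedean[of "c - g x"] by auto
          then show False using that[of n] by (simp add: inverse_eq_divide)
        qed
        moreover have "c - 1 / real (Suc n) < g x" if "c \<le> g x" for x n
        proof -
          have "0 < 1 / real (Suc n)" by simp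
          then show ?thesis using that by linarith
        qed
        ultimately show ?thesis by blast
      qed
      ultimately have "(\<lambda>n. V (c - 1 / real (Suc n))) \<longlonglongrightarrow> measure lebesgue {x \<in> \<Omega>. g x \<ge> c}"
        by (simp add: V_def)
      moreover have "m \<le> V (c - 1 / real (Suc n))" for n
        by (intro less_imp_le below) simp
      ultimately show ?thesis
        by (intro tendsto_lowerbound[of _ _ sequentially]) auto
    qed
    define L where "L = {x \<in> \<Omega>. g x = c}"
    have Ll: "L \<in> lmeasurable" unfolding L_def by (rule lm)
    define h where "h d = measure lebesgue (L \<inter> {x. x \<bullet> e > d})" for d
    have hc: "continuous_on UNIV h"
      unfolding h_def by (rule continuous_measure_halfspace[OF e Ll])
    obtain R where R: "\<Omega> \<subseteq> ball 0 R" "R > 0"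
      using bounded_domain bounded_subset_ballD by blast
    have eR: "\<bar>x \<bullet> e\<bar> < R" if "x \<in> \<Omega>" for x
      using R(1) that Basis_le_norm[OF e, of x] by fastforce
    have LR: "x \<bullet> e < R" "- R < x \<bullet> e" if "x \<in> L" for x
    proof -
      have "\<bar>x \<bullet> e\<bar> < R" using that by (intro eR) (simp add: L_def)
      then show "x \<bullet> e < R" "- R < x \<bullet> e" by linarith+
    qed
    have "L \<inter> {x. x \<bullet> e > R} = {}" "L \<inter> {x. x \<bullet> e > - R} = L"
      using LR by (blast dest: less_asym)+
    then have hR: "h R = 0" "h (- R) = measure lebesgue L"
      by (simp_all add: h_def)
    have "{x \<in> \<Omega>. g x \<ge> c} = {x \<in> \<Omega>. g x > c} \<union> L"
      by (auto simp: L_def)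
    then have "measure lebesgue {x \<in> \<Omega>. g x \<ge> c} = measure lebesgue ({x \<in> \<Omega>. g x > c} \<union> L)"
      by (rule arg_cong)
    also have "\<dots> = V c + measure lebesgue L"
      unfolding V_def L_def
      by (rule measure_Union) (use lm(1)[of c] lm(3)[of c] in \<open>auto simp: fmeasurableD fmeasurableD2\<close>)
    finally have split: "measure lebesgue {x \<in> \<Omega>. g x \<ge> c} = V c + measure lebesgue L" .
    \<comment> \<open>The hyperplanes at \<open>R\<close> and \<open>- R\<close> do not meet the bounded set \<open>\<Omega>\<close>.\<close>
    have "\<exists>d\<ge>- R. d \<le> R \<and> h d = m - V c"
    proof (rule IVT2')
      show "h R \<le> m - V c" "m - V c \<le> h (- R)" "- R \<le> R"
        using lo hi split hR R(2) by linarith+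
      show "continuous_on {- R..R} h"
        by (rule continuous_on_subset[OF hc]) simp
    qed
    then obtain d where d: "h d = m - V c" by blast
    define E where "E = {x \<in> \<Omega>. g x > c} \<union> (L \<inter> {x. x \<bullet> e > d})"
    have "upper_set g e E"
      unfolding upper_set_def
    proof (intro conjI ballI impI)
      show "E \<subseteq> \<Omega>"
        unfolding E_def L_def by blast
      show "E \<in> sets lebesgue" unfolding E_def
        by (intro sets.Un sets.Int ls fmeasurableD[OF Ll]) simp
      fix x y assume xy: "x \<in> E" "y \<in> \<Omega>" "g x < g y \<or> (g x = g y \<and> x \<bullet> e \<le> y \<bullet> e)"
      then have "g x > c \<or> (g x = c \<and> x \<bullet> e > d)"
        unfolding E_def L_def by blast
      then have "g y > c \<or> (g y = c \<and> y \<bullet> e > d)"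
        using xy(3) by linarith
      then show "y \<in> E"
        unfolding E_def L_def using xy(2) by blast
    qed
    moreover have "measure lebesgue E = V c + h d"
      unfolding E_def V_def h_def
    proof (rule measure_Union)
      have "L \<inter> {x. x \<bullet> e > d} \<in> sets lebesgue"
        by (intro sets.Int fmeasurableD[OF Ll]) simp
      then have "L \<inter> {x. x \<bullet> e > d} \<in> lmeasurable"
        by (rule subset_domain_lmeasurable) (auto simp: L_def)
      then show "emeasure lebesgue (L \<inter> {x. x \<bullet> e > d}) \<noteq> \<infinity>" "L \<inter> {x. x \<bullet> e > d} \<in> sets lebesgue"
        by (auto simp: fmeasurable_def)
    qed (use fmeasurableD[OF lm(1)[of c]] fmeasurableD2[OF lm(1)[of c]] in \<open>auto simp: L_def\<close>)
    ultimately show ?thesis using d by auto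
  qed
qed

end

section \<open>Rearrangements sorted like a given function\<close>

context fractional_domain
begin

lemma lebesgue_le_domain: "A \<subseteq> \<Omega> \<Longrightarrow> emeasure lebesgue A \<le> emeasure lebesgue \<Omega>"
  by (rule emeasure_mono) auto

lemma emeasure_domain_finite: "emeasure lebesgue \<Omega> < \<infinity>"
  using domain_lmeasurable by (simp add: fmeasurable_def)

text \<open>
  The essential bounds of a function can be read off from its distribution function; for the lower one
  this uses that \<open>\<Omega>\<close> has finite measure.
\<close>
lemma rearrangement_bounded:
  assumes \<rho>0: "bounded_weight \<Omega> C \<rho>0" and \<rho>: "\<rho> \<in> rearrangements \<Omega> \<rho>0"
  shows "bounded_weight \<Omega> C \<rho>"
proof -
  have \<rho>m: "\<rho> \<in> borel_measurable M"
    and eq: "\<And>t. emeasure lebesgue {x \<in> \<Omega>. \<rho> x > t} = emeasure lebesgue {x \<in> \<Omega>. \<rho>0 x > t}"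
    using \<rho> by (auto simp: rearrangements_def)
  have \<rho>0m: "\<rho>0 \<in> borel_measurable M"
    and bd: "AE x in lebesgue. x \<in> \<Omega> \<longrightarrow> \<bar>\<rho>0 x\<bar> \<le> C"
    using \<rho>0 by (auto simp: bounded_weight_def AE_restrict_space_iff)
  note ls = domain_level_sets[OF \<rho>m] domain_level_sets[OF \<rho>0m]
  have "emeasure lebesgue {x \<in> \<Omega>. \<rho>0 x > C} = 0"
  proof -
    have "AE x in lebesgue. \<not> (x \<in> \<Omega> \<and> \<rho>0 x > C)"
      using bd by eventually_elim auto
    from emeasure_eq_0_AE[OF this] show ?thesis by simp
  qed
  then have "{x \<in> \<Omega>. \<rho> x > C} \<in> null_sets lebesgue"
    using eq[of C] ls(1)[of C] by (simp add: null_sets_def)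
  then have up: "AE x in lebesgue. x \<notin> {x \<in> \<Omega>. \<rho> x > C}"
    by (rule AE_not_in)
  have "AE x in lebesgue. x \<notin> {x \<in> \<Omega>. \<rho> x \<le> - C - 1 / real (Suc n)}" for n
  proof -
    define t where "t = - C - 1 / real (Suc n)"
    have t: "t < - C" by (simp add: t_def)
    have "emeasure lebesgue {x \<in> \<Omega>. \<rho>0 x > t} = emeasure lebesgue \<Omega>"
    proof (rule emeasure_eq_AE)
      show "AE x in lebesgue. x \<in> {x \<in> \<Omega>. \<rho>0 x > t} \<longleftrightarrow> x \<in> \<Omega>"
        using bd by eventually_elim (use t in auto)
    qed (use ls in auto)
    then have "emeasure lebesgue {x \<in> \<Omega>. \<rho> x > t} = emeasure lebesgue \<Omega>"
      using eq by simp
    moreover have "emeasure lebesgue (\<Omega> - {x \<in> \<Omega>. \<rho> x > t}) = emeasure lebesgue \<Omega> - emeasure lebesgue {x \<in> \<Omega>. \<rho> x > t}"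
      using lebesgue_le_domain[of "{x \<in> \<Omega>. \<rho> x > t}"] emeasure_domain_finite ls(1)[of t]
      by (intro emeasure_Diff) auto
    moreover have "\<Omega> - {x \<in> \<Omega>. \<rho> x > t} = {x \<in> \<Omega>. \<rho> x \<le> t}"
      by auto
    ultimately have "{x \<in> \<Omega>. \<rho> x \<le> t} \<in> null_sets lebesgue"
      using ls(4)[of t] emeasure_domain_finite by (simp add: null_sets_def)
    then show ?thesis
      unfolding t_def by (rule AE_not_in)
  qed
  then have "AE x in lebesgue. \<forall>n. x \<notin> {x \<in> \<Omega>. \<rho> x \<le> - C - 1 / real (Suc n)}"
    unfolding AE_all_countable by blast
  then have "AE x in lebesgue. x \<in> \<Omega> \<longrightarrow> \<bar>\<rho> x\<bar> \<le> C"
    using up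
  proof eventually_elim
    case (elim x)
    have "- C \<le> \<rho> x" if "x \<in> \<Omega>"
    proof (rule ccontr)
      assume "\<not> - C \<le> \<rho> x"
      then obtain n where "inverse (real (Suc n)) < - C - \<rho> x"
        using reals_Archimedean[of "- C - \<rho> x"] by auto
      then have "\<rho> x \<le> - C - 1 / real (Suc n)"
        by (simp add: inverse_eq_divide)
      then show False using elim(1) that by blast
    qed
    then show ?case using elim(2) by auto
  qed
  then show ?thesis
    using \<rho>m by (simp add: bounded_weight_def AE_restrict_space_iff)
qed

text \<open>
  The sets differ by parts of equal measure, and \<open>g\<close> is at most a constant \<open>c\<close> on \<open>A - B\<close> and at least \<open>c\<close>
  on \<open>B - A\<close>.
\<close>
lemma bathtub:
  assumes g: "g \<in> borel_measurable M" "\<And>x. 0 \<le> g x"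
    and A: "A \<in> sets lebesgue" "A \<subseteq> \<Omega>" and B: "B \<in> sets lebesgue" "B \<subseteq> \<Omega>"
    and eq: "emeasure lebesgue A = emeasure lebesgue B"
    and up: "\<And>x y. x \<in> B \<Longrightarrow> y \<in> \<Omega> - B \<Longrightarrow> g y \<le> g x"
  shows "(\<integral>\<^sup>+x. ennreal (g x) * indicator A x \<partial>M)
    \<le> (\<integral>\<^sup>+x. ennreal (g x) * indicator B x \<partial>M)"
proof -
  have Am: "A \<in> sets M" and Bm: "B \<in> sets M"
    using A B by (auto simp: sets_restrict_space_iff)
  have eA: "emeasure M X = emeasure lebesgue X" if "X \<subseteq> \<Omega>" for X
    using that by (intro emeasure_restrict_space) auto
  have gm: "(\<lambda>x. ennreal (g x)) \<in> borel_measurable M"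
    using g(1) by measurable
  have split: "(\<integral>\<^sup>+x. ennreal (g x) * indicator (X \<union> Y) x \<partial>M)
      = (\<integral>\<^sup>+x. ennreal (g x) * indicator X x \<partial>M)
        + (\<integral>\<^sup>+x. ennreal (g x) * indicator Y x \<partial>M)"
    if "X \<inter> Y = {}" "X \<in> sets M" "Y \<in> sets M" for X Y
    by (rule nn_integral_disjoint_pair[OF gm that(2,3,1)])
  consider "A - B = {}" | "B = {}" | "A - B \<noteq> {}" "B \<noteq> {}" by blast
  then show ?thesis
  proof cases
    case 1
    then show ?thesis by (intro nn_integral_mono) (auto split: split_indicator)
  next
    case 2
    then have "A \<in> null_sets M"
      using Am eA[OF A(2)] eq by (simp add: null_sets_def)
    then have "AE x in M. x \<notin> A"
      by (rule AE_not_in)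
    then have "AE x in M. ennreal (g x) * indicator A x = 0"
      by eventually_elim simp
    then have "(\<integral>\<^sup>+x. ennreal (g x) * indicator A x \<partial>M) = (\<integral>\<^sup>+x. 0 \<partial>M)"
      by (rule nn_integral_cong_AE)
    then show ?thesis by simp
  next
    case 3
    then obtain x0 where x0: "x0 \<in> B" by blast
    define c where "c = (SUP y\<in>A - B. g y)"
    have bdd: "bdd_above (g ` (A - B))"
      using up[OF x0] A(2) by (intro bdd_aboveI2[of _ _ "g x0"]) blast
    have c1: "g y \<le> c" if "y \<in> A - B" for y
      unfolding c_def using that bdd by (rule cSUP_upper)
    have c2: "c \<le> g x" if "x \<in> B" for x
      unfolding c_def using 3(1) up[OF that] A(2) by (intro cSUP_least) blast+
    have fin: "emeasure lebesgue (A \<inter> B) \<noteq> \<infinity>"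
      using A B by (simp add: fmeasurableD2 subset_domain_lmeasurable le_infI1)
    have "emeasure lebesgue (A - A \<inter> B) = emeasure lebesgue (B - A \<inter> B)"
      using A B fin eq by (subst (1 2) emeasure_Diff) auto
    then have diff: "emeasure lebesgue (A - B) = emeasure lebesgue (B - A)"
      by (simp add: Diff_Int Int_commute)
    have eAB: "emeasure M (A - B) = emeasure lebesgue (A - B)"
      and eBA: "emeasure M (B - A) = emeasure lebesgue (B - A)"
      using A(2) B(2) by (blast intro: eA)+
    have "(\<integral>\<^sup>+x. ennreal (g x) * indicator (A - B) x \<partial>M)
        \<le> (\<integral>\<^sup>+x. ennreal c * indicator (A - B) x \<partial>M)"
      using c1 by (intro nn_integral_mono) (auto split: split_indicator intro: ennreal_leI)
    also have "\<dots> = ennreal c * emeasure lebesgue (B - A)"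
      using sets.Diff[OF Am Bm] by (simp add: nn_integral_cmult_indicator eAB diff)
    also have "\<dots> = (\<integral>\<^sup>+x. ennreal c * indicator (B - A) x \<partial>M)"
      using sets.Diff[OF Bm Am] by (simp add: nn_integral_cmult_indicator eBA)
    also have "\<dots> \<le> (\<integral>\<^sup>+x. ennreal (g x) * indicator (B - A) x \<partial>M)"
      using c2 by (intro nn_integral_mono) (auto split: split_indicator intro: ennreal_leI)
    finally have "(\<integral>\<^sup>+x. ennreal (g x) * indicator ((A \<inter> B) \<union> (A - B)) x \<partial>M)
        \<le> (\<integral>\<^sup>+x. ennreal (g x) * indicator ((A \<inter> B) \<union> (B - A)) x \<partial>M)"
      using Am Bm by (subst (1 2) split) (auto intro: add_left_mono)
    moreover have "(A \<inter> B) \<union> (A - B) = A" "(A \<inter> B) \<union> (B - A) = B" by auto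
    ultimately show ?thesis by simp
  qed
qed

text \<open>
  For every level \<open>t\<close> choose an upper set with the measure of \<open>{\<rho>0 > t}\<close>. Upper sets form a chain, so the
  function with value \<open>Sup {q \<in> \<rat>. x \<in> E q}\<close> at \<open>x\<close> has superlevel sets that are countable unions of a chain,
  with the right measures.
\<close>
lemma cosorted_rearrangement_exists:
  fixes g :: "'a \<Rightarrow> real"
  assumes \<rho>0: "bounded_weight \<Omega> C \<rho>0" and g: "g \<in> borel_measurable M" "\<And>x. 0 \<le> g x"
  shows "\<exists>\<sigma>\<in>rearrangements \<Omega> \<rho>0. \<forall>t x y. x \<in> \<Omega> \<and> \<sigma> x > t \<and> y \<in> \<Omega> \<and> \<sigma> y \<le> t \<longrightarrow> g y \<le> g x"
proof -
  obtain e :: 'a where e: "e \<in> Basis" using nonempty_Basis by blast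
  have \<rho>0m: "\<rho>0 \<in> borel_measurable M"
    and bd: "AE x in lebesgue. x \<in> \<Omega> \<longrightarrow> \<bar>\<rho>0 x\<bar> \<le> C"
    using \<rho>0 by (auto simp: bounded_weight_def AE_restrict_space_iff)
  note ls = domain_level_sets[OF \<rho>0m]
  have lm: "{x \<in> \<Omega>. \<rho>0 x > t} \<in> lmeasurable" for t
    by (intro subset_domain_lmeasurable ls) blast
  have top: "emeasure lebesgue {x \<in> \<Omega>. \<rho>0 x > t} = 0" if "t \<ge> C" for t
  proof -
    have "AE x in lebesgue. \<not> (x \<in> \<Omega> \<and> \<rho>0 x > t)"
      using bd by eventually_elim (use that in auto)
    from emeasure_eq_0_AE[OF this] show ?thesis by simp
  qed
  have bot: "emeasure lebesgue {x \<in> \<Omega>. \<rho>0 x > t} = emeasure lebesgue \<Omega>" if "t < - C" for t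
  proof (rule emeasure_eq_AE)
    show "AE x in lebesgue. x \<in> {x \<in> \<Omega>. \<rho>0 x > t} \<longleftrightarrow> x \<in> \<Omega>"
      using bd by eventually_elim (use that in auto)
  qed (use ls in auto)
  \<comment> \<open>Beyond the essential bounds the sets are fixed to be empty or all of \<open>\<Omega>\<close>, so that the
    suprema below are taken over nonempty bounded sets at every point of \<open>\<Omega>\<close>.\<close>
  have "\<exists>E. upper_set g e E \<and> emeasure lebesgue E = emeasure lebesgue {x \<in> \<Omega>. \<rho>0 x > t}
      \<and> (t \<ge> C \<longrightarrow> E = {}) \<and> (t < C \<and> t < - C \<longrightarrow> E = \<Omega>)" for t
  proof -
    consider "t \<ge> C" | "t < C" "t < - C" | "t < C" "t \<ge> - C" by linarith
    then show ?thesis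
    proof cases
      case 1
      then show ?thesis by (intro exI[of _ "{}"]) (simp add: upper_set_def top)
    next
      case 2
      then show ?thesis by (intro exI[of _ \<Omega>]) (simp add: upper_set_def bot)
    next
      case 3
      have "measure lebesgue {x \<in> \<Omega>. \<rho>0 x > t} \<le> measure lebesgue \<Omega>"
        using lm domain_lmeasurable by (intro measure_mono_fmeasurable) auto
      then obtain E where E: "upper_set g e E" "measure lebesgue E = measure lebesgue {x \<in> \<Omega>. \<rho>0 x > t}"
        using upper_set_exists[OF g e measure_nonneg] by blast
      have "E \<in> lmeasurable"
        by (intro subset_domain_lmeasurable upper_set_sets[OF E(1)])
      then have "emeasure lebesgue E = emeasure lebesgue {x \<in> \<Omega>. \<rho>0 x > t}"
        using E(2) lm[of t] by (simp add: emeasure_eq_measure2)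
      then show ?thesis using E(1) 3 by (intro exI[of _ E]) simp
    qed
  qed
  then obtain E where E: "\<And>t. upper_set g e (E t)"
      "\<And>t. emeasure lebesgue (E t) = emeasure lebesgue {x \<in> \<Omega>. \<rho>0 x > t}"
      "\<And>t. t \<ge> C \<Longrightarrow> E t = {}" "\<And>t. t < C \<Longrightarrow> t < - C \<Longrightarrow> E t = \<Omega>"
    by metis
  have Es: "E t \<in> sets lebesgue" "E t \<subseteq> \<Omega>" for t
    by (rule upper_set_sets[OF E(1)])+
  define S where "S x = {q \<in> \<rat>. x \<in> E q}" for x
  define \<sigma> where "\<sigma> x = Sup (S x)" for x
  have Sbdd: "bdd_above (S x)" for x
  proof (rule bdd_aboveI[of _ C])
    fix q assume "q \<in> S x"
    then show "q \<le> C" using E(3)[of q] by (force simp: S_def)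
  qed
  have Sne: "S x \<noteq> {}" if "x \<in> \<Omega>" for x
  proof -
    obtain q where q: "q \<in> \<rat>" "min C (- C) - 1 < q" "q < min C (- C)"
      using Rats_dense_in_real[of "min C (- C) - 1" "min C (- C)"] by (meson diff_less zero_less_one less_add_one diff_less_eq)
    then have "E q = \<Omega>" by (intro E(4)) simp_all
    then have "q \<in> S x" using that q(1) unfolding S_def by blast
    then show ?thesis by blast
  qed
  define U where "U t = (\<Union>q\<in>{q \<in> \<rat>. q > t}. E q)" for t
  have lev: "{x \<in> \<Omega>. \<sigma> x > t} = U t" for t
  proof -
    have "\<sigma> x > t \<longleftrightarrow> (\<exists>q\<in>\<rat>. q > t \<and> x \<in> E q)" if "x \<in> \<Omega>" for x
      unfolding \<sigma>_def less_cSup_iff[OF Sne[OF that] Sbdd] by (auto simp: S_def)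
    then show ?thesis
      using Es(2) by (auto simp: U_def)
  qed
  have cnt: "countable {q \<in> \<rat>. q > t}" for t :: real
    using countable_rat by (rule countable_subset[rotated]) auto
  have Us: "U t \<in> sets lebesgue" for t
    unfolding U_def using cnt Es(1) by (intro sets.countable_UN') auto
  have le: "emeasure lebesgue {x \<in> \<Omega>. \<rho>0 x > q} \<le> emeasure lebesgue {x \<in> \<Omega>. \<rho>0 x > t}" if "t < q" for q t
    using that ls by (intro emeasure_mono) auto
  have meas: "emeasure lebesgue (U t) = emeasure lebesgue {x \<in> \<Omega>. \<rho>0 x > t}" for t
  proof (rule antisym)
    show "emeasure lebesgue (U t) \<le> emeasure lebesgue {x \<in> \<Omega>. \<rho>0 x > t}"
      unfolding U_def
      by (intro emeasure_chain_Union_le cnt Es upper_set_chain[OF E(1) E(1)]) (auto simp: E(2) intro: le)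
    have "{x \<in> \<Omega>. \<rho>0 x > t} = (\<Union>q\<in>{q \<in> \<rat>. q > t}. {x \<in> \<Omega>. \<rho>0 x > q})"
    proof -
      have "\<exists>q\<in>\<rat>. t < q \<and> q < \<rho>0 x" if "t < \<rho>0 x" for x
        using Rats_dense_in_real[OF that] by blast
      then show ?thesis by (auto intro: less_trans)
    qed
    moreover have "emeasure lebesgue (\<Union>q\<in>{q \<in> \<rat>. q > t}. {x \<in> \<Omega>. \<rho>0 x > q}) \<le> emeasure lebesgue (U t)"
    proof (rule emeasure_chain_Union_le[OF cnt])
      show "{x \<in> \<Omega>. \<rho>0 x > q} \<in> sets lebesgue" for q by (rule ls)
      show "{x \<in> \<Omega>. \<rho>0 x > p} \<subseteq> {x \<in> \<Omega>. \<rho>0 x > q} \<or> {x \<in> \<Omega>. \<rho>0 x > q} \<subseteq> {x \<in> \<Omega>. \<rho>0 x > p}" for p q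
        by (cases "p \<le> q") (auto intro: less_trans le_less_trans)
      show "emeasure lebesgue {x \<in> \<Omega>. \<rho>0 x > q} \<le> emeasure lebesgue (U t)" if "q \<in> {q \<in> \<rat>. q > t}" for q
        unfolding E(2)[symmetric] using that Us by (intro emeasure_mono) (auto simp: U_def)
    qed
    ultimately show "emeasure lebesgue {x \<in> \<Omega>. \<rho>0 x > t} \<le> emeasure lebesgue (U t)" by simp
  qed
  have "\<sigma> \<in> rearrangements \<Omega> \<rho>0"
    unfolding rearrangements_def using meas Us by (auto simp: lev intro: measurable_onI)
  moreover have "g y \<le> g x" if "x \<in> \<Omega>" "\<sigma> x > t" "y \<in> \<Omega>" "\<sigma> y \<le> t" for t x y
  proof (rule ccontr)
    assume "\<not> g y \<le> g x"
    then have gxy: "g x < g y" by simp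
    have "x \<in> U t" using that lev[of t] by blast
    then obtain q where q: "q \<in> \<rat>" "q > t" "x \<in> E q" by (auto simp: U_def)
    have "y \<in> E q"
      by (rule upper_setD[OF E(1) q(3) that(3)]) (use gxy in simp)
    then have "y \<in> U t" using q by (auto simp: U_def)
    then show False using that(4) lev[of t] by force
  qed
  ultimately show ?thesis by blast
qed

text \<open>
  By the layer cake formula \<open>\<integral> (\<rho> + C) * g\<close> is the integral over \<open>t > - C\<close> of the integrals of \<open>g\<close> over
  \<open>{\<rho> > t}\<close>, and for each \<open>t\<close> these are largest for the superlevel sets of the sorted rearrangement.
\<close>
lemma hardy_littlewood_maximizer:
  fixes g :: "'a \<Rightarrow> real"
  assumes \<rho>0: "bounded_weight \<Omega> C \<rho>0" and g: "integrable M g" "\<And>x. 0 \<le> g x"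
  shows "\<exists>\<sigma>\<in>rearrangements \<Omega> \<rho>0. \<forall>\<rho>\<in>rearrangements \<Omega> \<rho>0.
    (\<integral>x. \<rho> x * g x \<partial>M) \<le> (\<integral>x. \<sigma> x * g x \<partial>M)"
proof -
  have gm: "g \<in> borel_measurable M" using g(1) by auto
  obtain \<sigma> where \<sigma>: "\<sigma> \<in> rearrangements \<Omega> \<rho>0"
      "\<And>t x y. x \<in> \<Omega> \<Longrightarrow> \<sigma> x > t \<Longrightarrow> y \<in> \<Omega> \<Longrightarrow> \<sigma> y \<le> t \<Longrightarrow> g y \<le> g x"
    using cosorted_rearrangement_exists[OF \<rho>0 gm g(2)] by blast
  interpret P: pair_sigma_finite "M" "lborel :: real measure"
    by unfold_locales
  have layer: "(\<integral>\<^sup>+x. ennreal ((\<rho> x + C) * g x) \<partial>M)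
      = (\<integral>\<^sup>+t. (\<integral>\<^sup>+x. ennreal (g x) * indicator {x \<in> \<Omega>. \<rho> x > t} x \<partial>M) * indicator {- C<..} t \<partial>lborel)"
    if "\<rho> \<in> rearrangements \<Omega> \<rho>0" for \<rho>
  proof -
    have b: "bounded_weight \<Omega> C \<rho>" by (rule rearrangement_bounded[OF \<rho>0 that])
    then have \<rho>m[measurable]: "\<rho> \<in> borel_measurable M"
      by (simp add: bounded_weight_def)
    note gm[measurable]
    have "AE x in M. \<bar>\<rho> x\<bar> \<le> C"
      using b by (simp add: bounded_weight_def)
    then have "(\<integral>\<^sup>+x. ennreal ((\<rho> x + C) * g x) \<partial>M)
        = (\<integral>\<^sup>+x. (\<integral>\<^sup>+t. ennreal (g x) * indicator {- C<..<\<rho> x} t \<partial>lborel) \<partial>M)"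
    proof (intro nn_integral_cong_AE, eventually_elim)
      case (elim x)
      then have "- C \<le> \<rho> x" by linarith
      then show ?case
        using g(2)[of x] by (simp add: nn_integral_cmult_indicator ennreal_mult mult.commute)
    qed
    also have "\<dots> = (\<integral>\<^sup>+x. (\<integral>\<^sup>+t. ennreal (g x) * (if - C < t \<and> t < \<rho> x then 1 else 0) \<partial>lborel) \<partial>M)"
      by (intro nn_integral_cong) (auto split: split_indicator)
    also have "\<dots> = (\<integral>\<^sup>+t. (\<integral>\<^sup>+x. ennreal (g x) * (if - C < t \<and> t < \<rho> x then 1 else 0) \<partial>M) \<partial>lborel)"
      by (rule P.Fubini'[symmetric]) measurable
    also have "\<dots> = (\<integral>\<^sup>+t. (\<integral>\<^sup>+x. ennreal (g x) * indicator {x \<in> \<Omega>. \<rho> x > t} x \<partial>M) * indicator {- C<..} t \<partial>lborel)"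
    proof (rule nn_integral_cong)
      fix t
      show "(\<integral>\<^sup>+x. ennreal (g x) * (if - C < t \<and> t < \<rho> x then 1 else 0) \<partial>M)
          = (\<integral>\<^sup>+x. ennreal (g x) * indicator {x \<in> \<Omega>. \<rho> x > t} x \<partial>M) * indicator {- C<..} t"
      proof (cases "- C < t")
        case True
        then show ?thesis
          by (auto intro!: nn_integral_cong split: split_indicator)
      qed simp
    qed
    finally show ?thesis .
  qed
  have "(\<integral>x. \<rho> x * g x \<partial>M) \<le> (\<integral>x. \<sigma> x * g x \<partial>M)"
    if \<rho>: "\<rho> \<in> rearrangements \<Omega> \<rho>0" for \<rho>
  proof -
    have \<rho>m: "\<rho> \<in> borel_measurable M" and \<sigma>m: "\<sigma> \<in> borel_measurable M"
      using \<rho> \<sigma>(1) by (auto simp: rearrangements_def)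
    have tail: "(\<integral>\<^sup>+x. ennreal (g x) * indicator {x \<in> \<Omega>. \<rho> x > t} x \<partial>M)
        \<le> (\<integral>\<^sup>+x. ennreal (g x) * indicator {x \<in> \<Omega>. \<sigma> x > t} x \<partial>M)" for t
    proof (rule bathtub[OF gm g(2)])
      show "emeasure lebesgue {x \<in> \<Omega>. \<rho> x > t} = emeasure lebesgue {x \<in> \<Omega>. \<sigma> x > t}"
        using \<rho> \<sigma>(1) by (simp add: rearrangements_def)
      show "g y \<le> g x" if "x \<in> {x \<in> \<Omega>. \<sigma> x > t}" "y \<in> \<Omega> - {x \<in> \<Omega>. \<sigma> x > t}" for x y
        using that by (intro \<sigma>(2)[of x t y]) auto
    qed (use domain_level_sets[OF \<rho>m] domain_level_sets[OF \<sigma>m] in auto)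
    have le: "(\<integral>\<^sup>+x. ennreal ((\<rho> x + C) * g x) \<partial>M) \<le> (\<integral>\<^sup>+x. ennreal ((\<sigma> x + C) * g x) \<partial>M)"
      unfolding layer[OF \<rho>] layer[OF \<sigma>(1)] by (rule nn_integral_mono) (rule mult_right_mono[OF tail], simp)
    have ir: "integrable M (\<lambda>x. \<tau> x * g x)"
      and int: "(\<integral>\<^sup>+x. ennreal ((\<tau> x + C) * g x) \<partial>M)
        = ennreal ((\<integral>x. \<tau> x * g x \<partial>M) + C * (\<integral>x. g x \<partial>M))"
      and nn: "0 \<le> (\<integral>x. \<tau> x * g x \<partial>M) + C * (\<integral>x. g x \<partial>M)"
      if \<tau>: "\<tau> \<in> rearrangements \<Omega> \<rho>0" for \<tau> :: "'a \<Rightarrow> real"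
    proof -
      have b: "bounded_weight \<Omega> C \<tau>" by (rule rearrangement_bounded[OF \<rho>0 \<tau>])
      show i: "integrable M (\<lambda>x. \<tau> x * g x)"
        by (rule weight_integrable[OF b g(1)])
      have i2: "integrable M (\<lambda>x. (\<tau> x + C) * g x)"
        using i g(1) by (simp add: distrib_right)
      have "AE x in M. \<bar>\<tau> x\<bar> \<le> C"
        using b by (simp add: bounded_weight_def)
      then have ae: "AE x in M. 0 \<le> (\<tau> x + C) * g x"
        by eventually_elim (use g(2) in \<open>auto intro!: mult_nonneg_nonneg\<close>)
      have eq: "(\<integral>x. (\<tau> x + C) * g x \<partial>M)
          = (\<integral>x. \<tau> x * g x \<partial>M) + C * (\<integral>x. g x \<partial>M)"
        using i g(1) by (simp add: distrib_right)
      show "(\<integral>\<^sup>+x. ennreal ((\<tau> x + C) * g x) \<partial>M)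
        = ennreal ((\<integral>x. \<tau> x * g x \<partial>M) + C * (\<integral>x. g x \<partial>M))"
        using nn_integral_eq_integral[OF i2 ae] eq by simp
      show "0 \<le> (\<integral>x. \<tau> x * g x \<partial>M) + C * (\<integral>x. g x \<partial>M)"
        using integral_nonneg_AE[OF ae] eq by simp
    qed
    show ?thesis
      using le unfolding int[OF \<rho>] int[OF \<sigma>(1)] by (simp add: ennreal_le_iff nn[OF \<sigma>(1)])
  qed
  then show ?thesis using \<sigma>(1) by blast
qed

end

section \<open>Exchanging values along a translation\<close>

text \<open>
  Pick a point of \<open>D\<close> below each rational that has one, and add the least element if there is one.
\<close>
lemma countable_coinitial_subset:
  fixes D :: "real set"
  shows "\<exists>D0. countable D0 \<and> D0 \<subseteq> D \<and> (\<forall>d\<in>D. \<exists>c\<in>D0. c \<le> d)"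
proof -
  define Q where "Q = {q \<in> \<rat>. \<exists>d\<in>D. d < q}"
  have "\<forall>q\<in>Q. \<exists>d. d \<in> D \<and> d < q" by (auto simp: Q_def)
  then obtain f where f: "\<And>q. q \<in> Q \<Longrightarrow> f q \<in> D \<and> f q < q"
    by metis
  define L where "L = {d \<in> D. \<forall>d'\<in>D. d \<le> d'}"
  have "countable L"
  proof (cases "L = {}")
    case False
    then obtain l where l: "l \<in> L" by blast
    then have "L \<subseteq> {l}" unfolding L_def by (blast intro: antisym)
    then show ?thesis by (rule countable_subset) simp
  qed simp
  moreover have "countable Q"
    unfolding Q_def using countable_rat by (rule countable_subset[rotated]) blast
  ultimately have "countable (L \<union> f ` Q)" by simp
  moreover have "L \<union> f ` Q \<subseteq> D" using f by (auto simp: L_def)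
  moreover have "\<exists>c\<in>L \<union> f ` Q. c \<le> d" if d: "d \<in> D" for d
  proof (cases "d \<in> L")
    case True
    then show ?thesis by (intro bexI[of _ d]) simp_all
  next
    case False
    then obtain d' where "d' \<in> D" "d' < d" using d by (auto simp: L_def not_le)
    then obtain q where q: "q \<in> \<rat>" "d' < q" "q < d"
      using Rats_dense_in_real by blast
    then have "q \<in> Q" using \<open>d' \<in> D\<close> by (auto simp: Q_def)
    then have "f q \<le> d" using f[of q] q(3) by linarith
    then show ?thesis using \<open>q \<in> Q\<close> by (intro bexI[of _ "f q"]) simp_all
  qed
  ultimately show ?thesis by (intro exI[of _ "L \<union> f ` Q"] conjI ballI)
qed

text \<open>
  The measure of the overlap, integrated over all translations \<open>z\<close>, is the product of the measures of
  \<open>A\<close> and \<open>B\<close> by Fubini's theorem. The sets are closed so that \<open>(x, z) \<mapsto> x + z \<in> B\<close> is Borel measurable.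
\<close>
lemma translate_overlap:
  fixes A B :: "'a::euclidean_space set"
  assumes A: "closed A" "emeasure lebesgue A \<noteq> 0" and B: "closed B" "emeasure lebesgue B \<noteq> 0"
  shows "\<exists>z. emeasure lebesgue (A \<inter> {x. x + z \<in> B}) \<noteq> 0"
proof (rule ccontr)
  assume *: "\<not> ?thesis"
  have Am[measurable]: "A \<in> sets borel" and Bm[measurable]: "B \<in> sets borel"
    using A B by auto
  have "0 = (\<integral>\<^sup>+z. emeasure lborel (A \<inter> {x. x + z \<in> B}) \<partial>(lborel :: 'a measure))"
  proof -
    have "emeasure lborel (A \<inter> {x. x + z \<in> B}) = 0" for z
    proof -
      have "{x. x + z \<in> B} \<in> sets borel"
        using measurable_sets[of "\<lambda>x. x + z" borel borel B] by (simp add: vimage_def)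
      then show ?thesis using * by (simp add: emeasure_completion)
    qed
    then show ?thesis by simp
  qed
  also have "\<dots> = (\<integral>\<^sup>+z. (\<integral>\<^sup>+x. indicator A x * indicator B (x + z) \<partial>lborel) \<partial>(lborel :: 'a measure))"
  proof (rule nn_integral_cong)
    fix z :: 'a
    have m: "{x. x + z \<in> B} \<in> sets borel"
      using measurable_sets[of "\<lambda>x. x + z" borel borel B] by (simp add: vimage_def)
    have "emeasure lborel (A \<inter> {x. x + z \<in> B}) = (\<integral>\<^sup>+x. indicator (A \<inter> {x. x + z \<in> B}) x \<partial>lborel)"
      using m by (subst nn_integral_indicator) auto
    also have "\<dots> = (\<integral>\<^sup>+x. indicator A x * indicator B (x + z) \<partial>lborel)"
      by (intro nn_integral_cong) (auto split: split_indicator)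
    finally show "emeasure lborel (A \<inter> {x. x + z \<in> B}) = (\<integral>\<^sup>+x. indicator A x * indicator B (x + z) \<partial>lborel)" .
  qed
  also have "\<dots> = (\<integral>\<^sup>+x. (\<integral>\<^sup>+z. indicator A x * indicator B (x + z) \<partial>lborel) \<partial>(lborel :: 'a measure))"
    by (rule lborel_pair.Fubini') measurable
  also have "\<dots> = (\<integral>\<^sup>+x. indicator A x * emeasure lborel B \<partial>lborel)"
  proof (rule nn_integral_cong)
    fix x :: 'a
    have "(\<integral>\<^sup>+z. indicator B (x + z) \<partial>lborel) = (\<integral>\<^sup>+z. indicator B z \<partial>lborel)"
      using nn_integral_lebesgue_translate[of "indicator B" x] by (simp add: nn_integral_completion)
    then show "(\<integral>\<^sup>+z. indicator A x * indicator B (x + z) \<partial>lborel) = indicator A x * emeasure lborel B"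
      by (simp add: nn_integral_cmult)
  qed
  also have "\<dots> = emeasure lborel A * emeasure lborel B"
    by (simp add: nn_integral_multc)
  finally show False
    using A B by (simp add: emeasure_completion)
qed

lemma emeasure_lebesgue_translation: "emeasure lebesgue ((+) z ` S) = emeasure lebesgue S"
  using emeasure_lebesgue_affine[of 1 z S] by (simp add: add.commute cong: image_cong_simp)

text \<open>
  If \<open>A\<close> and its translate are disjoint, this is a measure preserving involution.
\<close>
definition translation_swap :: "'a::euclidean_space set \<Rightarrow> 'a \<Rightarrow> 'a \<Rightarrow> 'a" where
  "translation_swap A z x = (if x \<in> A then x + z else if x \<in> (+) z ` A then x - z else x)"

lemma translation_swap_involution:
  assumes "A \<inter> (+) z ` A = {}"
  shows "translation_swap A z (translation_swap A z x) = x"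
  using assms by (auto simp: translation_swap_def add.commute)

lemma translation_swap_vimage:
  assumes A: "A \<in> sets lebesgue" and disj: "A \<inter> (+) z ` A = {}" and S: "S \<in> sets lebesgue"
  shows "translation_swap A z -` S \<in> sets lebesgue"
    and "emeasure lebesgue (translation_swap A z -` S) = emeasure lebesgue S"
proof -
  define B where "B = (+) z ` A"
  have B: "B \<in> sets lebesgue"
    unfolding B_def by (rule lebesgue_sets_translation[OF A])
  have AB: "A \<inter> B = {}" using disj by (simp add: B_def)
  define X where "X = S - (A \<union> B)"
  define Y where "Y = (+) (- z) ` (S \<inter> B)"
  define Z where "Z = (+) z ` (S \<inter> A)"
  have XYZ: "X \<in> sets lebesgue" "Y \<in> sets lebesgue" "Z \<in> sets lebesgue"
    unfolding X_def Y_def Z_def by (intro sets.Diff sets.Un lebesgue_sets_translation sets.Int A B S)+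
  have YA: "Y \<subseteq> A" and ZB: "Z \<subseteq> B"
    by (auto simp: Y_def Z_def B_def)
  have memY: "x \<in> Y \<longleftrightarrow> x \<in> A \<and> x + z \<in> S" for x
  proof
    assume "x \<in> Y"
    then show "x \<in> A \<and> x + z \<in> S" by (auto simp: Y_def B_def add.commute)
  next
    assume "x \<in> A \<and> x + z \<in> S"
    then have "x + z \<in> S \<inter> B" by (auto simp: B_def add.commute)
    then have "- z + (x + z) \<in> Y" unfolding Y_def by (rule imageI)
    then show "x \<in> Y" by simp
  qed
  have memZ: "x \<in> Z \<longleftrightarrow> x \<in> B \<and> x - z \<in> S" for x
  proof
    assume "x \<in> Z"
    then show "x \<in> B \<and> x - z \<in> S" by (auto simp: Z_def B_def)
  next
    assume "x \<in> B \<and> x - z \<in> S"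
    then have "x - z \<in> S \<inter> A" by (auto simp: B_def)
    then have "z + (x - z) \<in> Z" unfolding Z_def by (rule imageI)
    then show "x \<in> Z" by simp
  qed
  have eq: "translation_swap A z -` S = X \<union> (Y \<union> Z)"
  proof (rule set_eqI)
    fix x
    have sw: "translation_swap A z x = (if x \<in> A then x + z else if x \<in> B then x - z else x)"
      by (simp add: translation_swap_def B_def)
    consider "x \<in> A" "x \<notin> B" | "x \<notin> A" "x \<in> B" | "x \<notin> A" "x \<notin> B"
      using AB by blast
    then show "x \<in> translation_swap A z -` S \<longleftrightarrow> x \<in> X \<union> (Y \<union> Z)"
      by cases (simp_all add: sw memY memZ X_def)
  qed
  then show "translation_swap A z -` S \<in> sets lebesgue"
    using XYZ by simp
  have "emeasure lebesgue (X \<union> (Y \<union> Z)) = emeasure lebesgue X + (emeasure lebesgue Y + emeasure lebesgue Z)"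
  proof -
    have "X \<inter> (Y \<union> Z) = {}" "Y \<inter> Z = {}"
      using YA ZB AB by (auto simp: X_def)
    then show ?thesis
      using XYZ by (simp add: plus_emeasure[symmetric])
  qed
  also have "\<dots> = emeasure lebesgue X + (emeasure lebesgue (S \<inter> B) + emeasure lebesgue (S \<inter> A))"
    by (simp only: Y_def Z_def emeasure_lebesgue_translation)
  also have "\<dots> = emeasure lebesgue (X \<union> ((S \<inter> B) \<union> (S \<inter> A)))"
  proof -
    have "X \<inter> ((S \<inter> B) \<union> (S \<inter> A)) = {}" "(S \<inter> B) \<inter> (S \<inter> A) = {}"
      using AB by (auto simp: X_def)
    moreover have "S \<inter> B \<in> sets lebesgue" "S \<inter> A \<in> sets lebesgue"
      using A B S by auto
    ultimately show ?thesis
      using XYZ(1) by (subst plus_emeasure[symmetric]) (auto simp: plus_emeasure[symmetric])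
  qed
  also have "X \<union> ((S \<inter> B) \<union> (S \<inter> A)) = S"
    by (auto simp: X_def)
  finally show "emeasure lebesgue (translation_swap A z -` S) = emeasure lebesgue S"
    by (simp only: eq)
qed

lemma translation_swap_measure_preserving:
  assumes A: "A \<in> sets lebesgue" and disj: "A \<inter> (+) z ` A = {}"
  shows "translation_swap A z \<in> lebesgue \<rightarrow>\<^sub>M lebesgue"
    and "distr lebesgue lebesgue (translation_swap A z) = lebesgue"
proof -
  show m: "translation_swap A z \<in> lebesgue \<rightarrow>\<^sub>M lebesgue"
    by (rule measurableI) (use translation_swap_vimage(1)[OF A disj] in simp_all)
  show "distr lebesgue lebesgue (translation_swap A z) = lebesgue"
    by (rule measure_eqI) (use m translation_swap_vimage(2)[OF A disj] in \<open>simp_all add: emeasure_distr\<close>)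
qed

context fractional_domain
begin

text \<open>
  Composing \<open>\<rho>\<close> with the exchange \<open>\<tau>\<close> of two translates yields a rearrangement \<open>\<sigma>\<close>, and since \<open>\<tau>\<close> is a
  measure preserving involution, \<open>2 * (\<integral> \<sigma> g - \<integral> \<rho> g)\<close> is the integral of
  \<open>(\<rho> \<circ> \<tau> - \<rho>) * (g - g \<circ> \<tau>)\<close>, whose factors have the same sign.
\<close>
lemma swap_improves:
  fixes g :: "'a \<Rightarrow> real"
  assumes \<rho>0: "bounded_weight \<Omega> C \<rho>0" and \<rho>: "\<rho> \<in> rearrangements \<Omega> \<rho>0"
    and g: "integrable M g"
    and posA: "emeasure lebesgue {x \<in> \<Omega>. \<rho> x > q \<and> g x \<le> c} \<noteq> 0"
    and posB: "emeasure lebesgue {x \<in> \<Omega>. \<rho> x \<le> q \<and> g x \<ge> c} \<noteq> 0"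
  shows "\<exists>\<sigma>\<in>rearrangements \<Omega> \<rho>0. (\<integral>x. \<rho> x * g x \<partial>M) \<le> (\<integral>x. \<sigma> x * g x \<partial>M)
    \<and> \<not> (AE x in M. \<sigma> x = \<rho> x)"
proof -
  have \<rho>m: "\<rho> \<in> borel_measurable M"
    and \<rho>eq: "\<And>t. emeasure lebesgue {x \<in> \<Omega>. \<rho> x > t} = emeasure lebesgue {x \<in> \<Omega>. \<rho>0 x > t}"
    using \<rho> by (auto simp: rearrangements_def)
  have gm: "g \<in> borel_measurable M" using g by auto
  note ls\<rho> = domain_level_sets[OF \<rho>m] and lsg = domain_level_sets[OF gm]
  have "{x \<in> \<Omega>. \<rho> x > q} \<inter> {x \<in> \<Omega>. g x \<le> c} \<in> sets lebesgue"
    "{x \<in> \<Omega>. \<rho> x \<le> q} \<inter> {x \<in> \<Omega>. g x \<ge> c} \<in> sets lebesgue"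
    by (intro sets.Int ls\<rho> lsg)+
  moreover have "{x \<in> \<Omega>. \<rho> x > q} \<inter> {x \<in> \<Omega>. g x \<le> c} = {x \<in> \<Omega>. \<rho> x > q \<and> g x \<le> c}"
    "{x \<in> \<Omega>. \<rho> x \<le> q} \<inter> {x \<in> \<Omega>. g x \<ge> c} = {x \<in> \<Omega>. \<rho> x \<le> q \<and> g x \<ge> c}" by blast+
  ultimately have "{x \<in> \<Omega>. \<rho> x > q \<and> g x \<le> c} \<in> sets lebesgue" "{x \<in> \<Omega>. \<rho> x \<le> q \<and> g x \<ge> c} \<in> sets lebesgue"
    by simp_all
  then have lm: "{x \<in> \<Omega>. \<rho> x > q \<and> g x \<le> c} \<in> lmeasurable" "{x \<in> \<Omega>. \<rho> x \<le> q \<and> g x \<ge> c} \<in> lmeasurable"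
    by (auto intro: subset_domain_lmeasurable)
  obtain T1 where T1: "closed T1" "T1 \<subseteq> {x \<in> \<Omega>. \<rho> x > q \<and> g x \<le> c}" "emeasure lebesgue T1 \<noteq> 0"
    using closed_subset_positive_measure[OF lm(1) posA] by blast
  obtain T2 where T2: "closed T2" "T2 \<subseteq> {x \<in> \<Omega>. \<rho> x \<le> q \<and> g x \<ge> c}" "emeasure lebesgue T2 \<noteq> 0"
    using closed_subset_positive_measure[OF lm(2) posB] by blast
  obtain z where z: "emeasure lebesgue (T1 \<inter> {x. x + z \<in> T2}) \<noteq> 0"
    using translate_overlap[OF T1(1,3) T2(1,3)] by blast
  \<comment> \<open>Closed pieces of the two sets such that \<open>A\<close> lies in the first and \<open>A + z\<close> in the second.\<close>
  define A where "A = T1 \<inter> {x. x + z \<in> T2}"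
  have "closed {x. x + z \<in> T2}"
    using continuous_closed_vimage[OF T2(1), of "\<lambda>x. x + z"] by (simp add: vimage_def continuous_intros)
  then have "closed A"
    unfolding A_def using T1(1) by (rule closed_Int[rotated])
  then have As: "A \<in> sets lebesgue" by auto
  have Amem: "x \<in> \<Omega>" "\<rho> x > q" "g x \<le> c" "x + z \<in> \<Omega>" "\<rho> (x + z) \<le> q" "g (x + z) \<ge> c" if "x \<in> A" for x
    using that T1(2) T2(2) by (auto simp: A_def)
  have disj: "A \<inter> (+) z ` A = {}"
  proof -
    have "\<rho> y \<le> q" if "y \<in> (+) z ` A" for y
      using that Amem(5) by (auto simp: add.commute)
    then show ?thesis using Amem(2) by (meson disjoint_iff not_le)
  qed
  define \<tau> where "\<tau> = translation_swap A z"
  have \<tau>m[measurable]: "\<tau> \<in> lebesgue \<rightarrow>\<^sub>M lebesgue" and \<tau>d: "distr lebesgue lebesgue \<tau> = lebesgue"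
    unfolding \<tau>_def by (rule translation_swap_measure_preserving[OF As disj])+
  have \<tau>\<tau>: "\<tau> (\<tau> x) = x" for x
    unfolding \<tau>_def by (rule translation_swap_involution[OF disj])
  have \<tau>A: "\<tau> x = x + z" if "x \<in> A" for x
    using that by (simp add: \<tau>_def translation_swap_def)
  have cases: "x \<in> A \<or> \<tau> x \<in> A \<or> \<tau> x = x" for x
    by (auto simp: \<tau>_def translation_swap_def)
  have \<tau>\<Omega>1: "\<tau> x \<in> \<Omega>" if x: "x \<in> \<Omega>" for x
    using cases[of x] Amem(1)[of "\<tau> x"] Amem(4)[of x] \<tau>A[of x] x by metis
  have \<tau>\<Omega>: "\<tau> x \<in> \<Omega> \<longleftrightarrow> x \<in> \<Omega>" for x
    using \<tau>\<Omega>1[of x] \<tau>\<Omega>1[of "\<tau> x"] by (auto simp: \<tau>\<tau>)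
  define \<sigma> where "\<sigma> x = \<rho> (\<tau> x)" for x
  have \<sigma>lev: "{x \<in> \<Omega>. \<sigma> x > t} = \<tau> -` {x \<in> \<Omega>. \<rho> x > t}" for t
    by (auto simp: \<sigma>_def \<tau>\<Omega>)
  have \<sigma>: "\<sigma> \<in> rearrangements \<Omega> \<rho>0"
    unfolding rearrangements_def mem_Collect_eq
  proof (intro conjI allI)
    show "\<sigma> \<in> borel_measurable M"
      by (rule measurable_onI)
        (unfold \<sigma>lev \<tau>_def, rule translation_swap_vimage(1)[OF As disj ls\<rho>(1)])
    show "emeasure lebesgue {x \<in> \<Omega>. \<sigma> x > t} = emeasure lebesgue {x \<in> \<Omega>. \<rho>0 x > t}" for t
      unfolding \<sigma>lev \<tau>_def translation_swap_vimage(2)[OF As disj ls\<rho>(1)] by (rule \<rho>eq)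
  qed
  have b\<rho>: "bounded_weight \<Omega> C \<rho>" and b\<sigma>: "bounded_weight \<Omega> C \<sigma>"
    using rearrangement_bounded[OF \<rho>0] \<rho> \<sigma> by blast+
  define h where "h x = indicator \<Omega> x * (\<sigma> x * g x)" for x
  define k where "k x = indicator \<Omega> x * (\<rho> x * g x)" for x
  have hi: "integrable lebesgue h" and hint: "(\<integral>x. h x \<partial>lebesgue) = (\<integral>x. \<sigma> x * g x \<partial>M)"
    using weight_integrable[OF b\<sigma> g] by (simp_all add: h_def[abs_def] integrable_restrict_space integral_restrict_space)
  have ki: "integrable lebesgue k" and kint: "(\<integral>x. k x \<partial>lebesgue) = (\<integral>x. \<rho> x * g x \<partial>M)"
    using weight_integrable[OF b\<rho> g] by (simp_all add: k_def[abs_def] integrable_restrict_space integral_restrict_space)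
  have comp: "integrable lebesgue (\<lambda>x. f (\<tau> x))" "(\<integral>x. f (\<tau> x) \<partial>lebesgue) = (\<integral>x. f x \<partial>lebesgue)"
    if "integrable lebesgue f" for f :: "'a \<Rightarrow> real"
  proof -
    have fm: "f \<in> borel_measurable lebesgue" using that by auto
    show "integrable lebesgue (\<lambda>x. f (\<tau> x))"
      using integrable_distr_eq[OF \<tau>m fm] that by (simp add: \<tau>d)
    show "(\<integral>x. f (\<tau> x) \<partial>lebesgue) = (\<integral>x. f x \<partial>lebesgue)"
      using integral_distr[OF \<tau>m fm] by (simp add: \<tau>d)
  qed
  have pt: "0 \<le> h x - k x + h (\<tau> x) - k (\<tau> x)" for x
  proof (cases "x \<in> \<Omega>")
    case True
    then have e: "h x - k x + h (\<tau> x) - k (\<tau> x) = (\<rho> (\<tau> x) - \<rho> x) * (g x - g (\<tau> x))"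
      using \<tau>\<Omega>[of x] by (simp add: h_def k_def \<sigma>_def \<tau>\<tau> algebra_simps)
    consider "x \<in> A" | "\<tau> x \<in> A" | "\<tau> x = x" using cases[of x] by blast
    then show ?thesis
    proof cases
      case 1
      have "\<rho> (\<tau> x) - \<rho> x \<le> 0" "g x - g (\<tau> x) \<le> 0"
        using Amem[OF 1] \<tau>A[OF 1] by simp_all
      then show ?thesis unfolding e by (rule mult_nonpos_nonpos)
    next
      case 2
      have "\<tau> x + z = x" using \<tau>A[OF 2] \<tau>\<tau>[of x] by simp
      then have "0 \<le> \<rho> (\<tau> x) - \<rho> x" "0 \<le> g x - g (\<tau> x)"
        using Amem[OF 2] by simp_all
      then show ?thesis unfolding e by (rule mult_nonneg_nonneg)
    next
      case 3
      show ?thesis unfolding e by (simp add: 3)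
    qed
  next
    case False
    then show ?thesis using \<tau>\<Omega>[of x] by (simp add: h_def k_def)
  qed
  have "0 \<le> (\<integral>x. h x - k x + h (\<tau> x) - k (\<tau> x) \<partial>lebesgue)"
    using pt by (intro integral_nonneg_AE) auto
  also have "\<dots> = 2 * ((\<integral>x. h x \<partial>lebesgue) - (\<integral>x. k x \<partial>lebesgue))"
    using hi ki comp[OF hi] comp[OF ki] by simp
  finally have "(\<integral>x. \<rho> x * g x \<partial>M) \<le> (\<integral>x. \<sigma> x * g x \<partial>M)"
    by (simp add: hint kint)
  moreover have "\<not> (AE x in M. \<sigma> x = \<rho> x)"
  proof
    assume "AE x in M. \<sigma> x = \<rho> x"
    then have "AE x in lebesgue. x \<in> \<Omega> \<longrightarrow> \<sigma> x = \<rho> x"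
      by (simp add: AE_restrict_space_iff)
    then have "AE x in lebesgue. x \<notin> A"
    proof eventually_elim
      case (elim x)
      show ?case
      proof
        assume "x \<in> A"
        then show False using elim Amem[of x] \<tau>A[of x] by (simp add: \<sigma>_def)
      qed
    qed
    then have "A \<in> null_sets lebesgue"
      using AE_iff_null_sets[OF As] by blast
    then show False using z by (auto simp: A_def null_sets_def)
  qed
  ultimately show ?thesis using \<sigma> by blast
qed

text \<open>
  Let \<open>P q c\<close> mean that \<open>{\<rho> \<le> q, g \<ge> c}\<close> is null. It is preserved when \<open>c\<close> grows or \<open>q\<close> decreases, so
  \<open>\<psi> c = Sup {q. P q c}\<close> is nondecreasing. By the assumption, \<open>\<rho> x > q\<close> and \<open>P q (g x)\<close> are equivalent for almost
  every \<open>x\<close>, simultaneously for all rational \<open>q\<close>.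
\<close>
lemma monotone_representation:
  fixes g \<rho> :: "'a \<Rightarrow> real"
  assumes \<rho>: "bounded_weight \<Omega> C \<rho>"
    and sep: "\<And>q c. emeasure lebesgue {x \<in> \<Omega>. \<rho> x > q \<and> g x \<le> c} = 0
      \<or> emeasure lebesgue {x \<in> \<Omega>. \<rho> x \<le> q \<and> g x \<ge> c} = 0"
    and g: "g \<in> borel_measurable M"
  shows "\<exists>\<psi> :: real \<Rightarrow> real. mono \<psi> \<and> (AE x in M. \<rho> x = \<psi> (g x))"
proof -
  have \<rho>m: "\<rho> \<in> borel_measurable M"
    and bd: "AE x in lebesgue. x \<in> \<Omega> \<longrightarrow> \<bar>\<rho> x\<bar> \<le> C"
    using \<rho> by (auto simp: bounded_weight_def AE_restrict_space_iff)
  define Lo where "Lo q c = {x \<in> \<Omega>. \<rho> x > q \<and> g x \<le> c}" for q c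
  define Hi where "Hi q c = {x \<in> \<Omega>. \<rho> x \<le> q \<and> g x \<ge> c}" for q c
  have "Lo q c = {x \<in> \<Omega>. \<rho> x > q} \<inter> {x \<in> \<Omega>. g x \<le> c}"
    "Hi q c = {x \<in> \<Omega>. \<rho> x \<le> q} \<inter> {x \<in> \<Omega>. g x \<ge> c}" for q c
    by (auto simp: Lo_def Hi_def)
  then have sets: "Lo q c \<in> sets lebesgue" "Hi q c \<in> sets lebesgue" for q c
    by (simp_all only:) (intro sets.Int domain_level_sets[OF \<rho>m] domain_level_sets[OF g])+
  define P where "P q c \<longleftrightarrow> Hi q c \<in> null_sets lebesgue" for q c
  have nP: "Lo q c \<in> null_sets lebesgue" if "\<not> P q c" for q c
    using that sep[of q c] sets[of q c] by (auto simp: P_def null_sets_def Lo_def Hi_def)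
  have Pmono: "P q' c'" if "P q c" "q' \<le> q" "c \<le> c'" for q q' c c'
  proof -
    have "Hi q' c' \<subseteq> Hi q c" using that(2,3) by (auto simp: Hi_def)
    then show ?thesis using that(1) sets by (auto simp: P_def intro: null_sets_subset)
  qed
  \<comment> \<open>The exceptional sets are unions of null sets over uncountably many \<open>c\<close>. These null sets are
    monotone in \<open>c\<close>, so a countable cofinal or coinitial set of \<open>c\<close> gives the same union.\<close>
  have cover': "\<exists>D0. countable D0 \<and> D0 \<subseteq> D \<and> (\<forall>d\<in>D. \<exists>c\<in>D0. d \<le> c)" for D :: "real set"
  proof -
    obtain D0 where D0: "countable D0" "D0 \<subseteq> uminus ` D" "\<forall>d\<in>uminus ` D. \<exists>c\<in>D0. c \<le> d"
      using countable_coinitial_subset[of "uminus ` D"] by (elim exE conjE) (rule that)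
    have "uminus ` D0 \<subseteq> D" using D0(2) by force
    moreover have "\<exists>c\<in>uminus ` D0. d \<le> c" if d: "d \<in> D" for d
    proof -
      obtain c where "c \<in> D0" "c \<le> - d" using D0(3) d by blast
      then show ?thesis by (intro bexI[of _ "- c"]) auto
    qed
    moreover have "countable (uminus ` D0)" using D0(1) by simp
    ultimately show ?thesis by (intro exI[of _ "uminus ` D0"] conjI ballI)
  qed
  have ae1: "AE x in lebesgue. x \<in> \<Omega> \<and> \<rho> x \<le> q \<longrightarrow> \<not> P q (g x)" for q
  proof -
    obtain D0 where D0: "countable D0" "D0 \<subseteq> {c. P q c}" "\<forall>d\<in>{c. P q c}. \<exists>c\<in>D0. c \<le> d"
      using countable_coinitial_subset[of "{c. P q c}"] by (elim exE conjE) (rule that)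
    have "(\<Union>c\<in>D0. Hi q c) \<in> null_sets lebesgue"
      using D0(1,2) by (intro null_sets_UN') (auto simp: P_def)
    then have "AE x in lebesgue. x \<notin> (\<Union>c\<in>D0. Hi q c)"
      by (rule AE_not_in)
    then show ?thesis
    proof eventually_elim
      case (elim x)
      show ?case
      proof (intro impI notI)
        assume "x \<in> \<Omega> \<and> \<rho> x \<le> q" "P q (g x)"
        then obtain c where "c \<in> D0" "c \<le> g x" using D0(3) by blast
        then show False using elim \<open>x \<in> \<Omega> \<and> \<rho> x \<le> q\<close> by (auto simp: Hi_def)
      qed
    qed
  qed
  have ae2: "AE x in lebesgue. x \<in> \<Omega> \<and> \<rho> x > q \<longrightarrow> P q (g x)" for q
  proof -
    obtain D0 where D0: "countable D0" "D0 \<subseteq> {c. \<not> P q c}" "\<forall>d\<in>{c. \<not> P q c}. \<exists>c\<in>D0. d \<le> c"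
      using cover'[of "{c. \<not> P q c}"] by (elim exE conjE) (rule that)
    have "(\<Union>c\<in>D0. Lo q c) \<in> null_sets lebesgue"
      using D0(1,2) nP by (intro null_sets_UN') auto
    then have "AE x in lebesgue. x \<notin> (\<Union>c\<in>D0. Lo q c)"
      by (rule AE_not_in)
    then show ?thesis
    proof eventually_elim
      case (elim x)
      show ?case
      proof (rule impI, rule ccontr)
        assume x: "x \<in> \<Omega> \<and> \<rho> x > q" and "\<not> P q (g x)"
        then obtain c where "c \<in> D0" "g x \<le> c" using D0(3) by blast
        then show False using elim x by (auto simp: Lo_def)
      qed
    qed
  qed
  \<comment> \<open>The bound \<open>C\<close> and the element \<open>- C - 1\<close>, which lies below all values of \<open>\<rho>\<close>, keep the supremum
    meaningful where \<open>P q c\<close> holds for all \<open>q\<close> or for none.\<close>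
  define X where "X c = insert (- C - 1) {q. q \<le> C \<and> P q c}" for c
  define \<psi> where "\<psi> c = Sup (X c)" for c
  have Xbdd: "bdd_above (X c)" for c
    by (rule bdd_aboveI[of _ "max (- C - 1) C"]) (auto simp: X_def)
  have "mono \<psi>"
  proof (rule monoI)
    fix a b :: real assume "a \<le> b"
    then have "X a \<subseteq> X b" using Pmono by (auto simp: X_def)
    then show "\<psi> a \<le> \<psi> b"
      unfolding \<psi>_def using Xbdd by (intro cSup_subset_mono) (auto simp: X_def)
  qed
  moreover have "AE x in M. \<rho> x = \<psi> (g x)"
  proof -
    have "AE x in lebesgue. \<forall>q\<in>\<rat>. x \<in> \<Omega> \<and> \<rho> x \<le> q \<longrightarrow> \<not> P q (g x)"
      using ae1 countable_rat by (subst AE_ball_countable) auto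
    moreover have "AE x in lebesgue. \<forall>q\<in>\<rat>. x \<in> \<Omega> \<and> \<rho> x > q \<longrightarrow> P q (g x)"
      using ae2 countable_rat by (subst AE_ball_countable) auto
    ultimately have "AE x in lebesgue. x \<in> \<Omega> \<longrightarrow> \<rho> x = \<psi> (g x)"
      using bd
    proof eventually_elim
      case (elim x)
      show ?case
      proof (intro impI antisym)
        assume x: "x \<in> \<Omega>"
        then have C: "- C \<le> \<rho> x" "\<rho> x \<le> C" using elim(3) by auto
        show "\<rho> x \<le> \<psi> (g x)"
        proof (rule ccontr)
          assume "\<not> \<rho> x \<le> \<psi> (g x)"
          then obtain q where q: "q \<in> \<rat>" "\<psi> (g x) < q" "q < \<rho> x"
            using Rats_dense_in_real[of "\<psi> (g x)" "\<rho> x"] by auto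
          then have "q \<in> X (g x)" using elim(2) x C by (auto simp: X_def)
          then have "q \<le> \<psi> (g x)" unfolding \<psi>_def using Xbdd by (rule cSup_upper)
          then show False using q by simp
        qed
        show "\<psi> (g x) \<le> \<rho> x"
        proof (rule ccontr)
          assume "\<not> \<psi> (g x) \<le> \<rho> x"
          then obtain q where q: "q \<in> \<rat>" "\<rho> x < q" "q < \<psi> (g x)"
            using Rats_dense_in_real[of "\<rho> x" "\<psi> (g x)"] by auto
          have "\<not> P q (g x)" using elim(1) q x by auto
          then have "r \<le> q" if "r \<in> X (g x)" for r
            using that Pmono[of r "g x" q "g x"] C q(2) by (force simp: X_def)
          then have "\<psi> (g x) \<le> q"
            unfolding \<psi>_def by (intro cSup_least) (auto simp: X_def)
          then show False using q by simp
        qed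
      qed
    qed
    then show ?thesis by (simp add: AE_restrict_space_iff)
  qed
  ultimately show ?thesis by blast
qed

end

section \<open>Minimizers of the first eigenvalue\<close>

context fractional_domain
begin

lemma weight_form_square: "W \<rho> u u = (\<integral>x. \<rho> x * (u x)\<^sup>2 \<partial>M)"
  by (simp add: weight_form_def power2_eq_square mult.assoc)

lemma integrable_H0s_square: "u \<in> H0s s \<Omega> \<Longrightarrow> integrable M (\<lambda>x. (u x)\<^sup>2)"
  using H0s_on by (simp add: square_integrable_def)

lemma orthogonal_imp_nonpositive:
  assumes w: "integrable M w"
    and orth: "\<And>\<phi>. \<phi> \<in> H0s s \<Omega> \<Longrightarrow> (\<integral>x. w x * \<phi> x \<partial>M) = 0"
  shows "AE x in M. w x \<le> 0"
proof (rule ccontr)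
  assume neg: "\<not> ?thesis"
  have wm: "w \<in> borel_measurable M" using w by auto
  have "emeasure lebesgue {x \<in> \<Omega>. w x > 0} \<noteq> 0"
  proof
    assume "emeasure lebesgue {x \<in> \<Omega>. w x > 0} = 0"
    then have "{x \<in> \<Omega>. w x > 0} \<in> null_sets lebesgue"
      using domain_level_sets(1)[OF wm] by (simp add: null_sets_def)
    then have "AE x in lebesgue. x \<notin> {x \<in> \<Omega>. w x > 0}"
      by (rule AE_not_in)
    then have "AE x in lebesgue. x \<in> \<Omega> \<longrightarrow> w x \<le> 0"
      by eventually_elim auto
    then show False using neg by (simp add: AE_restrict_space_iff)
  qed
  then obtain v where "v \<in> H0s s \<Omega>" "0 < (\<integral>x. w x * v x ^ 1 \<partial>M)"
    using bump_test_function[OF w, of 1] by auto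
  then show False using orth[of v] by simp
qed

lemma orthogonal_imp_zero:
  assumes w: "integrable M w"
    and orth: "\<And>\<phi>. \<phi> \<in> H0s s \<Omega> \<Longrightarrow> (\<integral>x. w x * \<phi> x \<partial>M) = 0"
  shows "AE x in M. w x = 0"
proof -
  have "AE x in M. w x \<le> 0"
    by (rule orthogonal_imp_nonpositive) (use w orth in auto)
  moreover have "AE x in M. - w x \<le> 0"
    by (rule orthogonal_imp_nonpositive) (use w orth in auto)
  ultimately show ?thesis
    by eventually_elim auto
qed

text \<open>
  The choice in the definition has a witness, namely the absolute value of a maximizer. Conversely every
  normalized eigenfunction for the least positive eigenvalue is a maximizer.
\<close>
lemma first_eigenfunction_properties:
  assumes \<rho>: "bounded_weight \<Omega> C \<rho>" and pos: "emeasure lebesgue {x \<in> \<Omega>. \<rho> x > 0} \<noteq> 0"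
  defines "u \<equiv> first_eigenfunction s \<Omega> \<rho>"
  shows "maximizer s \<Omega> \<rho> u" and "AE x in M. u x > 0"
proof -
  obtain u0 where "maximizer s \<Omega> \<rho> u0"
    using maximizer_exists[OF \<rho> pos] by blast
  then have v: "maximizer s \<Omega> \<rho> (\<lambda>x. \<bar>u0 x\<bar>)" (is "maximizer s \<Omega> \<rho> ?v")
    by (rule maximizer_abs)
  have ev: "eigenfunction s \<Omega> \<rho> (lambda1 s \<Omega> \<rho>) ?v"
    using maximizer_eigenfunction[OF \<rho> v] lambda1_eq[OF \<rho> v] by simp
  have "AE x in M. ?v x > 0"
    by (rule strong_maximum_principle[OF \<rho> ev]) simp
  moreover have "H0s_norm s ?v = 1"
    using v by (simp add: H0s_norm_def maximizer_def)
  ultimately have "\<exists>w. eigenfunction s \<Omega> \<rho> (lambda1 s \<Omega> \<rho>) w \<and> (AE x in M. w x > 0) \<and> H0s_norm s w = 1"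
    using ev by (intro exI[of _ ?v] conjI)
  then have "eigenfunction s \<Omega> \<rho> (lambda1 s \<Omega> \<rho>) u \<and> (AE x in M. u x > 0) \<and> H0s_norm s u = 1"
    unfolding u_def first_eigenfunction_def by (rule someI_ex)
  then have u: "eigenfunction s \<Omega> \<rho> (lambda1 s \<Omega> \<rho>) u" "H0s_norm s u = 1"
    and upos: "AE x in M. u x > 0" by auto
  note e = eigenfunction_inner_self[OF u(1)]
  have u1: "H0s_inner s u u = 1"
    using u(2) by (simp add: H0s_norm_def)
  have "0 < W \<rho> ?v ?v" using v by (simp add: maximizer_def)
  then have "W \<rho> u u = W \<rho> ?v ?v"
    using e(3) u1 lambda1_eq[OF \<rho> v] by (simp add: field_simps)
  then show "maximizer s \<Omega> \<rho> u"
    using v e(1) u1 unfolding maximizer_def by simp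
  show "AE x in M. u x > 0" by (rule upos)
qed

lemma eigenfunction_test:
  "eigenfunction s \<Omega> \<rho> \<mu> u \<Longrightarrow> \<phi> \<in> H0s s \<Omega> \<Longrightarrow> H0s_inner s u \<phi> = \<mu> * W \<rho> u \<phi>"
  by (simp add: eigenfunction_def weight_form_def)

text \<open>
  The two weak equations of \<open>u\<close> have the same eigenvalue, so \<open>(\<sigma> - \<rho>) u\<close> is orthogonal to all test
  functions. This is the strict convexity of \<open>1 / \<lambda>\<^sub>1\<close> in disguise.
\<close>
lemma common_maximizer_unique_weight:
  assumes \<rho>: "bounded_weight \<Omega> C \<rho>" and \<sigma>: "bounded_weight \<Omega> C \<sigma>"
    and u: "maximizer s \<Omega> \<rho> u" "maximizer s \<Omega> \<sigma> u" and eq: "W \<sigma> u u = W \<rho> u u"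
    and pos: "AE x in M. u x > 0"
  shows "AE x in M. \<sigma> x = \<rho> x"
proof -
  have uH: "u \<in> H0s s \<Omega>" and m: "W \<rho> u u > 0" using u(1) by (auto simp: maximizer_def)
  have same: "W \<sigma> u \<phi> = W \<rho> u \<phi>" if \<phi>: "\<phi> \<in> H0s s \<Omega>" for \<phi>
  proof -
    have "1 / W \<rho> u u * W \<rho> u \<phi> = 1 / W \<sigma> u u * W \<sigma> u \<phi>"
      unfolding eigenfunction_test[OF maximizer_eigenfunction[OF \<rho> u(1)] \<phi>, symmetric]
        eigenfunction_test[OF maximizer_eigenfunction[OF \<sigma> u(2)] \<phi>, symmetric] ..
    then show ?thesis using m unfolding eq by simp
  qed
  have one: "integrable M u"
  proof -
    have "square_integrable M (\<lambda>x. 1)"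
      using M.integrable_const by (simp add: square_integrable_def)
    from square_integrable_mult[OF H0s_on[OF uH] this] show ?thesis by simp
  qed
  have w: "integrable M (\<lambda>x. (\<sigma> x - \<rho> x) * u x)"
    using weight_integrable[OF \<rho> one] weight_integrable[OF \<sigma> one] by (simp add: left_diff_distrib)
  have "AE x in M. (\<sigma> x - \<rho> x) * u x = 0"
  proof (rule orthogonal_imp_zero[OF w])
    fix \<phi> assume \<phi>: "\<phi> \<in> H0s s \<Omega>"
    have "(\<integral>x. (\<sigma> x - \<rho> x) * u x * \<phi> x \<partial>M) = W \<sigma> u \<phi> - W \<rho> u \<phi>"
      unfolding weight_form_def
      using weight_form_integrable[OF \<rho> uH \<phi>] weight_form_integrable[OF \<sigma> uH \<phi>]
      by (simp add: left_diff_distrib)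
    then show "(\<integral>x. (\<sigma> x - \<rho> x) * u x * \<phi> x \<partial>M) = 0"
      using same[OF \<phi>] by simp
  qed
  then show ?thesis using pos by eventually_elim auto
qed

context
  fixes \<rho>0 :: "'a \<Rightarrow> real" and C :: real
  assumes \<rho>0: "bounded_weight \<Omega> C \<rho>0" and \<rho>0_pos: "emeasure lebesgue {x \<in> \<Omega>. \<rho>0 x > 0} \<noteq> 0"
begin

lemma rearrangement_positive:
  "\<rho> \<in> rearrangements \<Omega> \<rho>0 \<Longrightarrow> emeasure lebesgue {x \<in> \<Omega>. \<rho> x > 0} \<noteq> 0"
  using \<rho>0_pos by (simp add: rearrangements_def)

lemma lambda1_minimizer_exists: "\<exists>\<rho>. lambda1_minimizer s \<Omega> \<rho>0 \<rho>"
proof -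
  have b: "bounded_weight \<Omega> \<bar>C\<bar> \<rho>" if "\<rho> \<in> rearrangements \<Omega> \<rho>0" for \<rho>
    using rearrangement_bounded[OF \<rho>0 that] by (auto simp: bounded_weight_def)
  have "\<rho>0 \<in> rearrangements \<Omega> \<rho>0"
    using \<rho>0 by (simp add: rearrangements_def bounded_weight_def)
  then have ne: "rearrangements \<Omega> \<rho>0 \<noteq> {}" by blast
  have "\<exists>\<sigma>\<in>rearrangements \<Omega> \<rho>0. \<forall>\<rho>\<in>rearrangements \<Omega> \<rho>0. W \<rho> f f \<le> W \<sigma> f f"
    if f: "f \<in> H0s s \<Omega>" for f
    unfolding weight_form_square
    by (rule hardy_littlewood_maximizer[OF \<rho>0 integrable_H0s_square[OF f]]) simp
  from joint_maximizer_exists[OF ne abs_ge_zero b this]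
  obtain \<sigma> f where \<sigma>: "\<sigma> \<in> rearrangements \<Omega> \<rho>0" and f: "f \<in> H0s s \<Omega>" "H0s_inner s f f \<le> 1"
    and max: "\<And>\<rho> v. \<rho> \<in> rearrangements \<Omega> \<rho>0 \<Longrightarrow> v \<in> H0s s \<Omega> \<Longrightarrow> H0s_inner s v v \<le> 1 \<Longrightarrow> W \<rho> v v \<le> W \<sigma> f f"
    by blast
  have mf: "maximizer s \<Omega> \<sigma> f"
    using max[OF \<sigma>] by (intro maximizerI[OF b[OF \<sigma>] rearrangement_positive[OF \<sigma>] f])
  have "lambda1 s \<Omega> \<sigma> \<le> lambda1 s \<Omega> \<rho>" if \<rho>: "\<rho> \<in> rearrangements \<Omega> \<rho>0" for \<rho>
  proof -
    obtain u where u: "maximizer s \<Omega> \<rho> u"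
      using maximizer_exists[OF b[OF \<rho>] rearrangement_positive[OF \<rho>]] by blast
    then have "0 < W \<rho> u u" "W \<rho> u u \<le> W \<sigma> f f"
      using max[OF \<rho>, of u] by (auto simp: maximizer_def)
    then show ?thesis
      unfolding lambda1_eq[OF b[OF \<rho>] u] lambda1_eq[OF b[OF \<sigma>] mf] by (intro divide_left_mono) auto
  qed
  then show ?thesis using \<sigma> by (auto simp: lambda1_minimizer_def)
qed

text \<open>
  The functional \<open>\<sigma> \<mapsto> \<integral> \<sigma> u\<^sup>2\<close> sees \<open>u\<close> only through its square, so a representation as a function of
  \<open>g = u\<^sup>2\<close> comes first. Precomposing with \<open>t \<mapsto> (max 0 t)\<^sup>2\<close>, which is nondecreasing on the whole line, gives a function of \<open>u\<close> itself.
\<close>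
lemma lambda1_minimizer_monotone:
  assumes min: "lambda1_minimizer s \<Omega> \<rho>0 \<rho>"
  shows "\<exists>\<psi> :: real \<Rightarrow> real. mono \<psi> \<and>
    (AE x in M. \<rho> x = \<psi> (first_eigenfunction s \<Omega> \<rho> x))"
proof -
  have \<rho>: "\<rho> \<in> rearrangements \<Omega> \<rho>0"
    and least: "\<And>\<sigma>. \<sigma> \<in> rearrangements \<Omega> \<rho>0 \<Longrightarrow> lambda1 s \<Omega> \<rho> \<le> lambda1 s \<Omega> \<sigma>"
    using min by (auto simp: lambda1_minimizer_def)
  note b = rearrangement_bounded[OF \<rho>0] and pos = rearrangement_positive
  define u where "u = first_eigenfunction s \<Omega> \<rho>"
  have u: "maximizer s \<Omega> \<rho> u" and upos: "AE x in M. u x > 0"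
    unfolding u_def by (rule first_eigenfunction_properties[OF b[OF \<rho>] pos[OF \<rho>]])+
  have uH: "u \<in> H0s s \<Omega>" and u1: "H0s_inner s u u = 1" and m: "W \<rho> u u > 0"
    using u by (auto simp: maximizer_def)
  have unique: "AE x in M. \<sigma> x = \<rho> x"
    if \<sigma>: "\<sigma> \<in> rearrangements \<Omega> \<rho>0" and ge: "W \<rho> u u \<le> W \<sigma> u u" for \<sigma>
  proof -
    obtain v where v: "maximizer s \<Omega> \<sigma> v"
      using maximizer_exists[OF b[OF \<sigma>] pos[OF \<sigma>]] by blast
    have vm: "0 < W \<sigma> v v" and vmax: "\<And>w. w \<in> H0s s \<Omega> \<Longrightarrow> W \<sigma> w w \<le> W \<sigma> v v * H0s_inner s w w"
      using v by (auto simp: maximizer_def)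
    have "1 / W \<rho> u u \<le> 1 / W \<sigma> v v"
      using least[OF \<sigma>] unfolding lambda1_eq[OF b[OF \<rho>] u] lambda1_eq[OF b[OF \<sigma>] v] .
    then have "W \<sigma> v v \<le> W \<rho> u u"
      using m vm by (simp add: field_simps)
    moreover have "W \<sigma> u u \<le> W \<sigma> v v"
      using vmax[OF uH] u1 by simp
    ultimately have eq: "W \<sigma> u u = W \<rho> u u" "W \<sigma> u u = W \<sigma> v v"
      using ge by linarith+
    have "maximizer s \<Omega> \<sigma> u"
      unfolding maximizer_def eq(2) using uH u1 vm vmax by blast
    then show ?thesis
      by (rule common_maximizer_unique_weight[OF b[OF \<rho>] b[OF \<sigma>] u _ eq(1) upos])
  qed
  define g where "g x = (u x)\<^sup>2" for x
  have g: "integrable M g"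
    unfolding g_def by (rule integrable_H0s_square[OF uH])
  have sep: "emeasure lebesgue {x \<in> \<Omega>. \<rho> x > q \<and> g x \<le> c} = 0
      \<or> emeasure lebesgue {x \<in> \<Omega>. \<rho> x \<le> q \<and> g x \<ge> c} = 0" for q c
  proof (rule ccontr)
    assume "\<not> ?thesis"
    then obtain \<sigma> where \<sigma>: "\<sigma> \<in> rearrangements \<Omega> \<rho>0"
        "(\<integral>x. \<rho> x * g x \<partial>M) \<le> (\<integral>x. \<sigma> x * g x \<partial>M)"
        "\<not> (AE x in M. \<sigma> x = \<rho> x)"
      using swap_improves[OF \<rho>0 \<rho> g, of q c] by blast
    then have "W \<rho> u u \<le> W \<sigma> u u"
      by (simp add: weight_form_square g_def)
    then show False using unique[OF \<sigma>(1)] \<sigma>(3) by blast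
  qed
  obtain \<psi> where \<psi>: "mono \<psi>" "AE x in M. \<rho> x = \<psi> (g x)"
    using monotone_representation[OF b[OF \<rho>] sep borel_measurable_integrable[OF g]] by blast
  define \<psi>' where "\<psi>' t = \<psi> ((max 0 t)\<^sup>2)" for t
  have "mono \<psi>'"
  proof (rule monoI)
    fix a b :: real assume "a \<le> b"
    then have "(max 0 a)\<^sup>2 \<le> (max 0 b)\<^sup>2" by (intro power_mono) auto
    then show "\<psi>' a \<le> \<psi>' b" unfolding \<psi>'_def using \<psi>(1) by (rule monoD[rotated])
  qed
  moreover have "AE x in M. \<rho> x = \<psi>' (u x)"
    using \<psi>(2) upos by eventually_elim (simp add: \<psi>'_def g_def max_def)
  ultimately show ?thesis unfolding u_def by blast
qed

end

end

theorem theorem4p4: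
  fixes \<Omega> :: "'a::euclidean_space set" and s :: real and \<rho>0 :: "'a \<Rightarrow> real"
  assumes "DIM('a) \<ge> 2"
    and "0 < s" and "s < 1"
    and "open \<Omega>" and "connected \<Omega>" and "\<Omega> \<noteq> {}" and "bounded \<Omega>" and "C2_boundary \<Omega>"
    and "\<rho>0 \<in> Linfty \<Omega>"
    and "emeasure lebesgue {x \<in> \<Omega>. \<rho>0 x > 0} > 0"
  shows "(\<exists>\<rho>. lambda1_minimizer s \<Omega> \<rho>0 \<rho>) \<and>
    (\<forall>\<rho>. lambda1_minimizer s \<Omega> \<rho>0 \<rho> \<longrightarrow>
      (\<exists>\<psi> :: real \<Rightarrow> real. mono \<psi> \<and>
        (AE x in lebesgue_on \<Omega>. \<rho> x = \<psi> (first_eigenfunction s \<Omega> \<rho> x))))"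
proof -
  interpret fractional_domain \<Omega> s
    by unfold_locales fact+
  obtain C where C: "bounded_weight \<Omega> C \<rho>0"
    using assms(9) by (auto simp: Linfty_def bounded_weight_def)
  have pos: "emeasure lebesgue {x \<in> \<Omega>. \<rho>0 x > 0} \<noteq> 0"
    using assms(10) by simp
  show ?thesis
    using lambda1_minimizer_exists[OF C pos] lambda1_minimizer_monotone[OF C pos] by blast
qed

end
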